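(* The monoid ${\cal M}^{\sf P}_{\sf poly} = {\cal RM}^{\sf P}/\!\equiv_{\sf poly}$ has evaluation elements and is finitely generated.
   Context: Let $A=\{0,1\}$, and let $A^*$ be the set of all finite words over $A$ (including the empty word), $|x|$ the length of $x$. "Function" means partial function; ${\sf Dom}(f)$ is the domain of $f$. For words $v,w$: $v \parallel_{\sf pref} w$ means that one of $v,w$ is a prefix of the other. A prefix code is a set $P\subset A^*$ in which no two distinct elements are prefix-comparable. A right ideal is a set $R\subseteq A^*$ with $RA^*=R$; every right ideal $R$ equals $PA^*$ for a unique prefix code $P$. A function $f:A^*\to A^*$ is polynomially balanced iff there is a polynomial $p$ such that $|f(x)|\le p(|x|)$ and $|x|\le p(|f(x)|)$ for all $x\in{\sf Dom}(f)$. ${\sf fP}$ is the monoid of all polynomially balanced partial functions $A^*\to A^*$ computable by deterministic Turing machines in polynomial time. A right-ideal morphism is a partial function $h:A^*\to A^*$ such that ${\sf Dom}(h)$ is a right ideal and $h(xw)=h(x)\,w$ for all $x\in{\sf Dom}(h)$, $w\in A^*$. ${\sf domC}(h)$ is the prefix code that generates ${\sf Dom}(h)$ as a right ideal. ${\cal RM}^{\sf P}$ is the monoid (under composition) of all $f\in{\sf fP}$ that are right-ideal morphisms. For $L_1,L_2\subseteq A^*$: $L_1\equiv_{\sf end}L_2$ iff $L_1A^*$ and $L_2A^*$ intersect (i.e., meet in a nonempty set) the same right ideals of $A^*$. For prefix codes $P_1,P_2$: $P_1\equiv_{\sf poly}P_2$ iff $P_1\equiv_{\sf end}P_2$ and there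 is a polynomial $\tau$ with non-negative integer coefficients such that for all $x_1\in P_1$, $x_2\in P_2$ with $x_1\parallel_{\sf pref}x_2$: $|x_1|\le\tau(|x_2|)$ and $|x_2|\le\tau(|x_1|)$. For right-ideal morphisms: $f\equiv_{\sf poly}g$ iff ${\sf domC}(f)\equiv_{\sf poly}{\sf domC}(g)$ and $f(x)=g(x)$ for all $x\in{\sf Dom}(f)\cap{\sf Dom}(g)$. The relation $\equiv_{\sf poly}$ is a congruence on ${\cal RM}^{\sf P}$; $[f]$ denotes the $\equiv_{\sf poly}$-class of $f$ in ${\cal RM}^{\sf P}$, and ${\cal M}^{\sf P}_{\sf poly}$ denotes the quotient monoid. Encoding: ${\sf code}(0)=00$, ${\sf code}(1)=01$, ${\sf code}(\#)=11$, and ${\sf code}(a_1\ldots a_n)={\sf code}(a_1)\ldots{\sf code}(a_n)$. Evaluation element: a class $[e_0]\in{\cal M}^{\sf P}_{\sf poly}$ is an evaluation element iff there exists $e\in[e_0]$ such that for every $[f_0]\in{\cal M}^{\sf P}_{\sf poly}$ there exists $u\in\{0,1\}^*$ such that $[e({\sf code}(u)\,11\,(\cdot))]=[f_0(\cdot)]$, where ${\sf code}(u)\,11\,(\cdot)$ is the function $x\in\{0,1\}^*\mapsto{\sf code}(u)\,11\,x$ and $e({\sf code}(u)\,11\,(\cdot))$ is its composition with $e$. *)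

theory Defs
  imports Main "HOL-Library.Sublist" "HOL-Computational_Algebra.Polynomial" "HOL-Algebra.Group"
begin

type_synonym word = "bool list"

text \<open>Words over \<open>{0,1}\<close> are boolean lists, with \<open>0 = False\<close> and \<open>1 = True\<close>. Partial functions
  \<open>A* \<rightarrow> A*\<close> are maps \<^typ>\<open>word \<rightharpoonup> word\<close>, composed by \<^const>\<open>map_comp\<close> (the right factor acts first).
  The polynomials that serve as bounds have coefficients in \<^typ>\<open>nat\<close>.\<close>

subsection \<open>Deterministic Turing machines\<close>

text \<open>A machine has \<open>tapes\<close> two-way infinite read-write tapes. The states are the numbers below
  \<open>states\<close> and the tape symbols the numbers below \<open>symbols\<close>; symbol 0 is the blank, and
  1 and 2 stand for the letters 0 and 1. \<open>delta\<close> maps a state and the list of scanned symbols to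
  the new state and, for each tape, the symbol written and the head movement.
  \<open>accept\<close> and \<open>reject\<close> are the only halting states.\<close>

record tm =
  tapes :: nat
  symbols :: nat
  states :: nat
  start :: nat
  accept :: nat
  reject :: nat
  delta :: "nat \<Rightarrow> nat list \<Rightarrow> nat \<times> (nat \<times> int) list"

definition wf_tm :: "tm \<Rightarrow> bool" where
  "wf_tm M \<longleftrightarrow>
     1 \<le> tapes M \<and> 3 \<le> symbols M \<and>
     start M < states M \<and> accept M < states M \<and> reject M < states M \<and> accept M \<noteq> reject M \<and>
     (\<forall>q s. q < states M \<and> length s = tapes M \<and> set s \<subseteq> {..<symbols M} \<longrightarrow>
        fst (delta M q s) < states M \<and>
        length (snd (delta M q s)) = tapes M \<and>
        set (snd (delta M q s)) \<subseteq> {..<symbols M} \<times> {-1, 0, 1})"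

record config =
  state :: nat
  tape :: "nat \<Rightarrow> int \<Rightarrow> nat"
  head :: "nat \<Rightarrow> int"

definition sym_of_bit :: "bool \<Rightarrow> nat" where
  "sym_of_bit b = (if b then 2 else 1)"

definition init_config :: "tm \<Rightarrow> word \<Rightarrow> config" where
  "init_config M x =
     \<lparr>state = start M,
      tape = (\<lambda>j i. if j = 0 \<and> 0 \<le> i \<and> i < int (length x) then sym_of_bit (x ! nat i) else 0),
      head = (\<lambda>j. 0)\<rparr>"

definition halting :: "tm \<Rightarrow> config \<Rightarrow> bool" where
  "halting M c \<longleftrightarrow> state c = accept M \<or> state c = reject M"

text \<open>A halted configuration is a fixed point of \<open>step\<close>.\<close>

definition step :: "tm \<Rightarrow> config \<Rightarrow> config" where
  "step M c =
     (if halting M c then c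
      else let (q, acts) = delta M (state c) (map (\<lambda>j. tape c j (head c j)) [0..<tapes M])
           in \<lparr>state = q,
               tape = (\<lambda>j. if j < tapes M then (tape c j)(head c j := fst (acts ! j)) else tape c j),
               head = (\<lambda>j. if j < tapes M then head c j + snd (acts ! j) else head c j)\<rparr>)"

definition run :: "tm \<Rightarrow> word \<Rightarrow> nat \<Rightarrow> config" where
  "run M x t = (step M ^^ t) (init_config M x)"

text \<open>The output is the word on the last tape that begins at cell 0 and is ended by the first blank.\<close>

definition has_output :: "tm \<Rightarrow> config \<Rightarrow> word \<Rightarrow> bool" where
  "has_output M c y \<longleftrightarrow>
     (\<forall>i < length y. tape c (tapes M - 1) (int i) = sym_of_bit (y ! i)) \<and>
     tape c (tapes M - 1) (int (length y)) = 0"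

text \<open>On inputs outside the domain the machine rejects, within the same time bound.\<close>

definition computes_in_time :: "tm \<Rightarrow> (word \<rightharpoonup> word) \<Rightarrow> (nat \<Rightarrow> nat) \<Rightarrow> bool" where
  "computes_in_time M f T \<longleftrightarrow>
     (\<forall>x. case f x of
            Some y \<Rightarrow> state (run M x (T (length x))) = accept M \<and>
                      has_output M (run M x (T (length x))) y
          | None \<Rightarrow> state (run M x (T (length x))) = reject M)"

definition polytime_computable :: "(word \<rightharpoonup> word) \<Rightarrow> bool" where
  "polytime_computable f \<longleftrightarrow> (\<exists>M (p :: nat poly). wf_tm M \<and> computes_in_time M f (poly p))"

subsection \<open>The monoid of polynomial-time right-ideal morphisms\<close>

definition poly_balanced :: "(word \<rightharpoonup> word) \<Rightarrow> bool" where
  "poly_balanced f \<longleftrightarrow>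
     (\<exists>p :: nat poly. \<forall>x y. f x = Some y \<longrightarrow>
        length y \<le> poly p (length x) \<and> length x \<le> poly p (length y))"

definition fP :: "(word \<rightharpoonup> word) set" where
  "fP = {f. poly_balanced f \<and> polytime_computable f}"

definition right_gen :: "word set \<Rightarrow> word set" where
  "right_gen L = {x @ w | x w. x \<in> L}"

definition right_ideal :: "word set \<Rightarrow> bool" where
  "right_ideal R \<longleftrightarrow> right_gen R = R"

definition pref_comparable :: "word \<Rightarrow> word \<Rightarrow> bool" where
  "pref_comparable v w \<longleftrightarrow> prefix v w \<or> prefix w v"

definition prefix_code :: "word set \<Rightarrow> bool" where
  "prefix_code P \<longleftrightarrow> (\<forall>v\<in>P. \<forall>w\<in>P. v \<noteq> w \<longrightarrow> \<not> pref_comparable v w)"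

lemma right_ideal_generated_by_unique_prefix_code:
  assumes "right_ideal R"
  shows "\<exists>!P. prefix_code P \<and> right_gen P = R"
proof (rule ex_ex1I)
  let ?P = "{x \<in> R. \<forall>y. strict_prefix y x \<longrightarrow> y \<notin> R}"
  have "prefix_code ?P"
    by (auto simp: prefix_code_def pref_comparable_def strict_prefix_def)
  moreover have "right_gen ?P = R"
  proof
    show "right_gen ?P \<subseteq> R"
      using assms by (auto simp: right_ideal_def right_gen_def)
    have "\<exists>y. prefix y x \<and> y \<in> ?P" if "x \<in> R" for x
      using that
    proof (induction "length x" arbitrary: x rule: less_induct)
      case less
      show ?case
      proof (cases "\<exists>y. strict_prefix y x \<and> y \<in> R")
        case True
        then obtain y where y: "strict_prefix y x" "y \<in> R" by blast
        from less.hyps[OF prefix_length_less[OF y(1)] y(2)] y(1) show ?thesis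
          by (meson prefix_order.less_imp_le prefix_order.trans)
      next
        case False
        then show ?thesis using less.prems by blast
      qed
    qed
    then show "R \<subseteq> right_gen ?P"
      unfolding right_gen_def prefix_def by blast
  qed
  ultimately show "\<exists>P. prefix_code P \<and> right_gen P = R" by blast
next
  have sub: "P \<subseteq> Q" if P: "prefix_code P" and eq: "right_gen P = right_gen Q" for P Q
  proof
    have self: "x \<in> right_gen L" if "x \<in> L" for x L
      using that unfolding right_gen_def by (metis (mono_tags, lifting) append_Nil2 mem_Collect_eq)
    fix x assume x: "x \<in> P"
    then obtain q where q: "q \<in> Q" "prefix q x"
      using self[OF x] eq unfolding right_gen_def prefix_def by blast
    then obtain p where p: "p \<in> P" "prefix p q"
      using self[OF q(1)] eq unfolding right_gen_def prefix_def by blast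
    then have "p = x"
      using P x q(2) unfolding prefix_code_def pref_comparable_def
      by (meson prefix_order.trans)
    then show "x \<in> Q"
      using p q prefix_order.antisym by blast
  qed
  fix P Q
  assume "prefix_code P \<and> right_gen P = R" "prefix_code Q \<and> right_gen Q = R"
  then show "P = Q" using sub[of P Q] sub[of Q P] by auto
qed

definition right_ideal_morphism :: "(word \<rightharpoonup> word) \<Rightarrow> bool" where
  "right_ideal_morphism h \<longleftrightarrow>
     right_ideal (dom h) \<and> (\<forall>x y w. h x = Some y \<longrightarrow> h (x @ w) = Some (y @ w))"

definition domC :: "(word \<rightharpoonup> word) \<Rightarrow> word set" where
  "domC h = (THE P. prefix_code P \<and> right_gen P = dom h)"

definition RMP :: "(word \<rightharpoonup> word) set" where
  "RMP = {f \<in> fP. right_ideal_morphism f}"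

subsection \<open>The congruence and the quotient monoid\<close>

definition end_equiv :: "word set \<Rightarrow> word set \<Rightarrow> bool" where
  "end_equiv L1 L2 \<longleftrightarrow>
     (\<forall>R. right_ideal R \<longrightarrow> (right_gen L1 \<inter> R \<noteq> {} \<longleftrightarrow> right_gen L2 \<inter> R \<noteq> {}))"

definition poly_equiv_code :: "word set \<Rightarrow> word set \<Rightarrow> bool" where
  "poly_equiv_code P1 P2 \<longleftrightarrow>
     end_equiv P1 P2 \<and>
     (\<exists>\<tau> :: nat poly. \<forall>x1\<in>P1. \<forall>x2\<in>P2. pref_comparable x1 x2 \<longrightarrow>
        length x1 \<le> poly \<tau> (length x2) \<and> length x2 \<le> poly \<tau> (length x1))"

definition poly_equiv :: "(word \<rightharpoonup> word) \<Rightarrow> (word \<rightharpoonup> word) \<Rightarrow> bool" where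
  "poly_equiv f g \<longleftrightarrow>
     poly_equiv_code (domC f) (domC g) \<and> (\<forall>x \<in> dom f \<inter> dom g. f x = g x)"

definition poly_rel :: "(word \<rightharpoonup> word) rel" where
  "poly_rel = {(f, g). f \<in> RMP \<and> g \<in> RMP \<and> poly_equiv f g}"

definition poly_class :: "(word \<rightharpoonup> word) \<Rightarrow> (word \<rightharpoonup> word) set" where
  "poly_class f = poly_rel `` {f}"

text \<open>Since \<^const>\<open>poly_rel\<close> is a congruence, the union in the product is the single class of
  \<open>f \<circ>\<^sub>m g\<close>, for any representatives \<open>f\<close> and \<open>g\<close>.\<close>

definition MPpoly :: "(word \<rightharpoonup> word) set monoid" where
  "MPpoly =
     \<lparr>carrier = RMP // poly_rel,
      mult = (\<lambda>X Y. \<Union>f\<in>X. \<Union>g\<in>Y. poly_class (f \<circ>\<^sub>m g)),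
      one = poly_class Some\<rparr>"

subsection \<open>Evaluation elements and finite generation\<close>

text \<open>The coding of words over \<open>{0,1}\<close>: \<open>code(0) = 00\<close>, \<open>code(1) = 01\<close>. The end marker
  \<open>code(#) = 11\<close> is written out in \<open>code_prefix\<close>, the function \<open>x \<mapsto> code(u) 11 x\<close>.\<close>

definition code :: "word \<Rightarrow> word" where
  "code u = concat (map (\<lambda>b. [False, b]) u)"

definition code_prefix :: "word \<Rightarrow> (word \<rightharpoonup> word)" where
  "code_prefix u = (\<lambda>x. Some (code u @ [True, True] @ x))"

definition evaluation_element :: "(word \<rightharpoonup> word) set \<Rightarrow> bool" where
  "evaluation_element E \<longleftrightarrow>
     E \<in> carrier MPpoly \<and>
     (\<exists>e\<in>E. \<forall>F \<in> carrier MPpoly. \<exists>u. poly_class (e \<circ>\<^sub>m code_prefix u) = F)"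

definition finitely_generated_monoid :: "('a, 'b) monoid_scheme \<Rightarrow> bool" where
  "finitely_generated_monoid G \<longleftrightarrow>
     monoid G \<and>
     (\<exists>S. finite S \<and> S \<subseteq> carrier G \<and> (\<forall>H. submonoid H G \<and> S \<subseteq> H \<longrightarrow> H = carrier G))"

end

theory Submission
  imports Defs "HOL-Library.Countable_Set"
begin

text \<open>
  A polynomial-time right-ideal morphism may need a polynomial of any degree, but an evaluator
  has one fixed time bound. An evaluator exists nevertheless because the congruence neglects
  suffixes of polynomial length: \<open>f\<close> is equivalent to its restriction to the inputs \<open>x w\<close> with
  \<open>x \<in> dom f\<close> and \<open>|w|\<close> above some polynomial in \<open>|x|\<close>. On these inputs every computation on \<open>x\<close> that
  takes polynomial time is short compared with the whole input, so that \<open>w\<close> can serve as a clock.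

  On input \<open>code(u) 11 x\<close> the evaluator runs the program \<open>u\<close> on the prefixes of \<open>x\<close>, in order of
  length. At the first prefix that \<open>u\<close> accepts, with output \<open>y\<close>, it returns \<open>y\<close> followed by the rest
  of \<open>x\<close>. Every simulated step and every change of prefix is charged to a clock that starts with
  \<open>|x| - |u|\<close>, which bounds the time for all \<open>u\<close>. If the input is lengthened, then the clock can only
  gain, so a result persists and is lengthened by the same word (\<open>search_append\<close>): the evaluator is
  a right-ideal morphism. It is balanced, because success at a prefix \<open>q\<close> leaves a suffix longer
  than \<open>|q| + |u|\<close> (\<open>search_lower\<close>). If \<open>u\<close> computes the morphism \<open>f\<close>, then evaluating \<open>u\<close> yields a
  restriction of \<open>f\<close> (\<open>search_sound\<close>), and by \<open>search_complete\<close> it is defined at all extensions of a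
  point of \<open>dom f\<close> that are polynomially longer. This makes the two equivalent
  (\<open>evaluator_equiv\<close>). Then the monoid is generated by the classes of the evaluator and of the two
  maps \<open>x \<mapsto> 0x\<close> and \<open>x \<mapsto> 1x\<close>, of which every \<open>x \<mapsto> code(u) 11 x\<close> is a product.

  Two models of computation carry the simulation. A queue program is a bit string that
  rewrites a queue of bits; its interpretation needs only counting along the program. Every
  Turing machine is simulated by a queue program with polynomial slowdown
  (\<open>queue_computes_if_polytime\<close>). A stack program is a while program over stacks of bits; it is
  compiled to a Turing machine step by step (\<open>polytime_if_decides\<close>). The interpreter of queue programs, and
  around it the evaluator, are stack programs. The same interpreter, run on two fixed queue
  programs in succession, shows that polynomial-time functions are closed under composition
  (\<open>polytime_comp\<close>), which the monoid structure requires.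
\<close>

section \<open>Polynomial equivalence as mutual absorption of domains\<close>

lemma poly_nat_mono: "m \<le> n \<Longrightarrow> poly p m \<le> poly p n" for p :: "nat poly"
  by (induction p) (auto intro!: add_mono mult_mono)

lemma right_ideal_iff: "right_ideal R \<longleftrightarrow> (\<forall>x\<in>R. \<forall>w. x @ w \<in> R)"
proof
  assume "right_ideal R"
  then show "\<forall>x\<in>R. \<forall>w. x @ w \<in> R"
    unfolding right_ideal_def right_gen_def by blast
next
  assume R: "\<forall>x\<in>R. \<forall>w. x @ w \<in> R"
  have "x \<in> right_gen R" if "x \<in> R" for x
    unfolding right_gen_def using that by (metis (mono_tags, lifting) append_Nil2 mem_Collect_eq)
  with R show "right_ideal R"
    unfolding right_ideal_def right_gen_def by blast
qed

lemma right_ideal_morphism_iff: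
  "right_ideal_morphism h \<longleftrightarrow> (\<forall>x y w. h x = Some y \<longrightarrow> h (x @ w) = Some (y @ w))"
  unfolding right_ideal_morphism_def right_ideal_iff by (auto simp: dom_def)

lemma morphismD: "right_ideal_morphism h \<Longrightarrow> h x = Some y \<Longrightarrow> h (x @ w) = Some (y @ w)"
  unfolding right_ideal_morphism_iff by blast

lemma morphism_dom: "right_ideal_morphism h \<Longrightarrow> x \<in> dom h \<Longrightarrow> prefix x y \<Longrightarrow> y \<in> dom h"
  by (auto simp: prefix_def dest: morphismD)

lemma domC:
  assumes "right_ideal_morphism h"
  shows "prefix_code (domC h)" "right_gen (domC h) = dom h"
proof -
  have "right_ideal (dom h)" using assms by (simp add: right_ideal_morphism_def)
  from theI'[OF right_ideal_generated_by_unique_prefix_code[OF this]]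
  show "prefix_code (domC h)" "right_gen (domC h) = dom h"
    unfolding domC_def by auto
qed

lemma domC_subset: "right_ideal_morphism h \<Longrightarrow> x \<in> domC h \<Longrightarrow> x \<in> dom h"
  using domC(2)[of h] unfolding right_gen_def by (metis (mono_tags, lifting) append_Nil2 mem_Collect_eq)

lemma dom_has_prefix_in_domC:
  "right_ideal_morphism h \<Longrightarrow> x \<in> dom h \<Longrightarrow> \<exists>y\<in>domC h. prefix y x"
  using domC(2)[of h] unfolding right_gen_def prefix_def by blast

lemma domC_minimal:
  assumes "right_ideal_morphism h" "x \<in> domC h" "y \<in> dom h" "prefix y x"
  shows "y = x"
proof -
  obtain z where z: "z \<in> domC h" "prefix z y"
    using dom_has_prefix_in_domC assms by blast
  then have "z = x"
    using domC(1)[OF assms(1)] assms(2,4) unfolding prefix_code_def pref_comparable_def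
    by (meson prefix_order.trans)
  then show ?thesis using z assms(4) prefix_order.antisym by blast
qed

text \<open>Absorption replaces the two conditions on prefix codes in the definition of equivalence. It
  speaks of domains only, and so behaves well under composition and transitivity.\<close>

definition absorbs :: "(word \<rightharpoonup> word) \<Rightarrow> (word \<rightharpoonup> word) \<Rightarrow> bool" where
  "absorbs g f \<longleftrightarrow> (\<exists>\<tau> :: nat poly. \<forall>x\<in>dom f. \<forall>y. prefix x y \<and> poly \<tau> (length x) \<le> length y \<longrightarrow> y \<in> dom g)"

lemma prefixes_comparable: "prefix x z \<Longrightarrow> prefix y z \<Longrightarrow> pref_comparable x y"
  unfolding pref_comparable_def by (rule prefix_same_cases)

text \<open>By end equivalence some extension of \<open>y\<close> lies in \<open>dom g\<close>. The generator of \<open>dom g\<close> below it is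
  comparable with the generator of \<open>dom f\<close> below \<open>x\<close>, hence no longer than \<open>\<tau>(|x|) \<le> |y|\<close>, hence a
  prefix of \<open>y\<close> itself.\<close>

lemma absorbs_if_poly_equiv:
  assumes f: "right_ideal_morphism f" and g: "right_ideal_morphism g"
    and e: "end_equiv (domC f) (domC g)"
    and \<tau>: "\<And>x y. x \<in> domC f \<Longrightarrow> y \<in> domC g \<Longrightarrow> pref_comparable x y \<Longrightarrow> length y \<le> poly \<tau> (length x)"
  shows "absorbs g f"
  unfolding absorbs_def
proof (intro exI ballI allI impI)
  fix x y assume x: "x \<in> dom f" and y: "prefix x y \<and> poly \<tau> (length x) \<le> length y"
  obtain x1 where x1: "x1 \<in> domC f" "prefix x1 x"
    using dom_has_prefix_in_domC[OF f x] by blast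
  have "right_ideal {v. prefix y v}"
    by (auto simp: right_ideal_iff)
  moreover have "y \<in> right_gen (domC f)"
    using morphism_dom[OF f x, of y] y domC(2)[OF f] by simp
  ultimately obtain v where v: "v \<in> dom g" "prefix y v"
    using e domC(2)[OF g] unfolding end_equiv_def by blast
  then obtain x2 where x2: "x2 \<in> domC g" "prefix x2 v"
    using dom_has_prefix_in_domC[OF g] by blast
  have "prefix x1 v" using x1 y v by (meson prefix_order.trans)
  then have "length x2 \<le> poly \<tau> (length x1)"
    using x1 x2 prefixes_comparable by (intro \<tau>) auto
  also have "\<dots> \<le> poly \<tau> (length x)"
    by (intro poly_nat_mono prefix_length_le x1)
  finally have "length x2 \<le> length y" using y by simp
  then have "prefix x2 y" using x2 v by (meson prefix_length_prefix)
  then show "y \<in> dom g"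
    using morphism_dom[OF g] domC_subset[OF g x2(1)] by blast
qed

lemma absorbs_extend:
  assumes f: "right_ideal_morphism f" and g: "right_ideal_morphism g" and "absorbs g f"
    and x: "x \<in> dom f"
  shows "\<exists>w. x @ w \<in> dom g"
proof -
  from assms obtain \<tau> :: "nat poly" where
    \<tau>: "\<And>x y. x \<in> dom f \<Longrightarrow> prefix x y \<Longrightarrow> poly \<tau> (length x) \<le> length y \<Longrightarrow> y \<in> dom g"
    unfolding absorbs_def by blast
  have "x @ replicate (poly \<tau> (length x)) False \<in> dom g"
    using x by (intro \<tau>) auto
  then show ?thesis by blast
qed

text \<open>If a generator \<open>y\<close> of \<open>dom g\<close> exceeded a generator \<open>x\<close> of \<open>dom f\<close> by more than \<open>\<tau>(|x|)\<close> letters,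
  then a proper prefix of \<open>y\<close> would already lie in \<open>dom g\<close>.\<close>

lemma poly_equiv_code_if_absorbs:
  assumes f: "right_ideal_morphism f" and g: "right_ideal_morphism g"
    and fg: "absorbs g f" and gf: "absorbs f g"
  shows "poly_equiv_code (domC f) (domC g)"
proof -
  have end1: "dom g \<inter> R \<noteq> {}" if mor: "right_ideal_morphism f" "right_ideal_morphism g" "absorbs g f"
     and R: "right_ideal R" "dom f \<inter> R \<noteq> {}" for f g and R :: "word set"
  proof -
    from R obtain x where x: "x \<in> dom f" "x \<in> R" by blast
    then obtain w where "x @ w \<in> dom g" using absorbs_extend[OF mor] by blast
    then show ?thesis using x(2) R(1) unfolding right_ideal_iff by blast
  qed
  have bound: "\<exists>\<tau>::nat poly. \<forall>x\<in>domC f. \<forall>y\<in>domC g. pref_comparable x y \<longrightarrow> length y \<le> poly \<tau> (length x)"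
    if f: "right_ideal_morphism f" and g: "right_ideal_morphism g" and "absorbs g f" for f g
  proof -
    from that obtain \<tau> :: "nat poly" where
      \<tau>: "\<And>x y. x \<in> dom f \<Longrightarrow> prefix x y \<Longrightarrow> poly \<tau> (length x) \<le> length y \<Longrightarrow> y \<in> dom g"
      unfolding absorbs_def by blast
    have "length y \<le> poly (\<tau> + [:0, 1:]) (length x)"
      if x: "x \<in> domC f" and y: "y \<in> domC g" and "pref_comparable x y" for x y
    proof (rule ccontr)
      assume "\<not> ?thesis"
      then have len: "poly \<tau> (length x) + length x < length y" by simp
      with that have xy: "prefix x y"
        unfolding pref_comparable_def using prefix_length_le by fastforce
      let ?v = "take (poly \<tau> (length x) + length x) y"
      have "prefix x ?v"
        using xy len by (intro prefix_length_prefix[OF xy take_is_prefix]) auto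
      then have "?v \<in> dom g"
        using domC_subset[OF f x] len by (intro \<tau>) auto
      then have "?v = y" using domC_minimal[OF g y _ take_is_prefix] by blast
      then have "length ?v = length y" by (rule arg_cong)
      with len show False by simp
    qed
    then show ?thesis by blast
  qed
  from bound[OF f g fg] obtain \<tau>1 :: "nat poly" where
    1: "\<forall>x\<in>domC f. \<forall>y\<in>domC g. pref_comparable x y \<longrightarrow> length y \<le> poly \<tau>1 (length x)" by blast
  from bound[OF g f gf] obtain \<tau>2 :: "nat poly" where
    2: "\<forall>y\<in>domC g. \<forall>x\<in>domC f. pref_comparable y x \<longrightarrow> length x \<le> poly \<tau>2 (length y)" by blast
  have "\<forall>x1\<in>domC f. \<forall>x2\<in>domC g. pref_comparable x1 x2 \<longrightarrow>
        length x1 \<le> poly (\<tau>1 + \<tau>2) (length x2) \<and> length x2 \<le> poly (\<tau>1 + \<tau>2) (length x1)"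
  proof (intro ballI impI)
    fix x1 x2 assume x: "x1 \<in> domC f" "x2 \<in> domC g" and "pref_comparable x1 x2"
    then have "length x2 \<le> poly \<tau>1 (length x1)" "length x1 \<le> poly \<tau>2 (length x2)"
      using 1 2 by (auto simp: pref_comparable_def)
    then show "length x1 \<le> poly (\<tau>1 + \<tau>2) (length x2) \<and> length x2 \<le> poly (\<tau>1 + \<tau>2) (length x1)"
      by simp
  qed
  moreover have "end_equiv (domC f) (domC g)"
    unfolding end_equiv_def domC(2)[OF f] domC(2)[OF g]
    using end1[OF f g fg] end1[OF g f gf] by blast
  ultimately show ?thesis unfolding poly_equiv_code_def by blast
qed

lemma poly_equiv_iff:
  assumes f: "right_ideal_morphism f" and g: "right_ideal_morphism g"
  shows "poly_equiv f g \<longleftrightarrow> absorbs g f \<and> absorbs f g \<and> (\<forall>x y z. f x = Some y \<longrightarrow> g x = Some z \<longrightarrow> y = z)"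
proof -
  have *: "(\<forall>x \<in> dom f \<inter> dom g. f x = g x) \<longleftrightarrow> (\<forall>x y z. f x = Some y \<longrightarrow> g x = Some z \<longrightarrow> y = z)"
  proof
    assume *: "\<forall>x \<in> dom f \<inter> dom g. f x = g x"
    show "\<forall>x y z. f x = Some y \<longrightarrow> g x = Some z \<longrightarrow> y = z"
    proof (intro allI impI)
      fix x y z assume "f x = Some y" "g x = Some z"
      moreover from this have "f x = g x" by (intro *[rule_format]) auto
      ultimately show "y = z" by simp
    qed
  qed fastforce
  have "absorbs g f \<and> absorbs f g" if "poly_equiv_code (domC f) (domC g)"
  proof -
    from that obtain \<tau> :: "nat poly" where
      \<tau>: "\<forall>x1\<in>domC f. \<forall>x2\<in>domC g. pref_comparable x1 x2 \<longrightarrow>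
        length x1 \<le> poly \<tau> (length x2) \<and> length x2 \<le> poly \<tau> (length x1)"
      and e: "end_equiv (domC f) (domC g)"
      unfolding poly_equiv_code_def by blast
    from e have e': "end_equiv (domC g) (domC f)" unfolding end_equiv_def by blast
    show ?thesis
    proof
      show "absorbs g f"
        by (rule absorbs_if_poly_equiv[OF f g e, of \<tau>]) (use \<tau> in blast)
      show "absorbs f g"
        by (rule absorbs_if_poly_equiv[OF g f e', of \<tau>])
          (use \<tau> in \<open>unfold pref_comparable_def, blast\<close>)
    qed
  qed
  then show ?thesis
    unfolding poly_equiv_def * using poly_equiv_code_if_absorbs[OF f g] by blast
qed

lemma absorbs_refl: "right_ideal_morphism f \<Longrightarrow> absorbs f f"
  unfolding absorbs_def by (metis morphism_dom)

lemma absorbs_trans: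
  assumes h: "right_ideal_morphism h" and "absorbs g f" "absorbs h g"
  shows "absorbs h f"
proof -
  from assms obtain \<sigma> \<tau> :: "nat poly" where
    \<sigma>: "\<And>x y. x \<in> dom f \<Longrightarrow> prefix x y \<Longrightarrow> poly \<sigma> (length x) \<le> length y \<Longrightarrow> y \<in> dom g" and
    \<tau>: "\<And>x y. x \<in> dom g \<Longrightarrow> prefix x y \<Longrightarrow> poly \<tau> (length x) \<le> length y \<Longrightarrow> y \<in> dom h"
    unfolding absorbs_def by metis
  let ?\<sigma> = "[:0, 1:] + \<sigma>"
  have "y \<in> dom h" if x: "x \<in> dom f" and y: "prefix x y" "poly (?\<sigma> + \<tau> \<circ>\<^sub>p ?\<sigma>) (length x) \<le> length y" for x y
  proof -
    let ?v = "take (poly ?\<sigma> (length x)) y"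
    have len: "length ?v = poly ?\<sigma> (length x)" using y by (simp add: poly_pcompose)
    have "prefix x ?v"
      using len by (intro prefix_length_prefix[OF y(1) take_is_prefix]) auto
    then have "?v \<in> dom g" using x len by (intro \<sigma>) auto
    then show ?thesis
      using y len by (intro \<tau>[OF _ take_is_prefix]) (auto simp: poly_pcompose)
  qed
  then show ?thesis unfolding absorbs_def by blast
qed

lemma RMP_morphism: "f \<in> RMP \<Longrightarrow> right_ideal_morphism f"
  by (simp add: RMP_def)

lemma morphism_comp: "right_ideal_morphism f \<Longrightarrow> right_ideal_morphism g \<Longrightarrow> right_ideal_morphism (f \<circ>\<^sub>m g)"
  unfolding right_ideal_morphism_iff by (auto simp: map_comp_Some_iff)

text \<open>An extension \<open>x w\<close> has to be long enough for \<open>g2\<close> at \<open>x\<close> and for \<open>f2\<close> at \<open>v = g1 x\<close>, since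
  \<open>g2 (x w) = v w\<close>. As \<open>|v|\<close> is polynomial in \<open>|x|\<close>, both bounds are polynomial in \<open>|x|\<close>.\<close>

lemma absorbs_comp:
  assumes bal: "poly_balanced g1" and g1: "right_ideal_morphism g1" and f1: "right_ideal_morphism f1"
    and f: "absorbs f2 f1" and g: "absorbs g2 g1"
    and eq: "\<And>x y z. g1 x = Some y \<Longrightarrow> g2 x = Some z \<Longrightarrow> y = z"
  shows "absorbs (f2 \<circ>\<^sub>m g2) (f1 \<circ>\<^sub>m g1)"
proof -
  from f g obtain \<sigma> \<tau> :: "nat poly" where
    \<sigma>: "\<And>x y. x \<in> dom f1 \<Longrightarrow> prefix x y \<Longrightarrow> poly \<sigma> (length x) \<le> length y \<Longrightarrow> y \<in> dom f2" and
    \<tau>: "\<And>x y. x \<in> dom g1 \<Longrightarrow> prefix x y \<Longrightarrow> poly \<tau> (length x) \<le> length y \<Longrightarrow> y \<in> dom g2"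
    unfolding absorbs_def by metis
  from bal obtain p :: "nat poly" where p: "\<And>x y. g1 x = Some y \<Longrightarrow> length y \<le> poly p (length x)"
    unfolding poly_balanced_def by blast
  have "y \<in> dom (f2 \<circ>\<^sub>m g2)" if x: "x \<in> dom (f1 \<circ>\<^sub>m g1)"
    and y: "prefix x y" "poly (\<tau> + \<sigma> \<circ>\<^sub>p p + [:0, 1:]) (length x) \<le> length y" for x y
  proof -
    from x obtain v where v: "g1 x = Some v" "v \<in> dom f1"
      by (auto simp: dom_def map_comp_Some_iff)
    from y(1) obtain w where w: "y = x @ w" by (auto simp: prefix_def)
    have gy: "g1 y = Some (v @ w)" using morphismD[OF g1 v(1)] w by simp
    have "y \<in> dom g2" using y v by (intro \<tau>[of x]) auto
    with eq[OF gy] have g2: "g2 y = Some (v @ w)" by auto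
    have "poly \<sigma> (length v) \<le> poly \<sigma> (poly p (length x))"
      by (intro poly_nat_mono p v)
    then have "v @ w \<in> dom f2"
      using y(2) v(2) w by (intro \<sigma>[of v]) (auto simp: poly_pcompose)
    then show ?thesis using g2 by (auto simp: dom_def map_comp_Some_iff)
  qed
  then show ?thesis unfolding absorbs_def by blast
qed

lemma poly_balanced_comp:
  assumes "poly_balanced f" "poly_balanced g"
  shows "poly_balanced (f \<circ>\<^sub>m g)"
proof -
  from assms obtain p q :: "nat poly" where
    p: "\<And>x y. f x = Some y \<Longrightarrow> length y \<le> poly p (length x) \<and> length x \<le> poly p (length y)" and
    q: "\<And>x y. g x = Some y \<Longrightarrow> length y \<le> poly q (length x) \<and> length x \<le> poly q (length y)"
    unfolding poly_balanced_def by metis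
  have "length y \<le> poly (p \<circ>\<^sub>p q + q \<circ>\<^sub>p p) (length x) \<and> length x \<le> poly (p \<circ>\<^sub>p q + q \<circ>\<^sub>p p) (length y)"
    if "(f \<circ>\<^sub>m g) x = Some y" for x y
  proof -
    from that obtain v where v: "g x = Some v" "f v = Some y" by (auto simp: map_comp_Some_iff)
    have "length y \<le> poly p (poly q (length x))"
      using p[OF v(2)] q[OF v(1)] poly_nat_mono[of "length v" _ p] by (meson le_trans)
    moreover have "length x \<le> poly q (poly p (length y))"
      using p[OF v(2)] q[OF v(1)] poly_nat_mono[of "length v" _ q] by (meson le_trans)
    ultimately show ?thesis by (simp add: poly_pcompose)
  qed
  then show ?thesis unfolding poly_balanced_def by blast
qed

lemma equiv_poly_rel: "equiv RMP poly_rel"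
proof (rule equivI)
  show "poly_rel \<subseteq> RMP \<times> RMP" unfolding poly_rel_def by blast
  show "refl_on RMP poly_rel"
    unfolding refl_on_def poly_rel_def
    by (auto simp: poly_equiv_iff RMP_morphism absorbs_refl)
  show "sym poly_rel"
  proof (rule symI)
    fix f g assume "(f, g) \<in> poly_rel"
    then have fg: "f \<in> RMP" "g \<in> RMP" "poly_equiv f g" by (auto simp: poly_rel_def)
    then have "poly_equiv g f"
      unfolding poly_equiv_iff[OF fg(1,2)[THEN RMP_morphism]]
        poly_equiv_iff[OF fg(2,1)[THEN RMP_morphism]] by blast
    with fg show "(g, f) \<in> poly_rel" by (simp add: poly_rel_def)
  qed
  show "trans poly_rel"
  proof (rule transI)
    fix f g h assume fg: "(f, g) \<in> poly_rel" and gh: "(g, h) \<in> poly_rel"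
    then have mor: "right_ideal_morphism f" "right_ideal_morphism g" "right_ideal_morphism h"
      by (auto simp: poly_rel_def RMP_morphism)
    have e: "poly_equiv f g" "poly_equiv g h" using fg gh by (auto simp: poly_rel_def)
    have "y = z" if fx: "f x = Some y" and hx: "h x = Some z" for x y z
    proof -
      \<comment> \<open>The values at \<open>x\<close> are compared at an extension of \<open>x\<close> that lies in the middle domain.\<close>
      obtain w where "x @ w \<in> dom g"
        using absorbs_extend[OF mor(1,2), of x] e(1) fx
        unfolding poly_equiv_iff[OF mor(1,2)] by (metis domI)
      moreover have "f (x @ w) = Some (y @ w)" "h (x @ w) = Some (z @ w)"
        using fx hx mor morphismD by blast+
      ultimately have "y @ w = z @ w"
        using e unfolding poly_equiv_iff[OF mor(1,2)] poly_equiv_iff[OF mor(2,3)] by blast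
      then show ?thesis by simp
    qed
    moreover have "absorbs h f" "absorbs f h"
      using absorbs_trans[OF mor(3), of g f] absorbs_trans[OF mor(1), of g h] e by (auto simp: poly_equiv_iff mor)
    ultimately show "(f, h) \<in> poly_rel"
      using fg gh mor by (auto simp: poly_rel_def poly_equiv_iff)
  qed
qed

lemma poly_equiv_comp:
  assumes "f1 \<in> RMP" "f2 \<in> RMP" "g1 \<in> RMP" "g2 \<in> RMP" "poly_equiv f1 f2" "poly_equiv g1 g2"
  shows "poly_equiv (f1 \<circ>\<^sub>m g1) (f2 \<circ>\<^sub>m g2)"
proof -
  note mor = assms(1-4)[THEN RMP_morphism]
  have bal: "poly_balanced g1" "poly_balanced g2" using assms by (auto simp: RMP_def fP_def)
  have f: "absorbs f2 f1" "absorbs f1 f2" "\<And>x y z. f1 x = Some y \<Longrightarrow> f2 x = Some z \<Longrightarrow> y = z"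
    and g: "absorbs g2 g1" "absorbs g1 g2" "\<And>x y z. g1 x = Some y \<Longrightarrow> g2 x = Some z \<Longrightarrow> y = z"
    using assms(5,6) by (auto simp: poly_equiv_iff mor)
  have "absorbs (f2 \<circ>\<^sub>m g2) (f1 \<circ>\<^sub>m g1)" "absorbs (f1 \<circ>\<^sub>m g1) (f2 \<circ>\<^sub>m g2)"
    using absorbs_comp[OF bal(1) mor(3,1) f(1) g(1)] absorbs_comp[OF bal(2) mor(4,2) f(2) g(2)] g(3)
    by auto
  moreover have "y = z" if "(f1 \<circ>\<^sub>m g1) x = Some y" "(f2 \<circ>\<^sub>m g2) x = Some z" for x y z
  proof -
    from that obtain u v where uv: "g1 x = Some u" "f1 u = Some y" "g2 x = Some v" "f2 v = Some z"
      by (auto simp: map_comp_Some_iff)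
    with g(3) have "u = v" by blast
    with uv f(3) show ?thesis by blast
  qed
  ultimately show ?thesis
    by (auto simp: poly_equiv_iff mor morphism_comp)
qed

section \<open>Stack programs and their compilation to Turing machines\<close>

text \<open>A program works on stacks of bits, addressed by numbers, and on a word of output that can only
  grow. \<open>Case\<close> branches on the top of a stack: empty, 0, 1. \<open>While\<close> runs until a stack is empty.\<close>

datatype com =
    Skip
  | Push nat bool
  | Pop nat
  | Out bool
  | Seq com com  (infixr ";;" 60)
  | Case nat com com com
  | While nat com

type_synonym store = "nat \<Rightarrow> word"

text \<open>The number counts the steps of the compiled machine. A push takes two of them, since the head
  has to leave the old top before the new one is written.\<close>

inductive exec :: "com \<Rightarrow> store \<Rightarrow> word \<Rightarrow> nat \<Rightarrow> store \<Rightarrow> word \<Rightarrow> bool" where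
  exec_Skip: "exec Skip s z 1 s z"
| exec_Push: "exec (Push r b) s z 2 (s(r := b # s r)) z"
| exec_Pop: "exec (Pop r) s z 1 (s(r := tl (s r))) z"
| exec_Out: "exec (Out b) s z 1 s (z @ [b])"
| exec_Seq: "exec a s z t1 s1 z1 \<Longrightarrow> exec b s1 z1 t2 s2 z2 \<Longrightarrow> exec (a ;; b) s z (Suc (t1 + t2)) s2 z2"
| exec_Case: "exec (case s r of [] \<Rightarrow> a | b # _ \<Rightarrow> if b then d else c) s z t s1 z1 \<Longrightarrow>
    exec (Case r a c d) s z (Suc t) s1 z1"
| exec_While_end: "s r = [] \<Longrightarrow> exec (While r a) s z 1 s z"
| exec_While: "s r \<noteq> [] \<Longrightarrow> exec a s z t1 s1 z1 \<Longrightarrow> exec (While r a) s1 z1 t2 s2 z2 \<Longrightarrow>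
    exec (While r a) s z (Suc (t1 + t2)) s2 z2"

primrec regs :: "com \<Rightarrow> nat set" where
  "regs Skip = {}"
| "regs (Push r b) = {r}"
| "regs (Pop r) = {r}"
| "regs (Out b) = {}"
| "regs (a ;; b) = regs a \<union> regs b"
| "regs (Case r a b c) = insert r (regs a \<union> regs b \<union> regs c)"
| "regs (While r a) = insert r (regs a)"

lemma finite_regs: "finite (regs c)"
  by (induction c) auto

text \<open>The control state of the compiled machine is the list of the commands that remain to be executed,
  not a program counter. Only finitely many such lists are reachable, so they can be numbered,
  and no jump addresses have to be computed. \<open>Put\<close> is the second half of a push.\<close>

datatype item = Do com | Put nat bool

type_synonym action = "nat \<times> int"

fun control :: "nat \<Rightarrow> item list \<Rightarrow> nat list \<Rightarrow> item list \<times> action list" where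
  "control K [] v = ([], map (\<lambda>x. (x, 0)) v)"
| "control K (Do Skip # k) v = (k, map (\<lambda>x. (x, 0)) v)"
| "control K (Do (Push r b) # k) v = (Put r b # k, (map (\<lambda>x. (x, 0)) v)[r := (v ! r, - 1)])"
| "control K (Put r b # k) v = (k, (map (\<lambda>x. (x, 0)) v)[r := (sym_of_bit b, 0)])"
| "control K (Do (Pop r) # k) v =
     (k, (map (\<lambda>x. (x, 0)) v)[r := (v ! r, if v ! r = 0 then 0 else 1)])"
| "control K (Do (Out b) # k) v = (k, (map (\<lambda>x. (x, 0)) v)[K := (sym_of_bit b, 1)])"
| "control K (Do (a ;; b) # k) v = (Do a # Do b # k, map (\<lambda>x. (x, 0)) v)"
| "control K (Do (Case r a c d) # k) v =
     (Do (if v ! r = 0 then a else if v ! r = 1 then c else d) # k, map (\<lambda>x. (x, 0)) v)"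
| "control K (Do (While r a) # k) v =
     (if v ! r = 0 then k else Do a # Do (While r a) # k, map (\<lambda>x. (x, 0)) v)"

text \<open>An upper bound for the control states met while executing \<open>c\<close> before the continuation \<open>k\<close>.\<close>

primrec reach :: "com \<Rightarrow> item list \<Rightarrow> item list set" where
  "reach Skip k = {Do Skip # k}"
| "reach (Push r b) k = {Do (Push r b) # k, Put r b # k}"
| "reach (Pop r) k = {Do (Pop r) # k}"
| "reach (Out b) k = {Do (Out b) # k}"
| "reach (a ;; b) k = insert (Do (a ;; b) # k) (reach a (Do b # k) \<union> reach b k)"
| "reach (Case r a b c) k = insert (Do (Case r a b c) # k) (reach a k \<union> reach b k \<union> reach c k)"
| "reach (While r a) k = insert (Do (While r a) # k) (reach a (Do (While r a) # k))"

lemma finite_reach: "finite (reach c k)"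
  by (induction c arbitrary: k) auto

lemma start_in_reach: "Do c # k \<in> reach c k"
  by (cases c) auto

lemma control_in_reach: "q \<in> reach c k \<Longrightarrow> fst (control K q v) \<in> insert k (reach c k)"
proof (induction c arbitrary: k)
  case (Seq a b)
  show ?case
    using Seq.prems Seq.IH(1)[of "Do b # k"] Seq.IH(2)[of k] start_in_reach[of a "Do b # k"]
      start_in_reach[of b k] by auto
next
  case (Case r a b c)
  show ?case
    using Case.prems Case.IH[of k] start_in_reach[of _ k] by auto
next
  case (While r a)
  show ?case
    using While.prems While.IH[of "Do (While r a) # k"] start_in_reach[of a "Do (While r a) # k"]
    by (auto split: if_splits)
qed auto

text \<open>Register \<open>r\<close> lives on tape \<open>r < K\<close>, the output on tape \<open>K\<close>. When nothing remains to be executed,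
  register 1 gives the verdict. The halting states take the numbers 0 and 1, which shifts the
  number of a control state by 2.\<close>

definition machine :: "nat \<Rightarrow> com \<Rightarrow> tm" where
  "machine K c = (let R = insert [] (reach c []) in
     \<lparr>tapes = Suc K, symbols = 3, states = card R + 2, start = to_nat_on R [Do c] + 2,
      accept = 0, reject = 1,
      delta = (\<lambda>q v. let k = from_nat_into R (q - 2) in
         if k = [] then (if v ! 1 = 0 then 1 else 0, map (\<lambda>x. (x, 0)) v)
         else (to_nat_on R (fst (control K k v)) + 2, snd (control K k v)))\<rparr>)"

lemma length_control [simp]: "length (snd (control K k v)) = length v"
  by (induction K k v rule: control.induct) auto

lemma set_control:
  assumes "set v \<subseteq> {..<3}"
  shows "set (snd (control K k v)) \<subseteq> {..<3} \<times> {-1, 0, 1}"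
proof -
  have v: "r < length v \<Longrightarrow> v ! r < 3" for r
    using assms nth_mem by fastforce
  have same: "set (map (\<lambda>x. (x, 0::int)) v) \<subseteq> {..<3} \<times> {-1, 0, 1}"
    using assms by auto
  have upd: "set ((map (\<lambda>x. (x, 0::int)) v)[r := p]) \<subseteq> {..<3} \<times> {-1, 0, 1}"
    if "r < length v \<Longrightarrow> p \<in> {..<3} \<times> {-1, 0, 1}" for r p
  proof (cases "r < length v")
    case True
    then show ?thesis using that set_update_subsetI[OF same] by blast
  next
    case False
    then show ?thesis using same by (simp add: list_update_beyond)
  qed
  show ?thesis
    by (cases "(K, k, v)" rule: control.cases)
      (use same in \<open>auto simp: sym_of_bit_def v simp del: set_map intro!: upd\<close>)
qed

lemma wf_machine:
  assumes "1 \<le> K"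
  shows "wf_tm (machine K c)"
proof -
  let ?R = "insert [] (reach c [])"
  have fin: "finite ?R" by (simp add: finite_reach)
  have num: "to_nat_on ?R k < card ?R" if "k \<in> ?R" for k
    using to_nat_on_finite[OF fin] that by (auto simp: bij_betw_def)
  have from_into: "from_nat_into ?R n \<in> ?R" for n
    by (rule from_nat_into) simp
  have closed: "fst (control K k v) \<in> ?R" if "k \<in> ?R" "k \<noteq> []" for k v
    using control_in_reach[of k c "[]" K v] that by auto
  have wf: "wf_tm (machine K c) \<longleftrightarrow> start (machine K c) < card ?R + 2 \<and> (\<forall>q v. q < card ?R + 2 \<and> length v = Suc K \<and> set v \<subseteq> {..<3} \<longrightarrow>
     fst (delta (machine K c) q v) < card ?R + 2 \<and> length (snd (delta (machine K c) q v)) = Suc K \<and>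
     set (snd (delta (machine K c) q v)) \<subseteq> {..<3} \<times> {-1, 0, 1})"
    unfolding wf_tm_def by (simp add: machine_def Let_def)
  show ?thesis
    unfolding wf
  proof (intro conjI allI impI)
    show "start (machine K c) < card ?R + 2"
      using num[of "[Do c]"] start_in_reach[of c "[]"] by (simp add: machine_def Let_def)
    fix q and v :: "nat list"
    assume *: "q < card ?R + 2 \<and> length v = Suc K \<and> set v \<subseteq> {..<3}"
    let ?k = "from_nat_into ?R (q - 2)"
    show "fst (delta (machine K c) q v) < card ?R + 2"
      using num[OF closed[OF from_into, of "q - 2" v]] by (simp add: machine_def Let_def)
    show "length (snd (delta (machine K c) q v)) = Suc K"
      using * by (simp add: machine_def Let_def)
    show "set (snd (delta (machine K c) q v)) \<subseteq> {..<3} \<times> {-1, 0, 1}"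
      using * set_control[of v K ?k] by (auto simp: machine_def Let_def)
  qed
qed

definition cell :: "word \<Rightarrow> nat \<Rightarrow> nat" where
  "cell w i = (if i < length w then sym_of_bit (w ! i) else 0)"

lemma cell_simps [simp]:
  "cell [] i = 0" "cell (b # w) 0 = sym_of_bit b" "cell (b # w) (Suc i) = cell w i"
  by (auto simp: cell_def)

lemma cell_0_eq_0_iff [simp]: "cell w 0 = 0 \<longleftrightarrow> w = []"
  by (cases w) (auto simp: sym_of_bit_def)

text \<open>The top of a register is under the head and the stack extends to the right up to a blank. The
  cells to the left of the head may contain anything, so that a pop is a mere movement, and the
  initial tape represents the input as register 0. The output is written in reading order, with
  the head on the first free cell.\<close>

definition represents :: "nat \<Rightarrow> config \<Rightarrow> store \<Rightarrow> word \<Rightarrow> bool" where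
  "represents K cfg s z \<longleftrightarrow>
     (\<forall>r<K. \<forall>i\<le>length (s r). tape cfg r (head cfg r + int i) = cell (s r) i) \<and>
     head cfg K = int (length z) \<and> (\<forall>i. tape cfg K (int i) = cell z i)"

definition scan :: "nat \<Rightarrow> config \<Rightarrow> nat list" where
  "scan K cfg = map (\<lambda>j. tape cfg j (head cfg j)) [0..<Suc K]"

lemma scan_nth: "r \<le> K \<Longrightarrow> scan K cfg ! r = tape cfg r (head cfg r)"
  by (simp add: scan_def del: upt_Suc)

lemma length_scan [simp]: "length (scan K cfg) = Suc K"
  by (simp add: scan_def)

lemma scan_represents: "represents K cfg s z \<Longrightarrow> r < K \<Longrightarrow> scan K cfg ! r = cell (s r) 0"
  unfolding represents_def by (simp add: scan_nth) (metis add_0_right le0 of_nat_0)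

definition num :: "com \<Rightarrow> item list \<Rightarrow> nat" where
  "num c k = to_nat_on (insert [] (reach c [])) k + 2"

definition act :: "nat \<Rightarrow> nat \<Rightarrow> int \<Rightarrow> nat \<Rightarrow> config \<Rightarrow> config" where
  "act q a m r cfg = \<lparr>state = q, tape = (tape cfg)(r := (tape cfg r)(head cfg r := a)),
     head = (head cfg)(r := head cfg r + m)\<rparr>"

lemma state_act [simp]: "state (act q a m r cfg) = q"
  by (simp add: act_def)

lemma step_machine:
  assumes "state cfg = num c k" "k \<in> reach c []" "k \<noteq> []"
    and ctl: "control K k (scan K cfg) = (k', acts)"
    and acts: "acts = (map (\<lambda>x. (x, 0)) (scan K cfg))[r := (a, m)]" and r: "r \<le> K"
  shows "step (machine K c) cfg = act (num c k') a m r cfg"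
proof -
  let ?R = "insert [] (reach c [])"
  have k: "from_nat_into ?R (to_nat_on ?R k) = k"
    using assms(2) by (intro from_nat_into_to_nat_on) (auto simp: countable_finite finite_reach)
  have delta: "delta (machine K c) (state cfg) (scan K cfg) = (num c k', acts)"
    using k assms(1,3) ctl by (simp add: machine_def Let_def num_def)
  have nh: "\<not> halting (machine K c) cfg"
    using assms(1) by (simp add: halting_def machine_def Let_def num_def)
  have tp: "tapes (machine K c) = Suc K"
    by (simp add: machine_def Let_def)
  have nth: "acts ! j = (if j = r then (a, m) else (tape cfg j (head cfg j), 0))" if "j < Suc K" for j
    using that acts r by (auto simp: nth_list_update scan_nth)
  show ?thesis
    unfolding step_def act_def
    using nh delta r by (auto simp: tp scan_def[symmetric] nth fun_eq_iff simp del: upt_Suc)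
qed

lemma step_machine_stay:
  assumes "state cfg = num c k" "k \<in> reach c []" "k \<noteq> []"
    and ctl: "control K k (scan K cfg) = (k', map (\<lambda>x. (x, 0)) (scan K cfg))"
  shows "step (machine K c) cfg = cfg\<lparr>state := num c k'\<rparr>"
proof -
  have "map (\<lambda>x. (x, 0)) (scan K cfg) = (map (\<lambda>x. (x, 0)) (scan K cfg))[0 := (scan K cfg ! 0, 0)]"
    by (rule nth_equalityI) (auto simp: nth_list_update)
  from step_machine[OF assms this] show ?thesis
    by (simp add: act_def scan_nth)
qed

lemma represents_push:
  assumes "represents K cfg s z" "r < K" and a: "a = tape cfg r (head cfg r)"
  shows "represents K (act q' (sym_of_bit b) 0 r (act q a (- 1) r cfg)) (s(r := b # s r)) z"
proof -
  have "tape cfg r (head cfg r + int i - 1) = cell (b # s r) i" if "i \<le> length (b # s r)" "i \<noteq> 0"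
    "\<And>i. i \<le> length (s r) \<Longrightarrow> tape cfg r (head cfg r + int i) = cell (s r) i" for i
    using that(1,2) that(3)[of "i - 1"] by (cases i) auto
  then show ?thesis
    using assms(1,2) unfolding represents_def act_def a fun_upd_triv
    by (auto simp: algebra_simps)
qed

lemma represents_pop:
  assumes "represents K cfg s z" "r < K" and a: "a = tape cfg r (head cfg r)"
  shows "represents K (act q a (if s r = [] then 0 else 1) r cfg) (s(r := tl (s r))) z"
proof (cases "s r")
  case Nil
  then show ?thesis using assms(1,2) unfolding represents_def act_def a fun_upd_triv by auto
next
  case (Cons b w)
  have "tape cfg r (head cfg r + 1 + int i) = cell w i" if "i \<le> length w" for i
  proof -
    have "tape cfg r (head cfg r + int (Suc i)) = cell (s r) (Suc i)"
      using assms(1,2) that Cons unfolding represents_def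
      by (metis Suc_le_mono length_Cons)
    then show ?thesis using Cons by (simp add: algebra_simps)
  qed
  with Cons show ?thesis using assms(1,2) unfolding represents_def act_def a fun_upd_triv
    by (auto simp: algebra_simps)
qed

lemma represents_out:
  assumes "represents K cfg s z"
  shows "represents K (act q (sym_of_bit b) 1 K cfg) s (z @ [b])"
  using assms unfolding represents_def act_def
  by (auto simp: cell_def nth_append)

context
  fixes K :: nat and c :: com
begin

text \<open>The number of steps is part of the predicate, so that simulations of parts of a program add up.\<close>

definition arrives :: "config \<Rightarrow> nat \<Rightarrow> item list \<Rightarrow> store \<Rightarrow> word \<Rightarrow> bool" where
  "arrives cfg t k s z \<longleftrightarrow> (let cfg' = (step (machine K c) ^^ t) cfg in
     state cfg' = num c k \<and> represents K cfg' s z)"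

lemma arrives_0: "arrives cfg 0 k s z \<longleftrightarrow> state cfg = num c k \<and> represents K cfg s z"
  by (simp add: arrives_def)

lemma arrives_Suc: "arrives cfg (Suc t) k s z \<longleftrightarrow> arrives (step (machine K c) cfg) t k s z"
  by (simp add: arrives_def funpow_swap1)

lemma arrives_add:
  assumes "arrives cfg t1 k1 s1 z1"
    and "\<And>cfg'. arrives cfg' 0 k1 s1 z1 \<Longrightarrow> arrives cfg' t2 k s z"
  shows "arrives cfg (t1 + t2) k s z"
  using assms(1) assms(2)[of "(step (machine K c) ^^ t1) cfg"]
  by (simp add: arrives_def funpow_add[symmetric] Let_def add.commute[of t1] flip: comp_apply[of "_ ^^ t2" "_ ^^ t1"])

lemma arrives_stay:
  assumes "arrives cfg 0 k s z" "k \<in> reach c []" "k \<noteq> []"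
    and "control K k (scan K cfg) = (k', map (\<lambda>x. (x, 0)) (scan K cfg))"
  shows "arrives cfg 1 k' s z"
  using assms step_machine_stay[of cfg c k K k'] by (simp add: arrives_def represents_def)

lemma arrives_scan: "arrives cfg 0 k s z \<Longrightarrow> r < K \<Longrightarrow> scan K cfg ! r = cell (s r) 0"
  using scan_represents[of K cfg s z r] by (simp add: arrives_0)

lemma exec_arrives:
  assumes "exec d s z t s' z'" "regs d \<subseteq> {..<K}" "reach d k \<subseteq> insert [] (reach c [])"
    and "arrives cfg 0 (Do d # k) s z"
  shows "arrives cfg t k s' z'"
  using assms
proof (induction arbitrary: k cfg rule: exec.induct)
  case (exec_Skip s z)
  then show ?case by (intro arrives_stay) auto
next
  case (exec_Push r b s z)
  then have 1: "step (machine K c) cfg = act (num c (Put r b # k)) (scan K cfg ! r) (- 1) r cfg"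
    by (intro step_machine[where k = "Do (Push r b) # k"]) (auto simp: arrives_0)
  have 2: "step (machine K c) (act (num c (Put r b # k)) x (- 1) r cfg) = 
     act (num c k) (sym_of_bit b) 0 r (act (num c (Put r b # k)) x (- 1) r cfg)" for x
    using exec_Push
    by (intro step_machine[where k = "Put r b # k"]) (auto simp: arrives_0 act_def)
  show ?case
    using represents_push[OF _ _ refl, of K cfg s z r] exec_Push.prems
    by (simp add: numeral_2_eq_2 arrives_Suc 1 2 arrives_0 scan_nth fun_upd_def)
next
  case (exec_Pop r s z)
  then have "step (machine K c) cfg = act (num c k) (scan K cfg ! r) (if s r = [] then 0 else 1) r cfg"
    using scan_represents[of K cfg s z r]
    by (intro step_machine[where k = "Do (Pop r) # k"]) (auto simp: arrives_0)
  then show ?case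
    using represents_pop[OF _ _ refl, of K cfg s z r] exec_Pop.prems
    by (simp add: arrives_Suc arrives_0 scan_nth fun_upd_def split: if_splits)
next
  case (exec_Out b s z)
  then have "step (machine K c) cfg = act (num c k) (sym_of_bit b) 1 K cfg"
    by (intro step_machine[where k = "Do (Out b) # k"]) (auto simp: arrives_0)
  then show ?case
    using represents_out[of K cfg s z] exec_Out
    by (simp add: arrives_Suc arrives_0)
next
  case (exec_Seq a s z t1 s1 z1 b t2 s2 z2)
  have "arrives cfg 1 (Do a # Do b # k) s z"
    using exec_Seq.prems by (intro arrives_stay) auto
  then have "arrives cfg (1 + (t1 + t2)) k s2 z2"
  proof (rule arrives_add)
    fix cfg' assume "arrives cfg' 0 (Do a # Do b # k) s z"
    with exec_Seq.prems have "arrives cfg' t1 (Do b # k) s1 z1"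
      by (intro exec_Seq.IH(1)) auto
    then show "arrives cfg' (t1 + t2) k s2 z2"
      by (rule arrives_add) (use exec_Seq.prems in \<open>auto intro: exec_Seq.IH(2)\<close>)
  qed
  then show ?case by simp
next
  case (exec_Case s r a d b z t s1 z1)
  then have v: "scan K cfg ! r = cell (s r) 0"
    by (auto intro: arrives_scan)
  let ?e = "case s r of [] \<Rightarrow> a | x # _ \<Rightarrow> if x then d else b"
  have "arrives cfg 1 (Do ?e # k) s z"
    using exec_Case.prems v by (intro arrives_stay[where k = "Do (Case r a b d) # k"])
      (auto simp: sym_of_bit_def split: list.splits)
  then have "arrives cfg (1 + t) k s1 z1"
  proof (rule arrives_add)
    fix cfg' assume "arrives cfg' 0 (Do ?e # k) s z"
    with exec_Case.prems show "arrives cfg' t k s1 z1"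
      by (intro exec_Case.IH) (auto split: list.splits)
  qed
  then show ?case by simp
next
  case (exec_While_end s r a z)
  then have v: "scan K cfg ! r = 0"
    by (auto simp: arrives_scan)
  show ?case
    using exec_While_end v by (intro arrives_stay) auto
next
  case (exec_While s r a z t1 s1 z1 t2 s2 z2)
  then have v: "scan K cfg ! r \<noteq> 0"
    by (auto simp: arrives_scan)
  have "arrives cfg 1 (Do a # Do (While r a) # k) s z"
    using exec_While.prems v by (intro arrives_stay) auto
  then have "arrives cfg (1 + (t1 + t2)) k s2 z2"
  proof (rule arrives_add)
    fix cfg' assume "arrives cfg' 0 (Do a # Do (While r a) # k) s z"
    with exec_While.prems have "arrives cfg' t1 (Do (While r a) # k) s1 z1"
      by (intro exec_While.IH(1)) auto
    then show "arrives cfg' (t1 + t2) k s2 z2"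
      by (rule arrives_add) (rule exec_While.IH(2)[OF exec_While.prems(1,2)])
  qed
  then show ?case by simp
qed

end

lemma step_halting: "halting M cfg \<Longrightarrow> (step M ^^ n) cfg = cfg"
  by (induction n) (auto simp: step_def)

definition decides :: "com \<Rightarrow> (word \<rightharpoonup> word) \<Rightarrow> nat poly \<Rightarrow> bool" where
  "decides c f p \<longleftrightarrow> (\<forall>x. \<exists>t s z. exec c ((\<lambda>r. [])(0 := x)) [] t s z \<and> t \<le> poly p (length x) \<and>
     f x = (if s 1 = [] then None else Some z))"

text \<open>One step after the control state is exhausted the machine halts, and from then on its
  configuration does not change.\<close>

lemma polytime_if_decides:
  assumes "decides c f p"
  shows "polytime_computable f"
proof -
  define K where "K = Suc (Suc (Max (insert 0 (regs c))))"
  have regs: "regs c \<subseteq> {..<K}"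
  proof
    fix r assume "r \<in> regs c"
    then have "r \<le> Max (insert 0 (regs c))"
      using finite_regs[of c] by (intro Max_ge) auto
    then show "r \<in> {..<K}" by (simp add: K_def)
  qed
  have "computes_in_time (machine K c) f (poly (p + 1))"
    unfolding computes_in_time_def
  proof
    fix x
    from assms obtain t s z where ex: "exec c ((\<lambda>r. [])(0 := x)) [] t s z"
      and t: "t \<le> poly p (length x)" and f: "f x = (if s 1 = [] then None else Some z)"
      unfolding decides_def by blast
    let ?M = "machine K c"
    have "represents K (init_config ?M x) ((\<lambda>r. [])(0 := x)) []"
      by (auto simp: represents_def init_config_def cell_def K_def)
    then have "arrives K c (init_config ?M x) 0 [Do c] ((\<lambda>r. [])(0 := x)) []"
      by (simp add: arrives_0 init_config_def num_def machine_def Let_def)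
    from exec_arrives[OF ex regs _ this]
    have arr: "arrives K c (init_config ?M x) t [] s z" by auto
    define cfg where "cfg = run ?M x t"
    have st: "state cfg = num c []" and rep: "represents K cfg s z"
      using arr by (auto simp: cfg_def run_def arrives_def Let_def)
    let ?R = "insert [] (reach c [])"
    have "from_nat_into ?R (to_nat_on ?R []) = []"
      by (intro from_nat_into_to_nat_on) (auto simp: countable_finite finite_reach)
    moreover have "scan K cfg ! 1 = cell (s 1) 0"
      using scan_represents[OF rep, of 1] by (simp add: K_def)
    moreover have "map (\<lambda>j. tape cfg j (head cfg j)) [0..<tapes ?M] = scan K cfg"
      by (simp add: scan_def machine_def Let_def)
    ultimately have step: "state (step ?M cfg) = (if s 1 = [] then 1 else 0)"
      "tape (step ?M cfg) K = tape cfg K"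
      using st by (auto simp: step_def halting_def machine_def Let_def num_def scan_nth fun_eq_iff)
    then have halt: "halting ?M (step ?M cfg)"
      by (auto simp: halting_def machine_def Let_def)
    have "run ?M x (poly (p + 1) (length x)) = (step ?M ^^ (poly p (length x) - t)) (step ?M cfg)"
      using t unfolding cfg_def run_def
      by (simp add: funpow_swap1 flip: funpow_add[unfolded comp_def fun_eq_iff, rule_format] funpow.simps(2)[unfolded comp_def fun_eq_iff, rule_format])
    also have "\<dots> = step ?M cfg"
      by (rule step_halting[OF halt])
    finally have run: "run ?M x (poly (p + 1) (length x)) = step ?M cfg" .
    have "has_output ?M (step ?M cfg) z"
      using rep step(2) by (auto simp: has_output_def machine_def Let_def represents_def cell_def)
    then show "case f x of
            Some y \<Rightarrow> state (run ?M x (poly (p + 1) (length x))) = accept ?M \<and>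
                      has_output ?M (run ?M x (poly (p + 1) (length x))) y
          | None \<Rightarrow> state (run ?M x (poly (p + 1) (length x))) = reject ?M"
      unfolding run f using step(1) by (simp add: machine_def Let_def)
  qed
  moreover have "wf_tm (machine K c)"
    by (rule wf_machine) (simp add: K_def)
  ultimately show ?thesis
    unfolding polytime_computable_def by blast
qed

section \<open>Queue programs\<close>

text \<open>A queue program is read in pairs of bits: \<open>11\<close> ends an entry, \<open>10\<close> puts a 0 at the front of the
  queue, and \<open>0b\<close> puts \<open>b\<close> at its end. A queue that begins with 1 is halted, and the rest of it is
  the output. On a queue \<open>0 0\<^sup>i 1 Q\<close> the entry with index \<open>i\<close> is run on \<open>Q\<close>. The zeros which it puts
  in front are added to the next letter \<open>0\<^sup>a 1\<close> of the queue; thus they act as the row of a table of which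
  the letter selects the column, and the queue is the whole configuration. To reject is to
  point beyond the last entry.\<close>

fun drop_entry :: "word \<Rightarrow> word" where
  "drop_entry (True # True # v) = v"
| "drop_entry (b # c # v) = drop_entry v"
| "drop_entry _ = []"

fun run_entry :: "word \<Rightarrow> word \<Rightarrow> word option" where
  "run_entry (True # True # v) Q = Some Q"
| "run_entry (True # False # v) Q = run_entry v (False # Q)"
| "run_entry (False # b # v) Q = run_entry v (Q @ [b])"
| "run_entry _ Q = None"

fun lookup :: "word \<Rightarrow> word \<Rightarrow> word option" where
  "lookup v [] = None"
| "lookup v (True # Q) = run_entry v Q"
| "lookup v (False # Q) = lookup (drop_entry v) Q"

datatype outcome = Halt "word option" | Cont word

fun qstep :: "word \<Rightarrow> word \<Rightarrow> outcome" where
  "qstep u (True # y) = Halt (Some y)"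
| "qstep u (False # Q) = (case lookup u Q of None \<Rightarrow> Halt None | Some Q' \<Rightarrow> Cont Q')"
| "qstep u [] = Halt None"

text \<open>The unused part of the clock is returned, since the evaluator spends one clock on many runs.\<close>

primrec qrun :: "word \<Rightarrow> nat \<Rightarrow> word \<Rightarrow> (nat \<times> word option) option" where
  "qrun u 0 Q = None"
| "qrun u (Suc c) Q = (case qstep u Q of Halt r \<Rightarrow> Some (c, r) | Cont Q' \<Rightarrow> qrun u c Q')"

text \<open>The words \<open>1\<close>, \<open>01\<close> and \<open>001\<close> stand for the letters 0, 1 and the end of the input. The initial 0
  distinguishes the queue from a halted one.\<close>

definition input_queue :: "word \<Rightarrow> word" where
  "input_queue x = False # concat (map (\<lambda>b. if b then [False, True] else [True]) x) @ [False, False, True]"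

text \<open>The pair \<open>(d, out)\<close> is the entry that puts \<open>d\<close> zeros in front and appends \<open>out\<close>; every
  table of such pairs is realized by a program.\<close>

definition entry_code :: "nat \<times> word \<Rightarrow> word" where
  "entry_code = (\<lambda>(d, out). concat (replicate d [True, False]) @ concat (map (\<lambda>b. [False, b]) out) @ [True, True])"

definition table_code :: "(nat \<times> word) list \<Rightarrow> word" where
  "table_code es = concat (map entry_code es)"

lemma run_entry_out: "run_entry (concat (map (\<lambda>b. [False, b]) out) @ [True, True] @ v) Q = Some (Q @ out)"
  by (induction out arbitrary: Q) auto

lemma run_entry_code: "run_entry (entry_code (d, out) @ v) Q = Some (replicate d False @ Q @ out)"
proof (induction d arbitrary: Q)
  case 0
  then show ?case using run_entry_out[of out v Q] by (simp add: entry_code_def)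
next
  case (Suc d)
  then show ?case by (simp add: entry_code_def replicate_app_Cons_same)
qed

lemma drop_entry_out: "drop_entry (concat (map (\<lambda>b. [False, b]) out) @ [True, True] @ v) = v"
  by (induction out) auto

lemma drop_entry_code: "drop_entry (entry_code e @ v) = v"
proof (cases e)
  case (Pair d out)
  have "drop_entry (entry_code (d, out) @ v) = v"
  proof (induction d)
    case 0
    then show ?case using drop_entry_out[of out v] by (simp add: entry_code_def)
  next
    case (Suc d)
    then show ?case by (simp add: entry_code_def)
  qed
  with Pair show ?thesis by simp
qed

lemma lookup_Nil: "lookup [] Q = None"
  by (induction "[] :: word" Q rule: lookup.induct) auto

lemma lookup_skip:
  "lookup (table_code es) (replicate i False @ Q) = lookup (table_code (drop i es)) Q"
proof (induction i arbitrary: es)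
  case (Suc i)
  show ?case
  proof (cases es)
    case Nil
    then show ?thesis using Suc[of "[]"] by (simp add: table_code_def lookup_Nil)
  next
    case (Cons e es')
    then show ?thesis using Suc[of es'] by (simp add: table_code_def drop_entry_code)
  qed
qed simp

lemma lookup_table:
  assumes "i < length es"
  shows "lookup (table_code es) (replicate i False @ True # Q) =
     Some (replicate (fst (es ! i)) False @ Q @ snd (es ! i))"
  using run_entry_code[of "fst (es ! i)" "snd (es ! i)"]
  unfolding lookup_skip Cons_nth_drop_Suc[OF assms, symmetric]
  by (simp add: table_code_def)

lemma lookup_too_far:
  "length es \<le> i \<Longrightarrow> lookup (table_code es) (replicate i False @ Q) = None"
  unfolding lookup_skip by (simp add: table_code_def lookup_Nil)

text \<open>The quantification over the remaining clock makes runs composable.\<close>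

definition leads_to :: "word \<Rightarrow> nat \<Rightarrow> word \<Rightarrow> word \<Rightarrow> bool" where
  "leads_to u n Q Q' \<longleftrightarrow> (\<forall>c. qrun u (n + c) Q = qrun u c Q')"

lemma leads_to_refl: "leads_to u 0 Q Q"
  by (simp add: leads_to_def)

lemma leads_to_trans: "leads_to u m Q1 Q2 \<Longrightarrow> leads_to u n Q2 Q3 \<Longrightarrow> leads_to u (m + n) Q1 Q3"
  by (simp add: leads_to_def add.assoc)

lemma leads_to_step: "qstep u Q = Cont Q' \<Longrightarrow> leads_to u 1 Q Q'"
  by (simp add: leads_to_def)

section \<open>Simulation of Turing machines by queue programs\<close>

text \<open>A configuration of a machine with several tapes is one word, whose letters are columns: the cells
  with a common index on all tapes, each with a mark if the head is there. The flag of a column tells the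
  origin, where the output starts.\<close>

type_synonym column = "bool \<times> (nat \<times> bool) list"

datatype letter = Bit bool | End | Col column

text \<open>A step of the machine is one pass over the queue. During the pass \<open>Pass q acts a b g\<close>, the new state
  \<open>q\<close> and the actions \<open>acts\<close> of the step are known, \<open>a\<close> and \<open>b\<close> are the last two columns that were
  read, and \<open>g\<close> collects the symbols under the heads in the new configuration, which the next
  pass needs. The phases \<open>Start\<close> and \<open>Seen\<close> turn the input into columns; the
  last three extract the output.\<close>

datatype phase =
    Start
  | Seen nat
  | Pass nat "(nat \<times> int) list" column column "nat list"
  | Before
  | Within
  | After

datatype target = To phase | Accept | Reject

lemma finite_lists: "finite A \<Longrightarrow> finite {l. length l = n \<and> set l \<subseteq> A}"
  using finite_lists_length_eq[of A n] by (simp add: conj_commute)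

context
  fixes M :: tm
begin

definition scanned :: "config \<Rightarrow> nat list" where
  "scanned cfg = map (\<lambda>j. tape cfg j (head cfg j)) [0..<tapes M]"

definition column :: "config \<Rightarrow> int \<Rightarrow> column" where
  "column cfg i = (i = 0, map (\<lambda>j. (tape cfg j i, head cfg j = i)) [0..<tapes M])"

definition blank :: column where
  "blank = (False, replicate (tapes M) (0, False))"

text \<open>The local rule: a column of the next configuration depends on the column and on its two
  neighbours, from which a head may move in.\<close>

definition evolve :: "(nat \<times> int) list \<Rightarrow> column \<Rightarrow> column \<Rightarrow> column \<Rightarrow> column" where
  "evolve acts a b c = (fst b, map (\<lambda>j.
     (if snd (snd b ! j) then fst (acts ! j) else fst (snd b ! j),
      (snd (snd b ! j) \<and> snd (acts ! j) = 0) \<or> (snd (snd a ! j) \<and> snd (acts ! j) = 1) \<or>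
      (snd (snd c ! j) \<and> snd (acts ! j) = - 1))) [0..<tapes M])"

definition observe :: "column \<Rightarrow> nat list \<Rightarrow> nat list" where
  "observe a g = map (\<lambda>j. if snd (snd a ! j) then fst (snd a ! j) else g ! j) [0..<tapes M]"

text \<open>The pass that extracts the output is announced by a bit 1 behind the end marker. When the
  pass is over, this bit has become the front of the queue and halts the program.\<close>

definition enter :: "nat \<Rightarrow> nat list \<Rightarrow> target \<times> word" where
  "enter q g = (if q = accept M then (To Before, [True]) else if q = reject M then (Reject, [])
     else (To (Pass (fst (delta M q g)) (snd (delta M q g)) blank blank (replicate (tapes M) 0)), []))"

definition input_column :: "nat \<Rightarrow> bool \<Rightarrow> column" where
  "input_column s b = (b, (s, b) # replicate (tapes M - 1) (0, b))"

definition emit :: "column \<Rightarrow> target \<times> letter list \<times> word" where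
  "emit a = (let s = fst (snd a ! (tapes M - 1)) in
     if s = 0 then (To After, [], []) else (To Within, [], [s = 2]))"

text \<open>A column is rewritten when its right neighbour is read, so the new columns lag one behind. The
  blank columns assumed at both ends make the word grow by one column on each side in each pass;
  therefore no head can leave it.\<close>

fun transition :: "phase \<Rightarrow> letter \<Rightarrow> target \<times> letter list \<times> word" where
  "transition Start (Bit b) = (To (Seen (sym_of_bit b)), [Col (input_column (sym_of_bit b) True)], [])"
| "transition Start End = (let e = enter (start M) (replicate (tapes M) 0)
     in (fst e, [Col (input_column 0 True), End], snd e))"
| "transition (Seen s) (Bit b) = (To (Seen s), [Col (input_column (sym_of_bit b) False)], [])"
| "transition (Seen s) End = (let e = enter (start M) (s # replicate (tapes M - 1) 0)
     in (fst e, [Col (input_column 0 False), End], snd e))"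
| "transition (Pass q acts a b g) (Col c) =
     (To (Pass q acts b c (observe (evolve acts a b c) g)), [Col (evolve acts a b c)], [])"
| "transition (Pass q acts a b g) End =
     (let a' = evolve acts a b blank; b' = evolve acts b blank blank;
          e = enter q (observe b' (observe a' g))
      in (fst e, [Col a', Col b', End], snd e))"
| "transition Before (Col a) = (if fst a then emit a else (To Before, [], []))"
| "transition Within (Col a) = emit a"
| "transition After (Col a) = (To After, [], [])"
| "transition Before End = (Accept, [], [])"
| "transition Within End = (Accept, [], [])"
| "transition After End = (Accept, [], [])"
| "transition _ _ = (Reject, [], [])"

definition columns :: "column set" where
  "columns = UNIV \<times> {l. length l = tapes M \<and> set l \<subseteq> {..<symbols M} \<times> UNIV}"

definition action_lists :: "(nat \<times> int) list set" where
  "action_lists = {l. length l = tapes M \<and> set l \<subseteq> {..<symbols M} \<times> {- 1, 0, 1}}"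

definition symbol_lists :: "nat list set" where
  "symbol_lists = {l. length l = tapes M \<and> set l \<subseteq> {..<symbols M}}"

definition phases :: "phase set" where
  "phases = {Start, Before, Within, After} \<union> Seen ` {..<symbols M} \<union>
     (\<lambda>(q, acts, a, b, g). Pass q acts a b g) `
       ({..<states M} \<times> action_lists \<times> columns \<times> columns \<times> symbol_lists)"

lemma finite_columns: "finite columns"
  unfolding columns_def by (intro finite_cartesian_product finite_lists) auto

lemma finite_phases: "finite phases"
  unfolding phases_def action_lists_def symbol_lists_def
  by (intro finite_UnI finite_imageI finite_cartesian_product finite_lists finite_columns) auto

definition letters :: "letter set" where
  "letters = insert End (range Bit \<union> Col ` columns)"

definition n_letters :: nat where
  "n_letters = 3 + card columns"

definition n_phases :: nat where
  "n_phases = Suc (card phases)"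

fun letter_num :: "letter \<Rightarrow> nat" where
  "letter_num (Bit b) = of_bool b"
| "letter_num End = 2"
| "letter_num (Col a) = 3 + to_nat_on columns a"

definition letter_of :: "nat \<Rightarrow> letter" where
  "letter_of n = (if n < 2 then Bit (n = 1) else if n = 2 then End else Col (from_nat_into columns (n - 3)))"

definition phase_num :: "phase \<Rightarrow> nat" where
  "phase_num q = (if q = Start then 0 else Suc (to_nat_on phases q))"

definition phase_of :: "nat \<Rightarrow> phase" where
  "phase_of n = (if n = 0 then Start else from_nat_into phases (n - 1))"

text \<open>The summand 1 keeps the entries apart from the halted queue; \<open>Reject\<close> points behind the table.\<close>

fun offset :: "target \<Rightarrow> nat" where
  "offset (To q) = Suc (phase_num q * n_letters)"
| "offset Accept = 0"
| "offset Reject = Suc (n_phases * n_letters)"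

definition bits :: "letter list \<Rightarrow> word" where
  "bits as = concat (map (\<lambda>a. replicate (letter_num a) False @ [True]) as)"

lemma bits_simps [simp]: "bits [] = []"
  "bits (a # as) = replicate (letter_num a) False @ True # bits as" "bits (as @ bs) = bits as @ bits bs"
  by (auto simp: bits_def)

text \<open>The entry in row \<open>q\<close> and column \<open>a\<close> of the table is at position \<open>q * n_letters + a\<close>.\<close>

definition table :: "(nat \<times> word) list" where
  "table = map (\<lambda>n. case transition (phase_of (n div n_letters)) (letter_of (n mod n_letters)) of
     (j, as, w) \<Rightarrow> (offset j, bits as @ w)) [0..<n_phases * n_letters]"

definition prog :: word where
  "prog = table_code table"

definition queue :: "target \<Rightarrow> word \<Rightarrow> word" where
  "queue j Q = replicate (offset j) False @ Q"

lemma letter_num_less: "a \<in> letters \<Longrightarrow> letter_num a < n_letters"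
  using to_nat_on_finite[OF finite_columns]
  by (auto simp: letters_def n_letters_def bij_betw_def)

lemma letter_of_num: "a \<in> letters \<Longrightarrow> letter_of (letter_num a) = a"
  by (auto simp: letters_def letter_of_def countable_finite finite_columns of_bool_def split: if_splits)

lemma phase_num_less: "q \<in> phases \<Longrightarrow> phase_num q < n_phases"
  using to_nat_on_finite[OF finite_phases]
  by (auto simp: phase_num_def n_phases_def bij_betw_def)

lemma phase_of_num: "q \<in> phases \<Longrightarrow> phase_of (phase_num q) = q"
  by (auto simp: phase_of_def phase_num_def countable_finite finite_phases)

lemma qstep_prog:
  assumes "q \<in> phases" "a \<in> letters" "transition q a = (j, as, w)"
  shows "qstep prog (queue (To q) (bits [a] @ R)) = Cont (queue j (R @ bits as @ w))"
proof -
  let ?n = "phase_num q * n_letters + letter_num a"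
  have "?n < Suc (phase_num q) * n_letters"
    using letter_num_less[OF assms(2)] by simp
  also have "\<dots> \<le> n_phases * n_letters"
    using phase_num_less[OF assms(1)] by (intro mult_le_mono1) simp
  finally have n: "?n < n_phases * n_letters" .
  have "?n div n_letters = phase_num q" "?n mod n_letters = letter_num a"
    using letter_num_less[OF assms(2)] by auto
  then have "table ! ?n = (offset j, bits as @ w)"
    using n assms by (simp add: table_def phase_of_num letter_of_num)
  then have "lookup prog (replicate ?n False @ True # R) = Some (queue j (R @ bits as @ w))"
    using n lookup_table[of ?n table R] by (simp add: prog_def queue_def table_def)
  then show ?thesis
    by (simp add: queue_def replicate_add)
qed

lemma leads_to_prog:
  assumes "q \<in> phases" "a \<in> letters" "transition q a = (j, as, w)"
  shows "leads_to prog 1 (queue (To q) (bits [a] @ R)) (queue j (R @ bits as @ w))"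
  by (rule leads_to_step) (rule qstep_prog[OF assms])

lemma qstep_Reject: "qstep prog (queue Reject Q) = Halt None"
  using lookup_too_far[of table "n_phases * n_letters"]
  by (simp add: queue_def prog_def table_def)

end

lemma trans_Pass_End:
  "transition M (Pass q acts a b g) End =
     (fst (enter M q (observe M (evolve M acts b (blank M) (blank M)) (observe M (evolve M acts a b (blank M)) g))),
      [Col (evolve M acts a b (blank M)), Col (evolve M acts b (blank M) (blank M)), End],
      snd (enter M q (observe M (evolve M acts b (blank M) (blank M)) (observe M (evolve M acts a b (blank M)) g))))"
  by (simp add: Let_def)

declare transition.simps(6) [simp del]

context
  fixes M :: tm
  assumes wf: "wf_tm M"
begin

lemma delta_wf:
  assumes "q < states M" "g \<in> symbol_lists M"
  shows "fst (delta M q g) < states M" "snd (delta M q g) \<in> action_lists M"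
  using wf assms unfolding wf_tm_def symbol_lists_def action_lists_def by blast+

lemma action_nth:
  assumes "acts \<in> action_lists M" "j < tapes M"
  shows "fst (acts ! j) < symbols M" "snd (acts ! j) = - 1 \<or> snd (acts ! j) = 0 \<or> snd (acts ! j) = 1"
proof -
  have "acts ! j \<in> {..<symbols M} \<times> {- 1, 0, 1}"
    using assms nth_mem[of j acts] unfolding action_lists_def by auto
  then show "fst (acts ! j) < symbols M"
    "snd (acts ! j) = - 1 \<or> snd (acts ! j) = 0 \<or> snd (acts ! j) = 1" by auto
qed

text \<open>After \<open>t\<close> steps on an input of length \<open>n\<close>, the heads and the nonblank cells are confined to the
  interval from \<open>- t\<close> to \<open>n + t\<close>, which is the interval of columns kept in the queue.\<close>

definition valid :: "nat \<Rightarrow> nat \<Rightarrow> config \<Rightarrow> bool" where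
  "valid n t cfg \<longleftrightarrow> state cfg < states M \<and> (\<forall>j<tapes M. \<bar>head cfg j\<bar> \<le> int t \<and>
     (\<forall>i. tape cfg j i < symbols M \<and> (tape cfg j i \<noteq> 0 \<longrightarrow> - int t \<le> i \<and> i < int (n + t))))"

lemma scanned_symbols: "valid n t cfg \<Longrightarrow> scanned M cfg \<in> symbol_lists M"
  by (auto simp: valid_def scanned_def symbol_lists_def)

lemma column_columns: "valid n t cfg \<Longrightarrow> column M cfg i \<in> columns M"
  by (auto simp: valid_def column_def columns_def)

lemma step_unfold:
  assumes "\<not> halting M cfg"
  shows "step M cfg = (let d = delta M (state cfg) (scanned M cfg) in
    \<lparr>state = fst d,
     tape = (\<lambda>j. if j < tapes M then (tape cfg j)(head cfg j := fst (snd d ! j)) else tape cfg j),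
     head = (\<lambda>j. if j < tapes M then head cfg j + snd (snd d ! j) else head cfg j)\<rparr>)"
  using assms by (simp add: step_def scanned_def split_def Let_def)

lemma valid_init: "valid (length x) 0 (init_config M x)"
  using wf by (auto simp: valid_def init_config_def wf_tm_def sym_of_bit_def)

lemma valid_step:
  assumes v: "valid n t cfg" and nh: "\<not> halting M cfg"
  shows "valid n (Suc t) (step M cfg)"
proof -
  let ?d = "delta M (state cfg) (scanned M cfg)"
  have d: "fst ?d < states M" "snd ?d \<in> action_lists M"
    using delta_wf scanned_symbols[OF v] v by (auto simp: valid_def)
  show ?thesis
    unfolding valid_def
  proof (intro conjI allI impI)
    show "state (step M cfg) < states M"
      using d by (simp add: step_unfold[OF nh] Let_def)
    fix j assume j: "j < tapes M"
    have vj: "\<bar>head cfg j\<bar> \<le> int t" "\<And>i. tape cfg j i < symbols M"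
       "\<And>i. tape cfg j i \<noteq> 0 \<Longrightarrow> - int t \<le> i \<and> i < int (n + t)"
      using v j unfolding valid_def by auto
    show "\<bar>head (step M cfg) j\<bar> \<le> int (Suc t)"
      using vj(1) action_nth(2)[OF d(2) j] j by (auto simp: step_unfold[OF nh] Let_def)
    fix i
    show "tape (step M cfg) j i < symbols M"
      using vj(2) action_nth(1)[OF d(2) j] j by (auto simp: step_unfold[OF nh] Let_def)
    assume nz: "tape (step M cfg) j i \<noteq> 0"
    show "- int (Suc t) \<le> i" "i < int (n + Suc t)"
      using nz vj(1) vj(3)[of i] j by (auto simp: step_unfold[OF nh] Let_def split: if_splits)
  qed
qed

text \<open>The columns outside the queue are those that a pass assumes there, so \<open>column\<close> may be used
  at all indices.\<close>

lemma column_blank: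
  assumes "valid n t cfg" "i < - int t \<or> int (n + t) < i"
  shows "column M cfg i = blank M"
proof -
  have "tape cfg j i = 0 \<and> head cfg j \<noteq> i" if "j < tapes M" for j
  proof -
    have "\<bar>head cfg j\<bar> \<le> int t" "tape cfg j i \<noteq> 0 \<longrightarrow> - int t \<le> i \<and> i < int (n + t)"
      using assms(1) that unfolding valid_def by auto
    with assms(2) show ?thesis by auto
  qed
  moreover have "i \<noteq> 0" using assms(2) by auto
  ultimately show ?thesis
    by (auto simp: column_def blank_def intro!: nth_equalityI)
qed

lemma evolve_column:
  assumes v: "valid n t cfg" and nh: "\<not> halting M cfg"
    and acts: "acts = snd (delta M (state cfg) (scanned M cfg))"
  shows "evolve M acts (column M cfg (i - 1)) (column M cfg i) (column M cfg (i + 1)) =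
    column M (step M cfg) i"
proof -
  have "acts \<in> action_lists M"
    using delta_wf scanned_symbols[OF v] v acts by (auto simp: valid_def)
  note mv = action_nth(2)[OF this]
  have t: "tape (step M cfg) j i = (if head cfg j = i then fst (acts ! j) else tape cfg j i)"
    if "j < tapes M" for j
    using that by (simp add: step_unfold[OF nh] Let_def acts)
  have h: "head (step M cfg) j = i \<longleftrightarrow> head cfg j = i \<and> snd (acts ! j) = 0 \<or>
     head cfg j = i - 1 \<and> snd (acts ! j) = 1 \<or> head cfg j = i + 1 \<and> snd (acts ! j) = - 1"
    if "j < tapes M" for j
    using that mv[OF that] by (auto simp: step_unfold[OF nh] Let_def acts)
  show ?thesis
    by (simp add: evolve_def column_def t h cong: map_cong)
qed

lemma nth_observe_columns:
  assumes "j < tapes M" "length g = tapes M"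
  shows "fold (\<lambda>i. observe M (column M cfg i)) is g ! j =
    (if head cfg j \<in> set is then tape cfg j (head cfg j) else g ! j)"
  using assms(2)
  by (induction "is" arbitrary: g) (use assms(1) in \<open>auto simp: observe_def column_def\<close>)

lemma length_observe [simp]: "length (observe M a g) = tapes M"
  by (simp add: observe_def)

text \<open>A pass that has met all heads has collected the argument of the next transition.\<close>

lemma observe_columns_scanned:
  assumes "\<And>j. j < tapes M \<Longrightarrow> head cfg j \<in> set is" "length g = tapes M"
  shows "fold (\<lambda>i. observe M (column M cfg i)) is g = scanned M cfg"
proof (rule nth_equalityI)
  have len: "length (fold (\<lambda>i. observe M (column M cfg i)) is g) = tapes M"
    using assms(2) by (induction "is" arbitrary: g) auto
  show "length (fold (\<lambda>i. observe M (column M cfg i)) is g) = length (scanned M cfg)"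
    using len by (simp add: scanned_def)
  fix j assume "j < length (fold (\<lambda>i. observe M (column M cfg i)) is g)"
  then have j: "j < tapes M"
    using len by simp
  show "fold (\<lambda>i. observe M (column M cfg i)) is g ! j = scanned M cfg ! j"
    using nth_observe_columns[OF j assms(2)] assms(1)[OF j] j by (simp add: scanned_def)
qed

lemma observe_symbols:
  assumes "valid n t cfg" "g \<in> symbol_lists M"
  shows "observe M (column M cfg i) g \<in> symbol_lists M"
proof -
  have "g ! j < symbols M" if "j < tapes M" for j
  proof -
    have "g ! j \<in> set g" "set g \<subseteq> {..<symbols M}"
      using assms(2) that by (auto simp: symbol_lists_def)
    then show ?thesis by blast
  qed
  then show ?thesis
    using assms(1) by (auto simp: observe_def symbol_lists_def column_def valid_def)
qed

lemma Pass_phases: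
  "q < states M \<Longrightarrow> acts \<in> action_lists M \<Longrightarrow> a \<in> columns M \<Longrightarrow> b \<in> columns M \<Longrightarrow> g \<in> symbol_lists M
   \<Longrightarrow> Pass q acts a b g \<in> phases M"
  unfolding phases_def by (intro UnI2 image_eqI[of _ _ "(q, acts, a, b, g)"]) auto

abbreviation cols :: "config \<Rightarrow> int \<Rightarrow> int \<Rightarrow> letter list" where
  "cols cfg i k \<equiv> map (\<lambda>i. Col (column M cfg i)) [i..k]"

context
  fixes n t cfg d
  assumes v: "valid n t cfg" and nh: "\<not> halting M cfg"
    and d: "d = delta M (state cfg) (scanned M cfg)"
begin

text \<open>The invariant of a pass: the columns from \<open>i\<close> on are still to be read, the new columns up to
  \<open>i - 2\<close> have been appended.\<close>

lemma pass_columns: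
  assumes "g \<in> symbol_lists M"
  shows "leads_to (prog M) m
    (queue M (To (Pass (fst d) (snd d) (column M cfg (i - 2)) (column M cfg (i - 1)) g))
       (bits M (cols cfg i (i + int m - 1)) @ R))
    (queue M (To (Pass (fst d) (snd d) (column M cfg (i + int m - 2)) (column M cfg (i + int m - 1))
        (fold (\<lambda>i. observe M (column M (step M cfg) i)) [i - 1..i + int m - 2] g)))
       (R @ bits M (cols (step M cfg) (i - 1) (i + int m - 2))))"
  using assms
proof (induction m arbitrary: i R g)
  case 0
  then show ?case by (simp add: leads_to_refl)
next
  case (Suc m)
  let ?g = "observe M (column M (step M cfg) (i - 1)) g"
  have g: "?g \<in> symbol_lists M"
    using observe_symbols[OF valid_step[OF v nh] Suc.prems] .
  have ev: "evolve M (snd d) (column M cfg (i - 2)) (column M cfg (i - 1)) (column M cfg i)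
      = column M (step M cfg) (i - 1)"
    using evolve_column[OF v nh, of "snd d" "i - 1"] d by simp
  have dv: "fst d < states M" "snd d \<in> action_lists M"
    using delta_wf scanned_symbols[OF v] v d by (auto simp: valid_def)
  let ?rest = "bits M (cols cfg (i + 1) (i + int m))"
  let ?new = "bits M [Col (column M (step M cfg) (i - 1))]"
  have "leads_to (prog M) 1
     (queue M (To (Pass (fst d) (snd d) (column M cfg (i - 2)) (column M cfg (i - 1)) g))
       (bits M [Col (column M cfg i)] @ (?rest @ R)))
     (queue M (To (Pass (fst d) (snd d) (column M cfg (i - 1)) (column M cfg i) ?g))
       ((?rest @ R) @ ?new @ []))"
  proof (rule leads_to_prog)
    show "Pass (fst d) (snd d) (column M cfg (i - 2)) (column M cfg (i - 1)) g \<in> phases M"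
      using dv Suc.prems column_columns[OF v] by (intro Pass_phases)
    show "Col (column M cfg i) \<in> letters M"
      using column_columns[OF v] by (simp add: letters_def)
    show "transition M (Pass (fst d) (snd d) (column M cfg (i - 2)) (column M cfg (i - 1)) g) (Col (column M cfg i)) =
      (To (Pass (fst d) (snd d) (column M cfg (i - 1)) (column M cfg i) ?g), [Col (column M (step M cfg) (i - 1))], [])"
      by (simp add: ev)
  qed
  from this have 1: "leads_to (prog M) 1
     (queue M (To (Pass (fst d) (snd d) (column M cfg (i - 2)) (column M cfg (i - 1)) g))
       (bits M (cols cfg i (i + int (Suc m) - 1)) @ R))
     (queue M (To (Pass (fst d) (snd d) (column M cfg (i - 1)) (column M cfg i) ?g))
       (?rest @ (R @ ?new)))"
    by (simp add: upto_rec1[of i "i + int m"])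
  have 2: "leads_to (prog M) m
     (queue M (To (Pass (fst d) (snd d) (column M cfg (i - 1)) (column M cfg i) ?g))
       (?rest @ (R @ ?new)))
     (queue M (To (Pass (fst d) (snd d) (column M cfg (i + int m - 1)) (column M cfg (i + int m))
        (fold (\<lambda>i. observe M (column M (step M cfg) i)) [i..i + int m - 1] ?g)))
       ((R @ ?new) @ bits M (cols (step M cfg) i (i + int m - 1))))"
    using Suc.IH[OF g, of "i + 1" "R @ ?new"] by (simp add: algebra_simps)
  have "[i - 1..i + int m - 1] = (i - 1) # [i..i + int m - 1]"
    using upto_rec1[of "i - 1" "i + int m - 1"] by simp
  with leads_to_trans[OF 1 2] show ?case
    by (simp add: algebra_simps)
qed

lemma pass_end:
  assumes "g \<in> symbol_lists M" and hi: "hi = int (n + t)"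
  shows "leads_to (prog M) 1
    (queue M (To (Pass (fst d) (snd d) (column M cfg (hi - 1)) (column M cfg hi) g)) (bits M [End] @ R))
    (let e = enter M (fst d) (fold (\<lambda>i. observe M (column M (step M cfg) i)) [hi, hi + 1] g)
     in queue M (fst e) (R @ bits M (cols (step M cfg) hi (hi + 1) @ [End]) @ snd e))"
proof -
  have dv: "fst d < states M" "snd d \<in> action_lists M"
    using delta_wf scanned_symbols[OF v] v d by (auto simp: valid_def)
  have b: "column M cfg (hi + 1) = blank M" "column M cfg (hi + 1 + 1) = blank M"
    using column_blank[OF v] hi by auto
  have "evolve M (snd d) (column M cfg (hi - 1)) (column M cfg hi) (blank M) = column M (step M cfg) hi"
    "evolve M (snd d) (column M cfg hi) (blank M) (blank M) = column M (step M cfg) (hi + 1)"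
    using evolve_column[OF v nh, of "snd d" hi] evolve_column[OF v nh, of "snd d" "hi + 1"] d b
    by simp_all
  then have tr: "transition M (Pass (fst d) (snd d) (column M cfg (hi - 1)) (column M cfg hi) g) End =
    (let e = enter M (fst d) (fold (\<lambda>i. observe M (column M (step M cfg) i)) [hi, hi + 1] g)
     in (fst e, cols (step M cfg) hi (hi + 1) @ [End], snd e))"
    by (simp add: trans_Pass_End upto_rec1[of hi] Let_def)
  have "Pass (fst d) (snd d) (column M cfg (hi - 1)) (column M cfg hi) g \<in> phases M"
    using dv assms(1) column_columns[OF v] by (intro Pass_phases)
  from leads_to_prog[OF this _ tr[unfolded Let_def], of R] show ?thesis
    by (simp add: letters_def Let_def del: bits_simps)
qed

lemma pass_total:
  "leads_to (prog M) (n + 2 * t + 2)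
    (queue M (To (Pass (fst d) (snd d) (blank M) (blank M) (replicate (tapes M) 0)))
      (bits M (cols cfg (- int t) (int (n + t)) @ [End])))
    (let e = enter M (fst d) (scanned M (step M cfg))
     in queue M (fst e) (bits M (cols (step M cfg) (- int (Suc t)) (int (n + Suc t)) @ [End]) @ snd e))"
proof -
  let ?c = "step M cfg" and ?hi = "int (n + t)"
  let ?f = "fold (\<lambda>i. observe M (column M ?c i))"
  have g0: "replicate (tapes M) 0 \<in> symbol_lists M"
    using wf by (auto simp: symbol_lists_def wf_tm_def)
  have b: "column M cfg (- int t - 2) = blank M" "column M cfg (- int t - 1) = blank M"
    using column_blank[OF v] by auto
  let ?g = "?f [- int t - 1..?hi - 1] (replicate (tapes M) 0)"
  have g: "?g \<in> symbol_lists M"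
    by (rule fold_invariant[where Q = "\<lambda>_. True"])
      (use g0 observe_symbols[OF valid_step[OF v nh]] in auto)
  have 1: "leads_to (prog M) (n + 2 * t + 1)
     (queue M (To (Pass (fst d) (snd d) (blank M) (blank M) (replicate (tapes M) 0)))
      (bits M (cols cfg (- int t) ?hi) @ bits M [End]))
     (queue M (To (Pass (fst d) (snd d) (column M cfg (?hi - 1)) (column M cfg ?hi) ?g))
       (bits M [End] @ bits M (cols ?c (- int t - 1) (?hi - 1))))"
    using pass_columns[OF g0, of "n + 2 * t + 1" "- int t" "bits M [End]"]
    by (simp add: b algebra_simps del: bits_simps)
  have pair: "[?hi..?hi + 1] = [?hi, ?hi + 1]" by (simp add: upto_rec1)
  have up: "[- int (Suc t)..int (n + Suc t)] = [- int t - 1..?hi - 1] @ [?hi, ?hi + 1]"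
  proof -
    have e: "- int (Suc t) = - int t - 1" "int (n + Suc t) = ?hi + 1" by auto
    show ?thesis
      using upto_split1[of "- int t - 1" ?hi "?hi + 1"] unfolding e pair by auto
  qed
  have "?f [?hi, ?hi + 1] ?g = ?f [- int (Suc t)..int (n + Suc t)] (replicate (tapes M) 0)"
    unfolding up by simp
  also have "\<dots> = scanned M ?c"
  proof (rule observe_columns_scanned)
    fix j assume "j < tapes M"
    then have "\<bar>head ?c j\<bar> \<le> int (Suc t)"
      using valid_step[OF v nh] by (simp add: valid_def)
    then show "head ?c j \<in> set [- int (Suc t)..int (n + Suc t)]" by auto
  qed simp
  finally have sc: "?f [?hi, ?hi + 1] ?g = scanned M ?c" .
  have "bits M (cols ?c (- int t - 1) (?hi - 1)) @ bits M (cols ?c ?hi (?hi + 1) @ [End]) =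
      bits M (cols ?c (- int (Suc t)) (int (n + Suc t)) @ [End])"
    unfolding up pair by simp
  then show ?thesis
    using leads_to_trans[OF 1 pass_end[OF g refl, of "bits M (cols ?c (- int t - 1) (?hi - 1))"]]
    unfolding sc bits_simps(3)[of M "cols cfg (- int t) ?hi"]
    by (simp add: Let_def del: bits_simps flip: append_assoc)
qed

end

text \<open>The queue between two passes: the phase of the next pass has already been chosen from the state and
  the scanned symbols.\<close>

definition stage :: "nat \<Rightarrow> nat \<Rightarrow> config \<Rightarrow> word" where
  "stage n t cfg = (let e = enter M (state cfg) (scanned M cfg)
     in queue M (fst e) (bits M (cols cfg (- int t) (int (n + t)) @ [End]) @ snd e))"

lemma stage_step:
  assumes v: "valid n t cfg" and nh: "\<not> halting M cfg"
  shows "leads_to (prog M) (n + 2 * t + 2) (stage n t cfg) (stage n (Suc t) (step M cfg))"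
proof -
  let ?d = "delta M (state cfg) (scanned M cfg)"
  have "enter M (state cfg) (scanned M cfg) =
      (To (Pass (fst ?d) (snd ?d) (blank M) (blank M) (replicate (tapes M) 0)), [])"
    using nh by (simp add: enter_def halting_def)
  moreover have "state (step M cfg) = fst ?d"
    using step_unfold[OF nh] by (simp add: Let_def)
  ultimately show ?thesis
    using pass_total[OF v nh refl] by (simp add: stage_def Let_def)
qed

lemma column_init: "column M (init_config M x) (int i) =
    input_column M (if i < length x then sym_of_bit (x ! i) else 0) (i = 0)"
proof -
  obtain k where k: "tapes M = Suc k"
    using wf by (cases "tapes M") (auto simp: wf_tm_def)
  show ?thesis
    unfolding column_def input_column_def k map_upt_Suc
    by (auto simp: init_config_def map_replicate_const)
qed

lemma scanned_init: "scanned M (init_config M x) =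
   (if x = [] then 0 else sym_of_bit (hd x)) # replicate (tapes M - 1) 0"
proof -
  obtain k where k: "tapes M = Suc k"
    using wf by (cases "tapes M") (auto simp: wf_tm_def)
  show ?thesis
    unfolding scanned_def k map_upt_Suc
    by (auto simp: init_config_def map_replicate_const hd_conv_nth)
qed

lemma Seen_phases: "Seen (sym_of_bit b) \<in> phases M"
  using wf by (auto simp: phases_def wf_tm_def sym_of_bit_def)

lemma Bit_letters [simp]: "Bit b \<in> letters M" "End \<in> letters M"
  by (auto simp: letters_def)

lemma input_queue_eq: "input_queue x = queue M (To Start) (bits M (map Bit x @ [End]))"
proof -
  have "concat (map (\<lambda>b. if b then [False, True] else [True]) x) = bits M (map Bit x)"
    by (induction x) (auto simp: bits_def)
  then show ?thesis
    by (simp add: input_queue_def queue_def phase_num_def numeral_2_eq_2)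
qed

lemma leads_to_Seen:
  "leads_to (prog M) (length w) (queue M (To (Seen (sym_of_bit b))) (bits M (map Bit w) @ R))
    (queue M (To (Seen (sym_of_bit b)))
      (R @ bits M (map (\<lambda>b. Col (input_column M (sym_of_bit b) False)) w)))"
proof (induction w arbitrary: R)
  case Nil
  then show ?case by (simp add: leads_to_refl)
next
  case (Cons c w)
  let ?a = "Col (input_column M (sym_of_bit c) False)"
  have "leads_to (prog M) 1 (queue M (To (Seen (sym_of_bit b))) (bits M [Bit c] @ bits M (map Bit w) @ R))
      (queue M (To (Seen (sym_of_bit b))) ((bits M (map Bit w) @ R) @ bits M [?a] @ []))"
    by (rule leads_to_prog[OF Seen_phases]) auto
  from leads_to_trans[OF this[folded append_assoc, unfolded append_Nil2, unfolded append_assoc] Cons.IH[of "R @ bits M [?a]"]]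
  show ?case by simp
qed

lemma Start_phases [simp]: "Start \<in> phases M" "Before \<in> phases M" "Within \<in> phases M" "After \<in> phases M"
  by (auto simp: phases_def)

lemma input_stage: "leads_to (prog M) (length x + 1) (input_queue x) (stage (length x) 0 (init_config M x))"
proof (cases x)
  case Nil
  have "leads_to (prog M) 1 (queue M (To Start) (bits M [End] @ []))
     (let e = enter M (start M) (replicate (tapes M) 0) in
      queue M (fst e) ([] @ bits M [Col (input_column M 0 True), End] @ snd e))"
    unfolding Let_def by (rule leads_to_prog) (auto simp: Let_def)
  moreover have "replicate (tapes M) 0 = scanned M (init_config M [])"
    using wf unfolding scanned_init by (cases "tapes M") (auto simp: wf_tm_def)
  ultimately show ?thesis
    using column_init[of "[]" 0]
    by (simp add: input_queue_eq stage_def Nil Let_def init_config_def)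
next
  case (Cons b w)
  let ?c = "init_config M x"
  let ?a = "Col (input_column M (sym_of_bit b) True)" and ?z = "Col (input_column M 0 False)"
  let ?as = "map (\<lambda>b. Col (input_column M (sym_of_bit b) False)) w"
  let ?q = "To (Seen (sym_of_bit b))"
  let ?e = "enter M (start M) (sym_of_bit b # replicate (tapes M - 1) 0)"
  have 1: "leads_to (prog M) 1 (queue M (To Start) (bits M [Bit b] @ bits M (map Bit w) @ bits M [End]))
      (queue M ?q ((bits M (map Bit w) @ bits M [End]) @ bits M [?a] @ []))"
    by (rule leads_to_prog) auto
  have 2: "leads_to (prog M) (length w) (queue M ?q (bits M (map Bit w) @ bits M [End] @ bits M [?a]))
      (queue M ?q ((bits M [End] @ bits M [?a]) @ bits M ?as))"
    by (rule leads_to_Seen)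
  have 3: "leads_to (prog M) 1 (queue M ?q (bits M [End] @ (bits M [?a] @ bits M ?as)))
     (queue M (fst ?e) ((bits M [?a] @ bits M ?as) @ bits M [?z, End] @ snd ?e))"
    by (rule leads_to_prog[OF Seen_phases]) (auto simp: Let_def)
  have "cols ?c 0 (int (length x)) = ?a # ?as @ [?z]"
  proof (rule nth_equalityI)
    fix i assume "i < length (cols ?c 0 (int (length x)))"
    then have "i \<le> length x" by simp
    then show "cols ?c 0 (int (length x)) ! i = (?a # ?as @ [?z]) ! i"
      using column_init[of x i] Cons by (auto simp: nth_Cons nth_append split: nat.splits)
  qed (simp add: Cons)
  moreover have "?e = enter M (state ?c) (scanned M ?c)"
    unfolding scanned_init by (simp add: init_config_def Cons)
  ultimately have "stage (length x) 0 ?c = queue M (fst ?e) (bits M ([?a] @ ?as @ [?z] @ [End]) @ snd ?e)"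
    by (simp add: stage_def Let_def)
  then show ?thesis
    using leads_to_trans[OF leads_to_trans[OF 1] 3, of "length w"] 2
    by (simp add: input_queue_eq Cons)
qed

lemma leads_to_output:
  assumes "q \<in> {Before, Within, After}" "column M cfg i \<in> columns M"
    and "transition M q (Col (column M cfg i)) = (To q', [], w)"
  shows "leads_to (prog M) 1 (queue M (To q) (bits M (Col (column M cfg i) # as) @ R))
    (queue M (To q') (bits M as @ R @ w))"
  using leads_to_prog[of q M "Col (column M cfg i)" "To q'" "[]" w "bits M as @ R"] assms
  by (auto simp: letters_def)

text \<open>The columns before the origin are skipped, the bits of the output are appended, and the
  first blank ends the output; the columns after it are skipped as well.\<close>

lemma output_queue:
  assumes v: "valid n t cfg" and out: "has_output M cfg y"
  shows "leads_to (prog M) (n + 2 * t + 2)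
    (queue M (To Before) (bits M (cols cfg (- int t) (int (n + t)) @ [End]) @ R))
    (queue M Accept (R @ y))"
proof -
  let ?hi = "int (n + t)"
  obtain k where k: "tapes M = Suc k"
    using wf by (cases "tapes M") (auto simp: wf_tm_def)
  have col: "column M cfg i \<in> columns M" for i using column_columns[OF v] .
  have sym: "fst (snd (column M cfg i) ! k) = tape cfg k i" for i
    by (simp add: column_def k nth_append)
  have emit: "emit M (column M cfg (int i)) = (To Within, [], [y ! i])" if "i < length y" for i
    using out that by (auto simp: emit_def k sym has_output_def sym_of_bit_def)
  have emit_end: "emit M (column M cfg (int (length y))) = (To After, [], [])"
    using out by (auto simp: emit_def k sym has_output_def)
  \<comment> \<open>The last symbol of the output is not blank, so the blank behind it is still in the queue.\<close>
  have len: "int (length y) \<le> ?hi"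
  proof (cases y rule: rev_cases)
    case (snoc y' b)
    then have "tape cfg k (int (length y')) = sym_of_bit b"
      using out by (auto simp: has_output_def k dest!: spec[of _ "length y'"])
    then have "tape cfg k (int (length y')) \<noteq> 0" by (simp add: sym_of_bit_def)
    then have "int (length y') < int (n + t)"
      using v unfolding valid_def k by blast
    then show ?thesis using snoc by simp
  qed simp
  let ?T = "\<lambda>i. cols cfg i ?hi @ [End]"
  have before: "leads_to (prog M) m (queue M (To Before) (bits M (?T (- int m)) @ R))
     (queue M (To Before) (bits M (?T 0) @ R))" for m
  proof (induction m)
    case (Suc m)
    have up: "cols cfg (- int (Suc m)) ?hi = Col (column M cfg (- int (Suc m))) # cols cfg (- int m) ?hi"
      by (subst upto_rec1) auto
    have "leads_to (prog M) 1 (queue M (To Before) (bits M (?T (- int (Suc m))) @ R))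
        (queue M (To Before) (bits M (?T (- int m)) @ R @ []))"
      unfolding up append_Cons by (rule leads_to_output[OF _ col]) (auto simp: column_def)
    from leads_to_trans[OF this[unfolded append_Nil2] Suc] show ?case by simp
  qed (simp add: leads_to_refl)
  have within: "leads_to (prog M) m (queue M (To Within) (bits M (?T (int i)) @ R))
     (queue M (To Within) (bits M (?T (int (length y))) @ R @ drop i y))" if "i + m = length y" for m i R
    using that
  proof (induction m arbitrary: i R)
    case (Suc m)
    then have up: "cols cfg (int i) ?hi = Col (column M cfg (int i)) # cols cfg (int (Suc i)) ?hi"
      using len by (subst upto_rec1) (auto simp: add.commute)
    have "leads_to (prog M) 1 (queue M (To Within) (bits M (?T (int i)) @ R))
        (queue M (To Within) (bits M (?T (int (Suc i))) @ R @ [y ! i]))"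
      unfolding up append_Cons by (rule leads_to_output[OF _ col]) (use Suc.prems emit[of i] in auto)
    from leads_to_trans[OF this Suc.IH[of "Suc i" "R @ [y ! i]"]] Suc.prems show ?case
      by (simp add: Cons_nth_drop_Suc)
  qed (simp add: leads_to_refl)
  have after: "leads_to (prog M) m (queue M (To After) (bits M (?T (?hi + 1 - int m)) @ R))
     (queue M (To After) (bits M [End] @ R))" for m R
  proof (induction m)
    case (Suc m)
    have up: "cols cfg (?hi + 1 - int (Suc m)) ?hi =
        Col (column M cfg (?hi + 1 - int (Suc m))) # cols cfg (?hi + 1 - int m) ?hi"
    proof -
      have e: "?hi + 1 - int (Suc m) + 1 = ?hi + 1 - int m" by simp
      have "[?hi + 1 - int (Suc m)..?hi] = (?hi + 1 - int (Suc m)) # [?hi + 1 - int m..?hi]"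
        using upto_rec1[of "?hi + 1 - int (Suc m)" ?hi] unfolding e by linarith
      then show ?thesis by (simp only: list.map)
    qed
    have "leads_to (prog M) 1 (queue M (To After) (bits M (?T (?hi + 1 - int (Suc m))) @ R))
        (queue M (To After) (bits M (?T (?hi + 1 - int m)) @ R @ []))"
      unfolding up append_Cons by (rule leads_to_output[OF _ col]) auto
    from leads_to_trans[OF this[unfolded append_Nil2] Suc] show ?case by simp
  qed (simp add: leads_to_refl)
  have up0: "cols cfg 0 ?hi = Col (column M cfg 0) # cols cfg 1 ?hi"
    by (subst upto_rec1) auto
  have upl: "cols cfg (int (length y)) ?hi =
      Col (column M cfg (int (length y))) # cols cfg (int (length y) + 1) ?hi"
    using len by (subst upto_rec1) auto
  let ?m = "n + t - length y"
  have m: "int (length y) + 1 = ?hi + 1 - int ?m" using len by auto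
  have origin: "transition M Before (Col (column M cfg 0)) = emit M (column M cfg 0)"
    by (simp add: column_def)
  have main: "leads_to (prog M) (length y + 1) (queue M (To Before) (bits M (?T 0) @ R))
     (queue M (To After) (bits M (?T (int (length y) + 1)) @ R @ y))"
  proof (cases y)
    case Nil
    have "leads_to (prog M) 1 (queue M (To Before) (bits M (?T 0) @ R))
      (queue M (To After) (bits M (?T 1) @ R @ []))"
      unfolding up0 append_Cons
      by (rule leads_to_output[OF _ col]) (use Nil emit_end origin in auto)
    with Nil show ?thesis by simp
  next
    case (Cons b y')
    have 1: "leads_to (prog M) 1 (queue M (To Before) (bits M (?T 0) @ R))
      (queue M (To Within) (bits M (?T 1) @ R @ [y ! 0]))"
      unfolding up0 append_Cons
      by (rule leads_to_output[OF _ col]) (use Cons emit[of 0] origin in auto)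
    have 2: "leads_to (prog M) (length y - 1) (queue M (To Within) (bits M (?T 1) @ R @ [y ! 0]))
      (queue M (To Within) (bits M (?T (int (length y))) @ (R @ [y ! 0]) @ drop 1 y))"
      using within[of 1 "length y - 1" "R @ [y ! 0]"] Cons by simp
    have 3: "leads_to (prog M) 1
      (queue M (To Within) (bits M (?T (int (length y))) @ (R @ [y ! 0]) @ drop 1 y))
      (queue M (To After) (bits M (?T (int (length y) + 1)) @ ((R @ [y ! 0]) @ drop 1 y) @ []))"
      unfolding upl append_Cons
      by (rule leads_to_output[OF _ col]) (use emit_end in auto)
    from leads_to_trans[OF leads_to_trans[OF 1 2] 3] Cons show ?thesis by simp
  qed
  have fin: "leads_to (prog M) 1 (queue M (To After) (bits M [End] @ R @ y)) (queue M Accept ((R @ y) @ bits M [] @ []))"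
    by (rule leads_to_prog) auto
  have "leads_to (prog M) (t + (length y + 1) + ?m + 1)
     (queue M (To Before) (bits M (?T (- int t)) @ R)) (queue M Accept ((R @ y) @ bits M [] @ []))"
    by (intro leads_to_trans[OF _ fin] leads_to_trans[OF leads_to_trans[OF before main]])
      (rule after[of ?m "R @ y", folded m])
  moreover have e: "t + (length y + 1) + ?m + 1 = n + 2 * t + 2" using len by auto
  ultimately show ?thesis unfolding e by simp
qed

lemma run_Suc: "run M x (Suc t) = step M (run M x t)"
  by (simp add: run_def)

lemma run_halted: "halting M (run M x t) \<Longrightarrow> t \<le> T \<Longrightarrow> run M x T = run M x t"
proof (induction "T - t" arbitrary: T)
  case (Suc m)
  from Suc.hyps(2) obtain T' where T': "T = Suc T'" "m = T' - t" "t \<le> T'"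
    by (cases T) auto
  then show ?case
    using Suc.hyps(1)[OF T'(2) Suc.prems(1) T'(3)] Suc.prems(1) by (simp add: run_Suc step_def)
qed simp

text \<open>Pass \<open>i\<close> takes \<open>n + 2 i + 2\<close> steps, one for each letter of the queue.\<close>

lemma run_stages:
  assumes "\<And>i. i < t \<Longrightarrow> \<not> halting M (run M x i)"
  shows "valid (length x) t (run M x t) \<and> (\<exists>m \<le> (t + 1) * (length x + 2 * t + 1).
     leads_to (prog M) m (input_queue x) (stage (length x) t (run M x t)))"
  using assms
proof (induction t)
  case 0
  have "run M x 0 = init_config M x" by (simp add: run_def)
  then show ?case using valid_init input_stage[of x] by (auto intro!: exI[of _ "length x + 1"])
next
  case (Suc t)
  then have v: "valid (length x) t (run M x t)" and nh: "\<not> halting M (run M x t)" by auto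
  from Suc obtain m where m: "m \<le> (t + 1) * (length x + 2 * t + 1)"
    "leads_to (prog M) m (input_queue x) (stage (length x) t (run M x t))" by auto
  have "m + (length x + 2 * t + 2) \<le> (Suc t + 1) * (length x + 2 * Suc t + 1)"
    using m(1) by (simp add: algebra_simps)
  with leads_to_trans[OF m(2) stage_step[OF v nh]] valid_step[OF v nh] show ?case
    unfolding run_Suc by blast
qed

lemma computes_imp_qrun:
  assumes comp: "computes_in_time M f T"
  shows "\<exists>c \<le> (T (length x) + 2) * (length x + 2 * T (length x) + 3).
    qrun (prog M) c (input_queue x) = Some (0, f x)"
proof -
  let ?n = "length x" and ?T = "T (length x)"
  have hT: "halting M (run M x ?T)"
    using comp unfolding computes_in_time_def halting_def
    by (cases "f x") (auto dest!: spec[of _ x])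
  define t where "t = (LEAST t. halting M (run M x t))"
  have ht: "halting M (run M x t)" unfolding t_def using hT by (rule LeastI)
  have tT: "t \<le> ?T" unfolding t_def using hT by (rule Least_le)
  have nh: "\<not> halting M (run M x i)" if "i < t" for i
    using not_less_Least[of i "\<lambda>t. halting M (run M x t)"] that unfolding t_def by blast
  have rT: "run M x ?T = run M x t" using run_halted[OF ht tT] .
  from run_stages[OF nh] obtain m where v: "valid ?n t (run M x t)"
    and m: "m \<le> (t + 1) * (?n + 2 * t + 1)"
      "leads_to (prog M) m (input_queue x) (stage ?n t (run M x t))" by blast
  have bound: "m + (?n + 2 * t + 2) + 1 \<le> (?T + 2) * (?n + 2 * ?T + 3)"
  proof -
    have "m + (?n + 2 * t + 2) + 1 \<le> (t + 2) * (?n + 2 * t + 3)"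
      using m(1) by (simp add: algebra_simps)
    also have "\<dots> \<le> (?T + 2) * (?n + 2 * ?T + 3)"
      using tT by (intro mult_le_mono) auto
    finally show ?thesis .
  qed
  have ar: "accept M \<noteq> reject M" using wf by (simp add: wf_tm_def)
  show ?thesis
  proof (cases "f x")
    case None
    then have "state (run M x t) = reject M"
      using comp rT unfolding computes_in_time_def by (auto dest!: spec[of _ x])
    then have st: "stage ?n t (run M x t) =
        queue M Reject (bits M (cols (run M x t) (- int t) (int (?n + t)) @ [End]))"
      using ar by (simp add: stage_def enter_def)
    have "qstep (prog M) (stage ?n t (run M x t)) = Halt None"
      unfolding st by (rule qstep_Reject)
    moreover have "qrun (prog M) (m + 1) (input_queue x) = qrun (prog M) 1 (stage ?n t (run M x t))"
      using m(2) unfolding leads_to_def by blast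
    ultimately have "qrun (prog M) (m + 1) (input_queue x) = Some (0, f x)"
      using None by simp
    with bound show ?thesis by (intro exI[of _ "m + 1"]) simp
  next
    case (Some y)
    then have "state (run M x t) = accept M" and out: "has_output M (run M x t) y"
      using comp rT unfolding computes_in_time_def by (auto dest!: spec[of _ x])
    then have st: "stage ?n t (run M x t) =
      queue M (To Before) (bits M (cols (run M x t) (- int t) (int (?n + t)) @ [End]) @ [True])"
      by (simp add: stage_def enter_def)
    have "leads_to (prog M) (m + (?n + 2 * t + 2)) (input_queue x) (queue M Accept ([True] @ y))"
      using m(2) unfolding st by (rule leads_to_trans) (rule output_queue[OF v out])
    then have "qrun (prog M) (m + (?n + 2 * t + 2) + 1) (input_queue x) =
        qrun (prog M) 1 (queue M Accept ([True] @ y))"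
      unfolding leads_to_def by blast
    then have "qrun (prog M) (m + (?n + 2 * t + 2) + 1) (input_queue x) = Some (0, f x)"
      using Some by (simp add: queue_def)
    with bound show ?thesis by blast
  qed
qed

end

definition queue_computes :: "word \<Rightarrow> (word \<rightharpoonup> word) \<Rightarrow> nat poly \<Rightarrow> bool" where
  "queue_computes u f p \<longleftrightarrow>
     (\<forall>x. \<exists>c \<le> poly p (length x). qrun u c (input_queue x) = Some (0, f x))"

lemma queue_computes_if_polytime:
  assumes "polytime_computable f"
  shows "\<exists>u p. queue_computes u f p"
proof -
  from assms obtain M and p :: "nat poly" where M: "wf_tm M" "computes_in_time M f (poly p)"
    unfolding polytime_computable_def by blast
  have "queue_computes (prog M) f ((p + 2) * ([:0, 1:] + 2 * p + 3))"
    using computes_imp_qrun[OF M] unfolding queue_computes_def by simp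
  then show ?thesis by blast
qed

section \<open>Interpreting queue programs by stack programs\<close>

inductive_simps exec_simps:
  "exec Skip s z t s' z'"
  "exec (Push r b) s z t s' z'"
  "exec (Pop r) s z t s' z'"
  "exec (Out b) s z t s' z'"
  "exec (a ;; b) s z t s' z'"
  "exec (Case r a c d) s z t s' z'"

text \<open>On code without loops \<open>wp\<close> is computed by rewriting, times included. Loops enter these
  computations by \<open>wp_runs\<close>, once an upper bound for their time is known.\<close>

definition wp :: "com \<Rightarrow> (nat \<Rightarrow> store \<Rightarrow> word \<Rightarrow> bool) \<Rightarrow> store \<Rightarrow> word \<Rightarrow> bool" where
  "wp c Q s z \<longleftrightarrow> (\<exists>t s' z'. exec c s z t s' z' \<and> Q t s' z')"

lemma wp_Skip [simp]: "wp Skip Q s z \<longleftrightarrow> Q 1 s z"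
  by (simp add: wp_def exec_simps)

lemma wp_Push [simp]: "wp (Push r b) Q s z \<longleftrightarrow> Q 2 (s(r := b # s r)) z"
  by (simp add: wp_def exec_simps)

lemma wp_Pop [simp]: "wp (Pop r) Q s z \<longleftrightarrow> Q 1 (s(r := tl (s r))) z"
  by (simp add: wp_def exec_simps)

lemma wp_Out [simp]: "wp (Out b) Q s z \<longleftrightarrow> Q 1 s (z @ [b])"
  by (simp add: wp_def exec_simps)

lemma wp_Seq [simp]: "wp (a ;; b) Q s z \<longleftrightarrow> wp a (\<lambda>t1 s1 z1. wp b (\<lambda>t2. Q (Suc (t1 + t2))) s1 z1) s z"
  unfolding wp_def exec_simps by blast

lemma wp_Case [simp]: "wp (Case r a c d) Q s z \<longleftrightarrow>
    (case s r of [] \<Rightarrow> wp a (\<lambda>t. Q (Suc t)) s z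
       | b # _ \<Rightarrow> if b then wp d (\<lambda>t. Q (Suc t)) s z else wp c (\<lambda>t. Q (Suc t)) s z)"
proof -
  have "wp (Case r a c d) Q s z \<longleftrightarrow>
      wp (case s r of [] \<Rightarrow> a | b # _ \<Rightarrow> if b then d else c) (\<lambda>t. Q (Suc t)) s z"
    unfolding wp_def exec_simps by blast
  then show ?thesis by (simp split: list.split)
qed

definition runs :: "com \<Rightarrow> store \<Rightarrow> word \<Rightarrow> nat \<Rightarrow> store \<Rightarrow> word \<Rightarrow> bool" where
  "runs c s z T s' z' \<longleftrightarrow> (\<exists>t\<le>T. exec c s z t s' z')"

lemma runs_wp: "runs c s z T s' z' \<longleftrightarrow> wp c (\<lambda>t s1 z1. t \<le> T \<and> s1 = s' \<and> z1 = z') s z"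
  unfolding runs_def wp_def by blast

lemma wp_runs: "runs c s z T s' z' \<Longrightarrow> (\<And>t. t \<le> T \<Longrightarrow> Q t s' z') \<Longrightarrow> wp c Q s z"
  unfolding runs_def wp_def by blast

lemma runs_mono: "runs c s z T s' z' \<Longrightarrow> T \<le> T' \<Longrightarrow> s' = s'' \<Longrightarrow> runs c s z T' s'' z'"
  unfolding runs_def by (meson le_trans)

lemma runs_Seq: "runs a s z t1 s1 z1 \<Longrightarrow> runs b s1 z1 t2 s2 z2 \<Longrightarrow> runs (a ;; b) s z (Suc (t1 + t2)) s2 z2"
  unfolding runs_def by (meson Suc_le_mono add_mono exec_Seq)

lemma runs_While_end: "s r = [] \<Longrightarrow> runs (While r a) s z 1 s z"
  unfolding runs_def using exec_While_end by blast

lemma runs_While: "s r \<noteq> [] \<Longrightarrow> runs a s z t1 s1 z1 \<Longrightarrow> runs (While r a) s1 z1 t2 s2 z2 \<Longrightarrow>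
    runs (While r a) s z (Suc (t1 + t2)) s2 z2"
  unfolding runs_def by (meson Suc_le_mono add_mono exec_While)

definition For :: "nat \<Rightarrow> (bool \<Rightarrow> com) \<Rightarrow> com" where
  "For r body = While r (Case r Skip (Pop r ;; body False) (Pop r ;; body True))"

lemma runs_For_end: "s r = [] \<Longrightarrow> runs (For r body) s z 1 s z"
  unfolding For_def by (rule runs_While_end)

lemma runs_For:
  assumes r: "s r = b # w" and body: "runs (body b) (s(r := w)) z t1 s1 z1"
    and rest: "runs (For r body) s1 z1 t2 s2 z2"
  shows "runs (For r body) s z (t1 + t2 + 4) s2 z2"
proof -
  have "runs (Pop r ;; body b) s z (t1 + 2) s1 z1"
    unfolding runs_wp using r by (auto intro!: wp_runs[OF body])
  then have "runs (Case r Skip (Pop r ;; body False) (Pop r ;; body True)) s z (t1 + 3) s1 z1"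
    unfolding runs_wp wp_Case using r by (cases b) (auto simp: runs_wp wp_def)
  from runs_While[OF _ this rest[unfolded For_def]] r show ?thesis
    unfolding For_def by (auto elim: runs_mono)
qed

definition Clear :: "nat \<Rightarrow> com" where
  "Clear r = While r (Pop r)"

lemma runs_Clear: "runs (Clear r) s z (2 * length (s r) + 1) (s(r := [])) z"
proof (induction "s r" arbitrary: s)
  case Nil
  then show ?case
    unfolding Clear_def by (intro runs_mono[OF runs_While_end]) auto
next
  case (Cons b w)
  have s: "s r = b # w" using Cons(2) by simp
  have pop: "runs (Pop r) s z 1 (s(r := w)) z"
    using s by (simp add: runs_wp)
  have "runs (Clear r) (s(r := w)) z (2 * length w + 1) (s(r := [])) z"
    using Cons(1)[of "s(r := w)"] by simp
  from runs_While[OF _ pop this[unfolded Clear_def]] show ?case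
    unfolding Clear_def by (auto simp: s)
qed

definition Move :: "nat \<Rightarrow> nat \<Rightarrow> com" where
  "Move a b = For a (Push b)"

lemma runs_Move:
  assumes "a \<noteq> b"
  shows "runs (Move a b) s z (6 * length (s a) + 1) (s(a := [], b := rev (s a) @ s b)) z"
proof (induction "s a" arbitrary: s)
  case Nil
  then show ?case
    unfolding Move_def by (intro runs_mono[OF runs_For_end]) auto
next
  case (Cons x w)
  have s: "s a = x # w" using Cons(2) by simp
  have body: "runs (Push b x) (s(a := w)) z 2 (s(a := w, b := x # s b)) z"
    using assms by (simp add: runs_wp)
  have rest: "runs (Move a b) (s(a := w, b := x # s b)) z (6 * length w + 1)
      (s(a := [], b := rev w @ x # s b)) z"
    by (rule runs_mono[OF Cons(1)]) (use assms in auto)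
  show ?case
    unfolding Move_def
    by (rule runs_mono[OF runs_For[where body = "Push b", OF s body rest[unfolded Move_def]]]) (auto simp: s)
qed

definition Emit :: "nat \<Rightarrow> com" where
  "Emit r = For r Out"

lemma runs_Emit: "runs (Emit r) s z (5 * length (s r) + 1) (s(r := [])) (z @ s r)"
proof (induction "s r" arbitrary: s z)
  case Nil
  then have "s(r := []) = s" "z @ s r = z" by auto
  then show ?case
    unfolding Emit_def using runs_For_end[of s r Out z] Nil by (simp flip: Nil)
next
  case (Cons x w)
  have s: "s r = x # w" using Cons(2) by simp
  have body: "runs (Out x) (s(r := w)) z 1 (s(r := w)) (z @ [x])"
    by (simp add: runs_wp)
  have rest: "runs (Emit r) (s(r := w)) (z @ [x]) (5 * length w + 1) (s(r := [])) (z @ x # w)"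
    using Cons(1)[of "s(r := w)" "z @ [x]"] by simp
  show ?case
    unfolding Emit_def s
    by (rule runs_mono[OF runs_For[where body = Out, OF s body rest[unfolded Emit_def]]]) auto
qed

text \<open>The registers: \<open>rI\<close> holds the input, \<open>rA\<close> the verdict, \<open>rW\<close> the queue program and \<open>rU\<close> its
  working copy, \<open>rF\<close> the queue, \<open>rT\<close> scratch, \<open>rC\<close> the clock and \<open>rP\<close> the reversal of the input of
  the queue program. The others are loop flags: \<open>rK\<close> for the tokens of an entry, \<open>rH\<close> for the search
  for an entry, \<open>rG\<close> for the steps of a queue program, \<open>rM\<close> for the prefixes tried by the evaluator.\<close>

abbreviation (input) "rI \<equiv> 0 :: nat"
abbreviation (input) "rA \<equiv> 1 :: nat"
abbreviation (input) "rW \<equiv> 2 :: nat"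
abbreviation (input) "rU \<equiv> 3 :: nat"
abbreviation (input) "rF \<equiv> 4 :: nat"
abbreviation (input) "rT \<equiv> 5 :: nat"
abbreviation (input) "rH \<equiv> 6 :: nat"
abbreviation (input) "rK \<equiv> 7 :: nat"
abbreviation (input) "rG \<equiv> 8 :: nat"
abbreviation (input) "rC \<equiv> 9 :: nat"
abbreviation (input) "rP \<equiv> 10 :: nat"
abbreviation (input) "rM \<equiv> 11 :: nat"

text \<open>The queue is kept in one stack, front on top. To append, the stack is turned over and back; the cost
  is linear in its length, which is still polynomial in total.\<close>

definition Append :: "bool \<Rightarrow> com" where
  "Append b = Move rF rT ;; Push rF b ;; Move rT rF"

lemma runs_Append:
  assumes "s rT = []"
  shows "runs (Append b) s z (12 * length (s rF) + 6) (s(rF := s rF @ [b])) z"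
proof -
  let ?s1 = "s(rF := [], rT := rev (s rF))"
  have 1: "runs (Move rF rT) s z (6 * length (s rF) + 1) ?s1 z"
    using runs_Move[of rF rT s z] assms by simp
  have 2: "runs (Push rF b) ?s1 z 2 (?s1(rF := [b])) z"
    by (simp add: runs_wp)
  have 3: "runs (Move rT rF) (?s1(rF := [b])) z (6 * length (s rF) + 1) (s(rF := s rF @ [b])) z"
    by (rule runs_mono[OF runs_Move]) (use assms in auto)
  show ?thesis
    unfolding Append_def by (rule runs_mono[OF runs_Seq[OF 1 runs_Seq[OF 2 3]]]) auto
qed

definition Drop_entry :: com where
  "Drop_entry = Push rK True ;; While rK
     (Case rU (Pop rK)
        (Pop rU ;; Case rU (Pop rK) (Pop rU) (Pop rU))
        (Pop rU ;; Case rU (Pop rK) (Pop rU) (Pop rU ;; Pop rK)))"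

definition Run_entry :: com where
  "Run_entry = (let fail = Pop rK ;; Clear rF ;; Pop rG in
     Push rK True ;; While rK
     (Case rU fail
        (Pop rU ;; Case rU fail (Pop rU ;; Append False) (Pop rU ;; Append True))
        (Pop rU ;; Case rU fail (Pop rU ;; Push rF False) (Pop rU ;; Pop rK))))"

lemma runs_Drop_entry:
  assumes "s rK = []"
  shows "runs Drop_entry s z (5 * length (s rU) + 13) (s(rU := drop_entry (s rU))) z"
proof -
  let ?body = "Case rU (Pop rK)
        (Pop rU ;; Case rU (Pop rK) (Pop rU) (Pop rU))
        (Pop rU ;; Case rU (Pop rK) (Pop rU) (Pop rU ;; Pop rK))"
  have loop: "runs (While rK ?body) s z (5 * length v + 10) (s(rU := drop_entry v, rK := [])) z"
    if "s rU = v" "s rK = [True]" for s v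
    using that
  proof (induction v arbitrary: s rule: drop_entry.induct)
    case (1 v)
    have "runs ?body s z 8 (s(rU := v, rK := [])) z"
      using 1 by (simp add: runs_wp)
    then show ?case
      by (rule runs_mono[OF runs_While[OF _ _ runs_While_end], rotated]) (use 1 in auto)
  next
    case ("2_1" c v)
    have "runs ?body s z 7 (s(rU := v)) z"
      using "2_1"(2,3) by (simp add: runs_wp)
    moreover have "runs (While rK ?body) (s(rU := v)) z (5 * length v + 10) (s(rU := drop_entry v, rK := [])) z"
      by (rule runs_mono[OF "2_1"(1)]) (use "2_1"(3) in auto)
    ultimately show ?case
      by (rule runs_mono[OF runs_While, rotated]) (use "2_1"(3) in auto)
  next
    case ("2_2" b v)
    have "runs ?body s z 7 (s(rU := v)) z"
      using "2_2"(2,3) by (cases b) (simp_all add: runs_wp)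
    moreover have "runs (While rK ?body) (s(rU := v)) z (5 * length v + 10) (s(rU := drop_entry v, rK := [])) z"
      by (rule runs_mono[OF "2_2"(1)]) (use "2_2"(3) in auto)
    ultimately show ?case
      by (rule runs_mono[OF runs_While, rotated]) (use "2_2"(3) in auto)
  next
    case "3_1"
    have "runs ?body s z 4 (s(rK := [])) z"
      using "3_1" by (simp add: runs_wp)
    then show ?case
      by (rule runs_mono[OF runs_While[OF _ _ runs_While_end], rotated]) (use "3_1" in auto)
  next
    case "3_2"
    have "runs ?body s z 6 (s(rU := [], rK := [])) z"
      using "3_2" by (simp add: runs_wp)
    then show ?case
      by (rule runs_mono[OF runs_While[OF _ _ runs_While_end], rotated]) (use "3_2" in auto)
  next
    case "3_3"
    have "runs ?body s z 6 (s(rU := [], rK := [])) z"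
      using "3_3" by (simp add: runs_wp)
    then show ?case
      by (rule runs_mono[OF runs_While[OF _ _ runs_While_end], rotated]) (use "3_3" in auto)
  qed
  have push: "runs (Push rK True) s z 2 (s(rK := [True])) z"
    using assms by (simp add: runs_wp)
  show ?thesis
    unfolding Drop_entry_def
    by (rule runs_mono[OF runs_Seq[OF push loop[OF refl]]]) (use assms in auto)
qed

text \<open>A token shortens the program by two bits and lengthens the queue by at most one, so the
  sum of the two lengths bounds the cost of all appends in the entry.\<close>

lemma runs_Run_entry:
  assumes "s rK = []" "s rT = []"
  shows "runs Run_entry s z (20 * (length (s rU) + 1) * (length (s rU) + length (s rF) + 1) + 10)
    (case run_entry (s rU) (s rF) of Some Q \<Rightarrow> s(rU := drop_entry (s rU), rF := Q)
       | None \<Rightarrow> s(rU := drop_entry (s rU), rF := [], rG := tl (s rG))) z"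
proof -
  let ?fail = "Pop rK ;; Clear rF ;; Pop rG"
  let ?body = "Case rU ?fail
        (Pop rU ;; Case rU ?fail (Pop rU ;; Append False) (Pop rU ;; Append True))
        (Pop rU ;; Case rU ?fail (Pop rU ;; Push rF False) (Pop rU ;; Pop rK))"
  let ?result = "\<lambda>v Q (s :: store). case run_entry v Q of
      Some Q' \<Rightarrow> s(rU := drop_entry v, rF := Q', rK := [])
    | None \<Rightarrow> s(rU := drop_entry v, rF := [], rK := [], rG := tl (s rG))"
  have fail: "runs ?fail s z (2 * length (s rF) + 5) (s(rK := [], rF := [], rG := tl (s rG))) z"
    if "s rK = [True]" for s
    unfolding runs_wp wp_Seq wp_Pop
    by (rule wp_runs[OF runs_Clear]) (use that in \<open>auto simp: fun_eq_iff\<close>)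
  have app: "runs (Pop rU ;; Append b) s z (12 * length (s rF) + 8) (s(rU := tl (s rU), rF := s rF @ [b])) z"
    if "s rT = []" for s b
    unfolding runs_wp wp_Seq wp_Pop
    by (rule wp_runs[OF runs_Append]) (use that in \<open>auto simp: fun_eq_iff\<close>)
  have loop: "runs (While rK ?body) s z (20 * (length v + 1) * (length v + length Q + 1)) (?result v Q s) z"
    if "s rU = v" "s rF = Q" "s rK = [True]" "s rT = []" for s v Q
    using that
  proof (induction v Q arbitrary: s rule: run_entry.induct)
    case (1 v Q)
    have "runs ?body s z 8 (s(rU := v, rK := [])) z"
      using 1 by (simp add: runs_wp)
    then show ?case
      by (rule runs_mono[OF runs_While[OF _ _ runs_While_end], rotated]) (use 1 in \<open>auto simp: fun_eq_iff\<close>)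
  next
    case (2 v Q)
    have "runs ?body s z 9 (s(rU := v, rF := False # Q)) z"
      using 2(2-) by (simp add: runs_wp)
    moreover have "runs (While rK ?body) (s(rU := v, rF := False # Q)) z
       (20 * (length v + 1) * (length v + length (False # Q) + 1)) (?result v (False # Q) s) z"
      by (rule runs_mono[OF 2(1)]) (use 2(2-) in \<open>auto simp: fun_eq_iff split: option.split\<close>)
    ultimately show ?case
      by (rule runs_mono[OF runs_While, rotated]) (use 2(2-) in \<open>auto simp: algebra_simps split: option.split\<close>)
  next
    case (3 b v Q)
    have "runs ?body s z (12 * length Q + 15) (s(rU := v, rF := Q @ [b])) z"
      unfolding runs_wp using 3(2-)
      by (cases b) (auto intro!: wp_runs[OF runs_Append] simp: fun_eq_iff)
    moreover have "runs (While rK ?body) (s(rU := v, rF := Q @ [b])) z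
       (20 * (length v + 1) * (length v + length (Q @ [b]) + 1)) (?result v (Q @ [b]) s) z"
      by (rule runs_mono[OF 3(1)]) (use 3(2-) in \<open>auto simp: fun_eq_iff split: option.split\<close>)
    ultimately show ?case
      by (rule runs_mono[OF runs_While, rotated]) (use 3(2-) in \<open>auto simp: algebra_simps split: option.split\<close>)
  next
    case ("4_1" Q)
    have "runs ?body s z (2 * length Q + 6) (s(rK := [], rF := [], rG := tl (s rG))) z"
      unfolding runs_wp wp_Case using "4_1"
      by (simp del: wp_Seq) (rule wp_runs[OF fail], auto)
    then show ?case
      by (rule runs_mono[OF runs_While[OF _ _ runs_While_end], rotated])
        (use "4_1" in \<open>auto simp: fun_eq_iff algebra_simps\<close>)
  next
    case ("4_2" Q)
    have "runs ?body s z (2 * length Q + 10) (s(rU := [], rK := [], rF := [], rG := tl (s rG))) z"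
      unfolding runs_wp wp_Case using "4_2"
      by (simp del: wp_Seq, subst wp_Seq, simp del: wp_Seq)
        (rule wp_runs[OF fail], auto simp: fun_eq_iff)
    then show ?case
      by (rule runs_mono[OF runs_While[OF _ _ runs_While_end], rotated])
        (use "4_2" in \<open>auto simp: fun_eq_iff algebra_simps\<close>)
  next
    case ("4_3" b Q)
    have "runs ?body s z (2 * length Q + 10) (s(rU := [], rK := [], rF := [], rG := tl (s rG))) z"
      unfolding runs_wp wp_Case using "4_3"
      by (cases b) (auto intro!: wp_runs[OF runs_Clear] simp: fun_eq_iff)
    then show ?case
      by (rule runs_mono[OF runs_While[OF _ _ runs_While_end], rotated])
        (use "4_3" in \<open>auto simp: fun_eq_iff algebra_simps\<close>)
  qed
  have push: "runs (Push rK True) s z 2 (s(rK := [True])) z"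
    using assms by (simp add: runs_wp)
  show ?thesis
    unfolding Run_entry_def Let_def
    by (rule runs_mono[OF runs_Seq[OF push loop[OF refl refl]]])
      (use assms in \<open>auto simp: fun_eq_iff split: option.split\<close>)
qed

lemma length_drop_entry: "length (drop_entry v) \<le> length v"
  by (induction v rule: drop_entry.induct) auto

lemma length_run_entry: "run_entry v Q = Some Q' \<Longrightarrow> length Q' \<le> length Q + length v"
  by (induction v Q rule: run_entry.induct) fastforce+

lemma length_lookup: "lookup v Q = Some Q' \<Longrightarrow> length Q' \<le> length Q + length v"
proof (induction v Q rule: lookup.induct)
  case (2 v Q)
  then show ?case using length_run_entry by fastforce
next
  case (3 v Q)
  then show ?case using length_drop_entry[of v] by fastforce
qed simp

definition Lookup :: com where
  "Lookup = Push rH True ;; While rH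
     (Case rF (Pop rH ;; Pop rG) (Pop rF ;; Drop_entry) (Pop rF ;; Run_entry ;; Pop rH))"

text \<open>What is left of the working copy of the program is cleared later; only its length matters.\<close>

lemma runs_Lookup:
  assumes "s rH = []" "s rK = []" "s rT = []"
  shows "\<exists>v'. length v' \<le> length (s rU) \<and> runs Lookup s z (60 * (length (s rU) + length (s rF) + 1)^2)
    (case lookup (s rU) (s rF) of Some Q \<Rightarrow> s(rU := v', rF := Q)
       | None \<Rightarrow> s(rU := v', rF := [], rG := tl (s rG))) z"
proof -
  let ?res = "\<lambda>v Q v' (s :: store). case lookup v Q of Some Q' \<Rightarrow> s(rU := v', rF := Q', rH := [])
       | None \<Rightarrow> s(rU := v', rF := [], rH := [], rG := tl (s rG))"
  let ?run = "\<lambda>v Q (s :: store). case run_entry v Q of Some Q' \<Rightarrow> s(rU := drop_entry v, rF := Q', rH := [])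
       | None \<Rightarrow> s(rU := drop_entry v, rF := [], rH := [], rG := tl (s rG))"
  let ?cost = "\<lambda>v Q :: word. (length Q + 1) * (5 * length v + 18) + 20 * (length v + 1) * (length v + length Q + 1)"
  let ?body = "Case rF (Pop rH ;; Pop rG) (Pop rF ;; Drop_entry) (Pop rF ;; Run_entry ;; Pop rH)"
  have loop: "\<exists>v'. length v' \<le> length v \<and> runs (While rH ?body) s z
      (?cost v Q)
      (?res v Q v' s) z"
    if "s rU = v" "s rF = Q" "s rH = [True]" "s rK = []" "s rT = []" for s v Q
    using that
  proof (induction v Q arbitrary: s rule: lookup.induct)
    case (1 v)
    have "runs ?body s z 4 (s(rH := [], rG := tl (s rG))) z"
      using 1 by (simp add: runs_wp)
    then have "runs (While rH ?body) s z
      ((length ([] :: word) + 1) * (5 * length v + 18) + 20 * (length v + 1) * (length v + length ([] :: word) + 1))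
      (s(rU := v, rF := [], rH := [], rG := tl (s rG))) z"
      by (rule runs_mono[OF runs_While[OF _ _ runs_While_end], rotated])
        (use 1 in \<open>auto simp: fun_eq_iff\<close>)
    then show ?case unfolding lookup.simps option.case by blast
  next
    case (2 v Q)
    have "runs ?body s z (20 * (length v + 1) * (length v + length Q + 1) + 15)
      (?run v Q s) z"
      unfolding runs_wp using 2
      by (auto intro!: wp_runs[OF runs_Run_entry] simp: fun_eq_iff split: option.split)
    then have "runs (While rH ?body) s z (?cost v (True # Q))
      (?run v Q s) z"
      by (rule runs_mono[OF runs_While[OF _ _ runs_While_end], rotated])
        (use 2 in \<open>auto simp: algebra_simps split: option.split\<close>)
    then show ?case using length_drop_entry[of v] by (intro exI[of _ "drop_entry v"]) simp
  next
    case (3 v Q)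
    let ?s = "s(rF := Q, rU := drop_entry v)"
    have 1: "runs ?body s z (5 * length v + 16) ?s z"
      unfolding runs_wp using 3(2-)
      by (auto intro!: wp_runs[OF runs_Drop_entry] simp: fun_eq_iff)
    have "\<exists>v'. length v' \<le> length (drop_entry v) \<and>
      runs (While rH ?body) ?s z (?cost (drop_entry v) Q)
      (?res (drop_entry v) Q v' ?s) z"
      by (rule 3(1)) (use 3(2-) in auto)
    then obtain v' where v': "length v' \<le> length (drop_entry v)" and
      2: "runs (While rH ?body) ?s z (?cost (drop_entry v) Q)
      (?res (drop_entry v) Q v' ?s) z"
      by blast
    have "?cost (drop_entry v) Q \<le>
       ?cost v Q"
      using length_drop_entry[of v] by (intro add_mono mult_le_mono) auto
    note le = this
    have "runs (While rH ?body) s z (?cost v (False # Q))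
      (case lookup v (False # Q) of Some Q' \<Rightarrow> s(rU := v', rF := Q', rH := [])
       | None \<Rightarrow> s(rU := v', rF := [], rH := [], rG := tl (s rG))) z"
    proof (rule runs_mono[OF runs_While[OF _ 1 2]])
      show "s rH \<noteq> []" using 3(4) by simp
    qed (use le in \<open>auto simp: fun_eq_iff algebra_simps split: option.split\<close>)
    then show ?case using v' length_drop_entry[of v] by (intro exI[of _ v']) simp
  qed
  let ?u = "length (s rU)" and ?q = "length (s rF)"
  have push: "runs (Push rH True) s z 2 (s(rH := [True])) z"
    using assms by (simp add: runs_wp)
  let ?s = "s(rH := [True])"
  have "\<exists>v'. length v' \<le> ?u \<and> runs (While rH ?body) ?s z
      ((?q + 1) * (5 * ?u + 18) + 20 * (?u + 1) * (?u + ?q + 1))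
      (?res (s rU) (s rF) v' ?s) z"
    by (rule loop) (use assms in auto)
  then obtain v' where v': "length v' \<le> ?u" and
    *: "runs (While rH ?body) ?s z ((?q + 1) * (5 * ?u + 18) + 20 * (?u + 1) * (?u + ?q + 1))
      (?res (s rU) (s rF) v' ?s) z"
    by blast
  have "Suc (2 + ((?q + 1) * (5 * ?u + 18) + 20 * (?u + 1) * (?u + ?q + 1))) \<le> 60 * (?u + ?q + 1)^2"
    by (simp add: power2_eq_square algebra_simps)
  then show ?thesis
    using v' assms unfolding Lookup_def
    by (intro exI[of _ v'] conjI) (auto intro!: runs_mono[OF runs_Seq[OF push *]] simp: fun_eq_iff split: option.split)
qed

definition Copy :: com where
  "Copy = Move rW rT ;; For rT (\<lambda>b. Push rW b ;; Push rU b)"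

lemma runs_Copy:
  assumes "s rT = []" "s rU = []"
  shows "runs Copy s z (15 * length (s rW) + 3) (s(rU := s rW)) z"
proof -
  let ?For = "For rT (\<lambda>b. Push rW b ;; Push rU b)"
  have loop: "runs ?For s z (9 * length (s rT) + 1)
      (s(rT := [], rW := rev (s rT) @ s rW, rU := rev (s rT) @ s rU)) z" for s
  proof (induction "s rT" arbitrary: s)
    case Nil
    then show ?case by (intro runs_mono[OF runs_For_end]) (auto simp: fun_eq_iff)
  next
    case (Cons b w)
    have s: "s rT = b # w" using Cons(2) by simp
    let ?s = "s(rT := w, rW := b # s rW, rU := b # s rU)"
    have body: "runs (Push rW b ;; Push rU b) (s(rT := w)) z 5 ?s z"
      by (simp add: runs_wp)
    have rest: "runs ?For ?s z (9 * length w + 1)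
        (s(rT := [], rW := rev (s rT) @ s rW, rU := rev (s rT) @ s rU)) z"
      by (rule runs_mono[OF Cons(1)]) (use s in \<open>auto simp: fun_eq_iff\<close>)
    show ?case
      by (rule runs_mono[OF runs_For[where body = "\<lambda>b. Push rW b ;; Push rU b", OF s body rest]])
        (auto simp: s)
  qed
  have move: "runs (Move rW rT) s z (6 * length (s rW) + 1) (s(rW := [], rT := rev (s rW))) z"
    using runs_Move[of rW rT s z] assms by simp
  show ?thesis
    unfolding Copy_def
    by (rule runs_mono[OF runs_Seq[OF move loop]]) (use assms in \<open>auto simp: fun_eq_iff\<close>)
qed

lemma runs_Case:
  assumes "s r = w" "runs (case w of [] \<Rightarrow> a | b # _ \<Rightarrow> if b then d else c) s z T s1 z1"
  shows "runs (Case r a c d) s z (Suc T) s1 z1"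
  using assms exec_Case unfolding runs_def by blast

definition Step :: com where
  "Step = Case rF (Pop rG) (Pop rF ;; Copy ;; Lookup ;; Clear rU) (Pop rF ;; Push rA True ;; Pop rG)"

text \<open>The effect of halting on the store. The flag \<open>rG\<close> ends the enclosing loop.\<close>

definition settle :: "word option \<Rightarrow> store \<Rightarrow> store" where
  "settle r s = (case r of None \<Rightarrow> s(rF := [], rG := []) | Some y \<Rightarrow> s(rF := y, rA := True # s rA, rG := []))"

definition idle :: "store \<Rightarrow> bool" where
  "idle s \<longleftrightarrow> s rU = [] \<and> s rT = [] \<and> s rH = [] \<and> s rK = []"

lemma runs_Step:
  assumes idle: "idle s" and G: "s rG = [True]"
  shows "runs Step s z (90 * (length (s rW) + length (s rF) + 1)^2)
    (case qstep (s rW) (s rF) of Halt r \<Rightarrow> settle r s | Cont Q \<Rightarrow> s(rF := Q)) z"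
proof (cases "s rF")
  case Nil
  then show ?thesis
    using G unfolding runs_wp Step_def by (auto simp: settle_def fun_eq_iff power2_eq_square)
next
  case (Cons b Q)
  let ?w = "length (s rW)" and ?q = "length Q"
  show ?thesis
  proof (cases b)
    case True
    then show ?thesis
      using Cons G unfolding runs_wp Step_def by (auto simp: settle_def fun_eq_iff power2_eq_square)
  next
    case False
    let ?s1 = "s(rF := Q)"
    let ?s2 = "?s1(rU := s rW)"
    have pop: "runs (Pop rF) s z 1 ?s1 z"
      using Cons by (simp add: runs_wp)
    have copy: "runs Copy ?s1 z (15 * ?w + 3) ?s2 z"
      by (rule runs_mono[OF runs_Copy]) (use idle in \<open>auto simp: idle_def\<close>)
    have "\<exists>v'. length v' \<le> length (?s2 rU) \<and>
      runs Lookup ?s2 z (60 * (length (?s2 rU) + length (?s2 rF) + 1)^2)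
        (case lookup (?s2 rU) (?s2 rF) of Some Q \<Rightarrow> ?s2(rU := v', rF := Q)
         | None \<Rightarrow> ?s2(rU := v', rF := [], rG := tl (?s2 rG))) z"
      by (rule runs_Lookup) (use idle in \<open>auto simp: idle_def\<close>)
    note ex = this
    obtain v' where v': "length v' \<le> ?w" and
      lookup: "runs Lookup ?s2 z (60 * (?w + ?q + 1)^2)
        (case lookup (s rW) Q of Some Q \<Rightarrow> ?s2(rU := v', rF := Q)
         | None \<Rightarrow> ?s2(rU := v', rF := [], rG := tl (s rG))) z" (is "runs _ _ _ _ ?s3 _")
    proof -
      have e: "?s2 rU = s rW" "?s2 rF = Q" "?s2 rG = s rG" by auto
      assume *: "\<And>v'. length v' \<le> ?w \<Longrightarrow> runs Lookup ?s2 z (60 * (?w + ?q + 1)^2)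
        (case lookup (s rW) Q of Some Q \<Rightarrow> ?s2(rU := v', rF := Q)
         | None \<Rightarrow> ?s2(rU := v', rF := [], rG := tl (s rG))) z \<Longrightarrow> thesis"
      show thesis using ex unfolding e by (blast intro: *)
    qed
    have clear: "runs (Clear rU) ?s3 z (2 * ?w + 1) (?s3(rU := [])) z"
      by (rule runs_mono[OF runs_Clear]) (use v' in \<open>auto split: option.split\<close>)
    have le: "60 * (?w + ?q + 1)^2 + 17 * ?w + 30 \<le> 90 * (?w + length (s rF) + 1)^2"
      using Cons by (simp add: power2_eq_square algebra_simps)
    have "runs (Pop rF ;; Copy ;; Lookup ;; Clear rU) s z (60 * (?w + ?q + 1)^2 + 17 * ?w + 20)
      (case qstep (s rW) (s rF) of Halt r \<Rightarrow> settle r s | Cont Q \<Rightarrow> s(rF := Q)) z"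
      by (rule runs_mono[OF runs_Seq[OF pop runs_Seq[OF copy runs_Seq[OF lookup clear]]]])
        (use Cons False idle G in \<open>auto simp: settle_def idle_def fun_eq_iff split: option.split\<close>)
    note branch = this
    have "runs Step s z (Suc (60 * (?w + ?q + 1)^2 + 17 * ?w + 20))
      (case qstep (s rW) (s rF) of Halt r \<Rightarrow> settle r s | Cont Q \<Rightarrow> s(rF := Q)) z"
      unfolding Step_def by (rule runs_Case[of s rF "False # Q"]) (use Cons False branch in simp_all)
    then show ?thesis by (rule runs_mono) (use le in simp_all)
  qed
qed

lemma length_qstep: "qstep u Q = Cont Q' \<Longrightarrow> length Q' \<le> length Q + length u"
  by (induction u Q rule: qstep.induct) (auto split: option.splits dest: length_lookup)

text \<open>A step lengthens the queue by at most the length of the program, so \<open>N\<close> bounds the queue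
  throughout the run.\<close>

lemma runs_Steps:
  assumes "qrun (s rW) c (s rF) = Some (c', r)" "idle s" "s rG = [True]"
    and "length (s rF) + Suc c * length (s rW) + 1 \<le> N"
  shows "runs (While rG Step) s z (c * (90 * N^2 + 1) + 1) (settle r s) z"
  using assms
proof (induction c arbitrary: s)
  case (Suc c)
  let ?t = "90 * (length (s rW) + length (s rF) + 1)^2"
  have "?t \<le> 90 * N^2"
    using Suc.prems(4) by (intro mult_le_mono power_mono) auto
  then have step: "runs Step s z (90 * N^2)
    (case qstep (s rW) (s rF) of Halt r \<Rightarrow> settle r s | Cont Q \<Rightarrow> s(rF := Q)) z"
    by (rule runs_mono[OF runs_Step[OF Suc.prems(2,3)]]) simp
  show ?case
  proof (cases "qstep (s rW) (s rF)")
    case (Halt r')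
    with Suc.prems have r: "r' = r" by simp
    have step': "runs Step s z (90 * N^2) (settle r s) z" using step Halt r by simp
    show ?thesis
      by (rule runs_mono[OF runs_While[OF _ step' runs_While_end]])
        (use Suc.prems in \<open>auto simp: settle_def split: option.split\<close>)
  next
    case (Cont Q)
    have step': "runs Step s z (90 * N^2) (s(rF := Q)) z" using step Cont by simp
    have rest: "runs (While rG Step) (s(rF := Q)) z (c * (90 * N^2 + 1) + 1) (settle r (s(rF := Q))) z"
      by (rule Suc.IH) (use Suc.prems Cont length_qstep[OF Cont] in \<open>auto simp: idle_def\<close>)
    show ?thesis
      by (rule runs_mono[OF runs_While[OF _ step' rest]])
        (use Suc.prems in \<open>auto simp: settle_def fun_eq_iff split: option.split\<close>)
  qed
qed simp

text \<open>An exhausted clock stops the run of the queue program and also the evaluator.\<close>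

definition Clocked :: com where
  "Clocked = Case rC (Clear rF ;; Pop rG ;; Pop rM) (Pop rC ;; Step) (Pop rC ;; Step)"

lemma runs_Clocked:
  assumes "s rC = replicate c True" "idle s" "s rG = [True]" "s rM = [True]"
    and "length (s rF) + Suc c * length (s rW) + 1 \<le> N"
  shows "runs (While rG Clocked) s z ((c + 1) * (90 * N^2 + 10) + 2 * N)
    (case qrun (s rW) c (s rF) of None \<Rightarrow> s(rF := [], rG := [], rC := [], rM := [])
       | Some (c', r) \<Rightarrow> settle r (s(rC := replicate c' True))) z"
  using assms
proof (induction c arbitrary: s)
  case 0
  have "runs Clocked s z (2 * length (s rF) + 6) (s(rF := [], rG := [], rM := [])) z"
    unfolding Clocked_def runs_wp using 0
    by (auto intro!: wp_runs[OF runs_Clear] simp: fun_eq_iff)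
  then show ?case
    by (rule runs_mono[OF runs_While[OF _ _ runs_While_end], rotated])
      (use 0 in \<open>auto simp: fun_eq_iff\<close>)
next
  case (Suc c)
  let ?t = "90 * (length (s rW) + length (s rF) + 1)^2"
  let ?s = "s(rC := replicate c True)"
  have le: "?t \<le> 90 * N^2"
    using Suc.prems(5) by (intro mult_le_mono power_mono) auto
  have "runs Step ?s z (90 * (length (?s rW) + length (?s rF) + 1)^2)
    (case qstep (?s rW) (?s rF) of Halt r \<Rightarrow> settle r ?s | Cont Q \<Rightarrow> ?s(rF := Q)) z"
    by (rule runs_Step) (use Suc.prems in \<open>auto simp: idle_def\<close>)
  then have "runs Step ?s z (90 * N^2)
    (case qstep (s rW) (s rF) of Halt r \<Rightarrow> settle r ?s | Cont Q \<Rightarrow> ?s(rF := Q)) z"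
    by (rule runs_mono) (use le in auto)
  from wp_runs[OF this] have "runs Clocked s z (90 * N^2 + 4)
    (case qstep (s rW) (s rF) of Halt r \<Rightarrow> settle r ?s | Cont Q \<Rightarrow> ?s(rF := Q)) z"
    unfolding runs_wp Clocked_def using Suc.prems by simp
  note step = this
  show ?case
  proof (cases "qstep (s rW) (s rF)")
    case (Halt r')
    have step': "runs Clocked s z (90 * N^2 + 4) (settle r' ?s) z" using step Halt by simp
    show ?thesis
      by (rule runs_mono[OF runs_While[OF _ step' runs_While_end]])
        (use Suc.prems Halt in \<open>auto simp: settle_def split: option.split\<close>)
  next
    case (Cont Q)
    have step': "runs Clocked s z (90 * N^2 + 4) (?s(rF := Q)) z" using step Cont by simp
    have rest: "runs (While rG Clocked) (?s(rF := Q)) z ((c + 1) * (90 * N^2 + 10) + 2 * N)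
      (case qrun (s rW) c Q of None \<Rightarrow> s(rF := [], rG := [], rC := [], rM := [])
       | Some (c', r) \<Rightarrow> settle r (s(rC := replicate c' True))) z"
      by (rule runs_mono[OF Suc.IH])
       (use Suc.prems Cont length_qstep[OF Cont] in \<open>auto simp: idle_def settle_def fun_eq_iff split: option.split\<close>)
    show ?thesis
      by (rule runs_mono[OF runs_While[OF _ step' rest]])
        (use Suc.prems Cont in \<open>auto simp: settle_def fun_eq_iff split: option.split\<close>)
  qed
qed

section \<open>Composition of polynomial-time functions\<close>

text \<open>The queue is a stack with its front on top, so it is filled from its end: first the end
  marker, then the letters, the last one first. For this order \<open>rP\<close> contains the word reversed.\<close>

definition Setup :: com where
  "Setup = Push rF True ;; Push rF False ;; Push rF False ;;
     For rP (\<lambda>b. Push rT b ;; Push rF True ;; (if b then Push rF False else Skip)) ;;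
     Move rT rP ;; Push rF False"

lemma runs_Setup:
  assumes "s rT = []" "s rF = []"
  shows "runs Setup s z (20 * length (s rP) + 30) (s(rF := input_queue (rev (s rP)))) z"
proof -
  let ?code = "\<lambda>b. if b then [False, True] else [True]"
  let ?body = "\<lambda>b. Push rT b ;; Push rF True ;; (if b then Push rF False else Skip)"
  have loop: "runs (For rP ?body) s z (12 * length (s rP) + 1)
      (s(rP := [], rT := rev (s rP) @ s rT, rF := concat (map ?code (rev (s rP))) @ s rF)) z" for s
  proof (induction "s rP" arbitrary: s)
    case Nil
    then show ?case by (intro runs_mono[OF runs_For_end]) (auto simp: fun_eq_iff)
  next
    case (Cons b w)
    have s: "s rP = b # w" using Cons(2) by simp
    let ?s = "s(rP := w, rT := b # s rT, rF := ?code b @ s rF)"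
    have body: "runs (?body b) (s(rP := w)) z 8 ?s z"
      by (simp add: runs_wp)
    have rest: "runs (For rP ?body) ?s z (12 * length w + 1)
        (s(rP := [], rT := rev (s rP) @ s rT, rF := concat (map ?code (rev (s rP))) @ s rF)) z"
      by (rule runs_mono[OF Cons(1)]) (use s in \<open>auto simp: fun_eq_iff\<close>)
    show ?case
      by (rule runs_mono[OF runs_For[where body = ?body, OF s body rest]]) (auto simp: s)
  qed
  let ?s1 = "s(rF := [False, False, True])"
  let ?s2 = "s(rP := [], rT := rev (s rP), rF := concat (map ?code (rev (s rP))) @ [False, False, True])"
  let ?s3 = "s(rF := concat (map ?code (rev (s rP))) @ [False, False, True])"
  have 1: "runs (For rP ?body) ?s1 z (12 * length (s rP) + 1) ?s2 z"
    by (rule runs_mono[OF loop]) (use assms in \<open>auto simp: fun_eq_iff\<close>)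
  have 2: "runs (Move rT rP) ?s2 z (6 * length (s rP) + 1) ?s3 z"
    by (rule runs_mono[OF runs_Move]) (use assms in \<open>auto simp: fun_eq_iff\<close>)
  have 3: "runs (For rP ?body ;; Move rT rP ;; Push rF False) ?s1 z (18 * length (s rP) + 10)
      (s(rF := input_queue (rev (s rP)))) z"
  proof (rule runs_mono[OF runs_Seq[OF 1 runs_Seq[OF 2]]])
    show "runs (Push rF False) ?s3 z 2 (s(rF := input_queue (rev (s rP)))) z"
      by (simp add: runs_wp input_queue_def)
  qed auto
  show ?thesis
    unfolding Setup_def runs_wp using assms
    by (simp del: wp_Seq add: wp_Seq[of "Push rF b" for b]) (rule wp_runs[OF 3], auto)
qed

primrec Load :: "nat \<Rightarrow> word \<Rightarrow> com" where
  "Load r [] = Skip"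
| "Load r (b # w) = Load r w ;; Push r b"

lemma runs_Load: "runs (Load r w) s z (3 * length w + 1) (s(r := w @ s r)) z"
proof (induction w)
  case Nil
  show ?case by (simp add: runs_wp)
next
  case (Cons b w)
  show ?case
    unfolding Load.simps by (rule runs_mono[OF runs_Seq[OF Cons]]) (auto simp: runs_wp)
qed

lemma length_input_queue: "length (input_queue x) \<le> 2 * length x + 4"
  by (induction x) (auto simp: input_queue_def)

lemma length_qrun: "qrun u c Q = Some (c', Some y) \<Longrightarrow> length y \<le> length Q + c * length u"
proof (induction c arbitrary: Q)
  case (Suc c)
  show ?case
  proof (cases "qstep u Q")
    case (Halt r)
    with Suc.prems show ?thesis
      by (cases "(u, Q)" rule: qstep.cases) (auto split: option.splits)
  next
    case (Cont Q')
    with Suc.prems Suc.IH[of Q'] length_qstep[OF Cont] show ?thesis by simp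
  qed
qed simp

definition Compute :: com where
  "Compute = Setup ;; Push rG True ;; While rG Step"

definition size_bound :: "word \<Rightarrow> nat poly \<Rightarrow> nat poly" where
  "size_bound u p = [:5, 2:] + (p + 1) * [:length u:]"

definition time_bound :: "word \<Rightarrow> nat poly \<Rightarrow> nat poly" where
  "time_bound u p = [:40, 20:] + p * (90 * size_bound u p ^ 2 + 1)"

lemma runs_Compute:
  assumes comp: "queue_computes (s rW) f p" and idle: "idle s"
    and s: "s rF = []" "s rG = []" "s rP = rev x"
  shows "runs Compute s z (poly (time_bound (s rW) p) (length x)) (settle (f x) s) z"
    and "f x = Some y \<Longrightarrow> length y \<le> poly (size_bound (s rW) p) (length x)"
proof -
  from comp obtain c where c: "c \<le> poly p (length x)" "qrun (s rW) c (input_queue x) = Some (0, f x)"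
    unfolding queue_computes_def by blast
  let ?s1 = "s(rF := input_queue x)"
  let ?s2 = "s(rF := input_queue x, rG := [True])"
  let ?N = "poly (size_bound (s rW) p) (length x)"
  have N: "length (input_queue x) + Suc c * length (s rW) + 1 \<le> ?N"
  proof -
    have "c * length (s rW) \<le> poly p (length x) * length (s rW)"
      by (rule mult_le_mono1[OF c(1)])
    moreover have "?N = 2 * length x + 5 + (poly p (length x) * length (s rW) + length (s rW))"
      by (simp add: size_bound_def algebra_simps)
    ultimately show ?thesis
      using length_input_queue[of x] unfolding mult_Suc by linarith
  qed
  have 1: "runs Setup s z (20 * length x + 30) ?s1 z"
    by (rule runs_mono[OF runs_Setup]) (use s idle in \<open>auto simp: idle_def\<close>)
  have 2: "runs (Push rG True) ?s1 z 2 ?s2 z"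
    using s by (simp add: runs_wp fun_eq_iff)
  have 3: "runs (While rG Step) ?s2 z (c * (90 * ?N^2 + 1) + 1) (settle (f x) ?s2) z"
    by (rule runs_Steps) (use c idle N in \<open>auto simp: idle_def\<close>)
  have "c * (90 * ?N^2 + 1) \<le> poly p (length x) * (90 * ?N^2 + 1)"
    by (rule mult_le_mono1[OF c(1)])
  then show "runs Compute s z (poly (time_bound (s rW) p) (length x)) (settle (f x) s) z"
    unfolding Compute_def
    by (intro runs_mono[OF runs_Seq[OF 1 runs_Seq[OF 2 3]]])
      (auto simp: time_bound_def settle_def fun_eq_iff algebra_simps split: option.split)
  assume "f x = Some y"
  then show "length y \<le> ?N"
    using length_qrun[of "s rW" c "input_queue x" 0 y] c(2) N by simp
qed

definition Compose :: "word \<Rightarrow> word \<Rightarrow> com" where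
  "Compose u v = (let second = Pop rA ;; Clear rP ;; Move rF rP ;; Clear rW ;; Load rW u ;; Compute ;; Emit rF
     in Load rW v ;; Move rI rP ;; Compute ;; Case rA Skip second second)"

text \<open>Both functions have queue programs, which become constants of one stack program. Interpreted
  one after the other, they need time polynomial in the length of the intermediate word, which is polynomial
  in the length of the input.\<close>

lemma polytime_comp:
  assumes "polytime_computable f" "polytime_computable g"
  shows "polytime_computable (f \<circ>\<^sub>m g)"
proof -
  from queue_computes_if_polytime assms obtain u p v q where
    u: "queue_computes u f p" and v: "queue_computes v g q" by metis
  let ?second = "Pop rA ;; Clear rP ;; Move rF rP ;; Clear rW ;; Load rW u ;; Compute ;; Emit rF"
  define S where "S = size_bound v q"
  define T2 where "T2 = [:40 + 2 * length v + 3 * length u, 2:] + 6 * S + time_bound u p \<circ>\<^sub>p S + 5 * size_bound u p \<circ>\<^sub>p S"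
  define T where "T = [:10 + 3 * length v, 6:] + time_bound v q + T2"
  have "decides (Compose u v) (f \<circ>\<^sub>m g) T"
    unfolding decides_def
  proof
    fix x
    define s0 where "s0 = ((\<lambda>r. []) :: store)(0 := x)"
    define s1 where "s1 = ((\<lambda>r. []) :: store)(rW := v, rP := rev x)"
    let ?n = "length x" and ?s = "settle (g x) s1" and ?branch = "Case rA Skip ?second ?second"
    have load: "runs (Load rW v) s0 [] (3 * length v + 1) (s0(rW := v)) []"
      by (rule runs_mono[OF runs_Load]) (auto simp: s0_def)
    have move: "runs (Move rI rP) (s0(rW := v)) [] (6 * ?n + 1) s1 []"
      by (rule runs_mono[OF runs_Move]) (auto simp: s0_def s1_def fun_eq_iff)
    have c1: "runs Compute s1 [] (poly (time_bound v q) ?n) ?s []"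
      by (rule runs_mono[OF runs_Compute(1)[where f = g and p = q and x = x]])
        (use v in \<open>auto simp: s1_def idle_def\<close>)
    have "\<exists>s z. runs ?branch ?s [] (poly T2 ?n + 2) s z \<and>
       (f \<circ>\<^sub>m g) x = (if s rA = [] then None else Some z)"
    proof (cases "g x")
      case None
      have "runs ?branch ?s [] 2 ?s []"
        using None by (simp add: runs_wp settle_def s1_def)
      then have "runs ?branch ?s [] (poly T2 ?n + 2) ?s []"
        by (rule runs_mono) auto
      moreover have "(f \<circ>\<^sub>m g) x = (if settle (g x) s1 rA = [] then None else Some [])"
        using None by (simp add: settle_def s1_def)
      ultimately show ?thesis by blast
    next
      case (Some y)
      have y: "length y \<le> poly S ?n"
        using runs_Compute(2)[of s1 g q x y] v Some by (auto simp: s1_def idle_def S_def)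
      define s2 where "s2 = ((\<lambda>r. []) :: store)(rW := v, rP := rev x, rF := y)"
      define s3 where "s3 = ((\<lambda>r. []) :: store)(rW := u, rP := rev y)"
      let ?s4 = "(settle (f y) s3)(rF := [])" and ?out = "case f y of None \<Rightarrow> [] | Some w \<Rightarrow> w"
      have pop: "runs (Pop rA) ?s [] 1 s2 []"
        using Some by (auto simp: runs_wp settle_def s1_def s2_def fun_eq_iff)
      have clearP: "runs (Clear rP) s2 [] (2 * ?n + 1) (s2(rP := [])) []"
        by (rule runs_mono[OF runs_Clear]) (auto simp: s2_def)
      have moveF: "runs (Move rF rP) (s2(rP := [])) [] (6 * length y + 1) (s3(rW := v)) []"
        by (rule runs_mono[OF runs_Move]) (auto simp: s2_def s3_def fun_eq_iff)
      have clearW: "runs (Clear rW) (s3(rW := v)) [] (2 * length v + 1) (s3(rW := [])) []"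
        by (rule runs_mono[OF runs_Clear]) (auto simp: s3_def)
      have loadW: "runs (Load rW u) (s3(rW := [])) [] (3 * length u + 1) s3 []"
        by (rule runs_mono[OF runs_Load]) (auto simp: s3_def fun_eq_iff)
      have c2: "runs Compute s3 [] (poly (time_bound u p) (length y)) (settle (f y) s3) []"
        by (rule runs_mono[OF runs_Compute(1)[where f = f and p = p and x = y]])
          (use u in \<open>auto simp: s3_def idle_def\<close>)
      have emit: "runs (Emit rF) (settle (f y) s3) [] (5 * poly (size_bound u p) (length y) + 1)
         ?s4 ?out"
      proof -
        have "length (settle (f y) s3 rF) \<le> poly (size_bound u p) (length y)"
          using runs_Compute(2)[of s3 f p y] u
          by (auto simp: settle_def s3_def idle_def split: option.split)
        moreover have e: "[] @ settle (f y) s3 rF = ?out"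
          by (auto simp: settle_def split: option.split)
        ultimately show ?thesis
          by (intro runs_mono[OF runs_Emit[of rF "settle (f y) s3" "[]", unfolded e]]) auto
      qed
      have "poly (time_bound u p) (length y) \<le> poly (time_bound u p) (poly S ?n)"
        "poly (size_bound u p) (length y) \<le> poly (size_bound u p) (poly S ?n)"
        using poly_nat_mono[OF y] by auto
      then have "runs ?second ?s [] (poly T2 ?n)
         ?s4 ?out"
        using y by (intro runs_mono[OF runs_Seq[OF pop runs_Seq[OF clearP runs_Seq[OF moveF
            runs_Seq[OF clearW runs_Seq[OF loadW runs_Seq[OF c2 emit]]]]]]] refl)
          (simp add: T2_def poly_pcompose)
      then have "runs ?branch ?s [] (Suc (poly T2 ?n))
         ?s4 ?out"
        by (intro runs_Case[of _ rA "[True]"]) (use Some in \<open>auto simp: settle_def s1_def\<close>)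
      then have "runs ?branch ?s [] (poly T2 ?n + 2)
         ?s4 ?out"
        by (rule runs_mono) auto
      moreover have "(f \<circ>\<^sub>m g) x = (if ?s4 rA = [] then None
          else Some ?out)"
        using Some by (auto simp: settle_def s3_def split: option.split)
      ultimately show ?thesis by blast
    qed
    then obtain s z where fin: "runs ?branch ?s [] (poly T2 ?n + 2) s z"
      and res: "(f \<circ>\<^sub>m g) x = (if s rA = [] then None else Some z)" by blast
    have "runs (Compose u v) s0 [] (poly T ?n) s z"
      unfolding Compose_def Let_def
      by (rule runs_mono[OF runs_Seq[OF load runs_Seq[OF move runs_Seq[OF c1 fin]]]])
        (auto simp: T_def)
    then show "\<exists>t s z. exec (Compose u v) ((\<lambda>r. [])(0 := x)) [] t s z \<and> t \<le> poly T (length x) \<and>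
      (f \<circ>\<^sub>m g) x = (if s 1 = [] then None else Some z)"
      using res unfolding runs_def s0_def by blast
  qed
  then show ?thesis by (rule polytime_if_decides)
qed

definition Prepend :: "word \<Rightarrow> com" where
  "Prepend w = foldr (\<lambda>b c. Out b ;; c) w (Emit rI ;; Push rA True)"

lemma polytime_prepend: "polytime_computable (\<lambda>x. Some (w @ x))"
proof -
  have run: "runs (Prepend w) s z (2 * length w + 5 * length (s rI) + 4) (s(rI := [], rA := True # s rA)) (z @ w @ s rI)" for s z
  proof (induction w arbitrary: z)
    case Nil
    show ?case
      unfolding Prepend_def runs_wp by (auto intro!: wp_runs[OF runs_Emit])
  next
    case (Cons b w)
    have "runs (Out b) s z 1 s (z @ [b])" by (simp add: runs_wp)
    from runs_Seq[OF this Cons[of "z @ [b]"]]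
    have "runs (Prepend (b # w)) s z (Suc (1 + (2 * length w + 5 * length (s rI) + 4)))
        (s(rI := [], rA := True # s rA)) (z @ (b # w) @ s rI)"
      by (simp only: Prepend_def foldr.simps o_apply append_assoc append_Cons append_Nil)
    then show ?case by (rule runs_mono) auto
  qed
  have "decides (Prepend w) (\<lambda>x. Some (w @ x)) [:2 * length w + 4, 5:]"
    unfolding decides_def
  proof
    fix x
    show "\<exists>t s z. exec (Prepend w) ((\<lambda>r. [])(0 := x)) [] t s z \<and>
        t \<le> poly [:2 * length w + 4, 5:] (length x) \<and> Some (w @ x) = (if s 1 = [] then None else Some z)"
    proof -
      let ?s = "((\<lambda>r. []) :: store)(0 := x)"
      from run[of ?s "[]"] obtain t where "t \<le> 2 * length w + 5 * length (?s rI) + 4"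
        "exec (Prepend w) ?s [] t (?s(rI := [], rA := True # ?s rA)) ([] @ w @ ?s rI)"
        unfolding runs_def by blast
      then show ?thesis
        by (intro exI[of _ t] exI[of _ "?s(rI := [], rA := True # ?s rA)"] exI[of _ "[] @ w @ ?s rI"]) auto
    qed
  qed
  then show ?thesis by (rule polytime_if_decides)
qed

section \<open>A program for the evaluator\<close>

text \<open>In \<open>search u c p r\<close> the prefix \<open>p\<close> of the input is tried next, \<open>r\<close> is the rest of the input, and \<open>c\<close> is
  the clock. The charge for a new prefix ensures that the clock bounds the length of
  the prefix twice over, as every trial takes at least one step.\<close>

primrec search :: "word \<Rightarrow> nat \<Rightarrow> word \<Rightarrow> word \<Rightarrow> word option" where
  "search u c p [] = (case qrun u c (input_queue p) of
     Some (c', Some y) \<Rightarrow> Some y | _ \<Rightarrow> None)"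
| "search u c p (b # r) = (case qrun u c (input_queue p) of
     None \<Rightarrow> None
   | Some (c', Some y) \<Rightarrow> Some (y @ b # r)
   | Some (c', None) \<Rightarrow> search u (c' - 1) (p @ [b]) r)"

text \<open>The first component is the decoded word in reverse, as it is found on a stack.\<close>

fun parse :: "word \<Rightarrow> word \<Rightarrow> (word \<times> word) option" where
  "parse a (False # b # z) = parse (b # a) z"
| "parse a (True # True # z) = Some (a, z)"
| "parse a _ = None"

text \<open>If the program is not shorter than the word behind its code, the truncated difference is 0, and with the
  clock 0 every search fails (\<open>search_0\<close>). So short inputs need no separate treatment.\<close>

definition evaluator :: "word \<rightharpoonup> word" where
  "evaluator z = (case parse [] z of None \<Rightarrow> None
     | Some (a, x) \<Rightarrow> search (rev a) (length x - length a) [] x)"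

definition Parse_step :: com where
  "Parse_step =
     Case rI (Pop rH)
        (Pop rI ;; Case rI (Pop rH) (Pop rI ;; Push rT False) (Pop rI ;; Push rT True))
        (Pop rI ;; Case rI (Pop rH) (Pop rH) (Pop rI ;; Pop rH ;; Push rM True))"

definition Parse :: com where
  "Parse = Push rH True ;; While rH Parse_step"

text \<open>The clock gets one unit for each bit of \<open>rI\<close> and loses one for each bit of the program, while
  the program is turned over from \<open>rT\<close> to \<open>rW\<close>.\<close>

definition Wind :: com where
  "Wind = Move rI rF ;; For rF (\<lambda>b. Push rI b ;; Push rC True) ;; For rT (\<lambda>b. Push rW b ;; Pop rC)"

definition Try_prefix :: com where
  "Try_prefix = Setup ;; Push rG True ;; While rG Clocked"

definition Next_prefix :: com where
  "Next_prefix =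
     (let done = Pop rM ;; Emit rF ;; Emit rI
      in Case rA
          (Case rM Skip Skip (Case rI (Pop rM) (Pop rI ;; Push rP False ;; Pop rC) (Pop rI ;; Push rP True ;; Pop rC)))
          done done)"

definition Evaluator :: com where
  "Evaluator = Parse ;; Case rM Skip Skip (Wind ;; While rM (Try_prefix ;; Next_prefix))"

lemma runs_Parse_loop:
  assumes "s rI = w" "s rT = a" "s rH = [True]" "s rM = []"
  shows "\<exists>s'. runs (While rH Parse_step) s z (6 * length w + 10) s' z \<and>
     (case parse a w of None \<Rightarrow> s' rA = s rA \<and> s' rM = []
        | Some (a', x) \<Rightarrow> s' = s(rI := x, rT := a', rH := [], rM := [True]))"
  using assms
proof (induction a w arbitrary: s rule: parse.induct)
  case (1 a b w)
  let ?s = "s(rI := w, rT := b # a)"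
  have body: "runs Parse_step s z 9 ?s z"
    using 1(2-) by (cases b) (auto simp: runs_wp Parse_step_def fun_eq_iff)
  have "\<exists>s'. runs (While rH Parse_step) ?s z (6 * length w + 10) s' z \<and>
     (case parse (b # a) w of None \<Rightarrow> s' rA = ?s rA \<and> s' rM = []
        | Some (a', x) \<Rightarrow> s' = ?s(rI := x, rT := a', rH := [], rM := [True]))"
    by (rule 1(1)) (use 1(2-) in auto)
  then obtain s' where rest: "runs (While rH Parse_step) ?s z (6 * length w + 10) s' z"
    and s': "case parse (b # a) w of None \<Rightarrow> s' rA = ?s rA \<and> s' rM = []
        | Some (a', x) \<Rightarrow> s' = ?s(rI := x, rT := a', rH := [], rM := [True])" by blast
  have "runs (While rH Parse_step) s z (6 * length (False # b # w) + 10) s' z"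
    by (rule runs_mono[OF runs_While[OF _ body rest]]) (use 1(2-) in auto)
  moreover have "case parse a (False # b # w) of None \<Rightarrow> s' rA = s rA \<and> s' rM = []
        | Some (a', x) \<Rightarrow> s' = s(rI := x, rT := a', rH := [], rM := [True])"
    using s' by (auto simp: fun_eq_iff split: option.splits)
  ultimately show ?case by blast
next
  case (2 a w)
  have "runs Parse_step s z 12 (s(rI := w, rH := [], rM := [True])) z"
    using 2 by (simp add: runs_wp Parse_step_def fun_eq_iff)
  then have "runs (While rH Parse_step) s z (6 * length (True # True # w) + 10) (s(rI := w, rH := [], rM := [True])) z"
    by (rule runs_mono[OF runs_While[OF _ _ runs_While_end], rotated]) (use 2 in auto)
  moreover have "s(rI := w, rH := [], rM := [True]) = s(rI := w, rT := a, rH := [], rM := [True])"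
    using 2 by (auto simp: fun_eq_iff)
  ultimately show ?case unfolding parse.simps option.case prod.case by blast
next
  case ("3_1" a)
  have "runs Parse_step s z 4 (s(rH := [])) z"
    using "3_1" by (simp add: runs_wp Parse_step_def fun_eq_iff)
  then have "runs (While rH Parse_step) s z (6 * length ([] :: word) + 10) (s(rH := [])) z"
    by (rule runs_mono[OF runs_While[OF _ _ runs_While_end], rotated]) (use "3_1" in auto)
  then show ?case
    by (intro exI[of _ "s(rH := [])"] conjI, assumption) (use "3_1" in auto)
next
  case ("3_2" a)
  have "runs Parse_step s z 6 (s(rI := [], rH := [])) z"
    using "3_2" by (simp add: runs_wp Parse_step_def fun_eq_iff)
  then have "runs (While rH Parse_step) s z (6 * length [True] + 10) (s(rI := [], rH := [])) z"
    by (rule runs_mono[OF runs_While[OF _ _ runs_While_end], rotated]) (use "3_2" in auto)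
  then show ?case
    by (intro exI[of _ "s(rI := [], rH := [])"] conjI, assumption) (use "3_2" in auto)
next
  case ("3_4" a b)
  have "runs Parse_step s z 6 (s(rI := [], rH := [])) z"
    using "3_4" by (cases b) (auto simp: runs_wp Parse_step_def fun_eq_iff)
  then have "runs (While rH Parse_step) s z (6 * length [b] + 10) (s(rI := [], rH := [])) z"
    by (rule runs_mono[OF runs_While[OF _ _ runs_While_end], rotated]) (use "3_4" in auto)
  then show ?case
    by (intro exI[of _ "s(rI := [], rH := [])"] conjI, assumption) (use "3_4" in auto)
next
  case ("3_3" a w)
  have "runs Parse_step s z 6 (s(rI := False # w, rH := [])) z"
    using "3_3" by (auto simp: runs_wp Parse_step_def fun_eq_iff)
  then have "runs (While rH Parse_step) s z (6 * length (True # False # w) + 10) (s(rI := False # w, rH := [])) z"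
    by (rule runs_mono[OF runs_While[OF _ _ runs_While_end], rotated]) (use "3_3" in auto)
  then show ?case
    by (intro exI[of _ "s(rI := False # w, rH := [])"] conjI, assumption) (use "3_3" in auto)
qed

lemma runs_Wind:
  assumes "s rF = []" "s rC = []" "s rW = []"
  shows "runs Wind s z (21 * length (s rI) + 9 * length (s rT) + 10)
    (s(rT := [], rW := rev (s rT), rC := replicate (length (s rI) - length (s rT)) True)) z"
proof -
  let ?fill = "\<lambda>b. Push rI b ;; Push rC True" and ?drain = "\<lambda>b. Push rW b ;; Pop rC"
  have fill: "runs (For rF ?fill) s z (9 * length (s rF) + 1)
      (s(rF := [], rI := rev (s rF) @ s rI, rC := replicate (length (s rF)) True @ s rC)) z" for s
  proof (induction "s rF" arbitrary: s)
    case Nil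
    then show ?case by (intro runs_mono[OF runs_For_end]) (auto simp: fun_eq_iff)
  next
    case (Cons b w)
    have s: "s rF = b # w" using Cons(2) by simp
    let ?s = "s(rF := w, rI := b # s rI, rC := True # s rC)"
    have body: "runs (?fill b) (s(rF := w)) z 5 ?s z"
      by (simp add: runs_wp)
    have rest: "runs (For rF ?fill) ?s z (9 * length w + 1)
        (s(rF := [], rI := rev (s rF) @ s rI, rC := replicate (length (s rF)) True @ s rC)) z"
      by (rule runs_mono[OF Cons(1)]) (use s in \<open>auto simp: fun_eq_iff replicate_app_Cons_same\<close>)
    show ?case
      by (rule runs_mono[OF runs_For[where body = ?fill, OF s body rest]]) (auto simp: s)
  qed
  have drain: "runs (For rT ?drain) s z (8 * length (s rT) + 1)
      (s(rT := [], rW := rev (s rT) @ s rW, rC := drop (length (s rT)) (s rC))) z" for s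
  proof (induction "s rT" arbitrary: s)
    case Nil
    then show ?case by (intro runs_mono[OF runs_For_end]) (auto simp: fun_eq_iff)
  next
    case (Cons b w)
    have s: "s rT = b # w" using Cons(2) by simp
    let ?s = "s(rT := w, rW := b # s rW, rC := tl (s rC))"
    have body: "runs (?drain b) (s(rT := w)) z 4 ?s z"
      by (simp add: runs_wp)
    have rest: "runs (For rT ?drain) ?s z (8 * length w + 1)
        (s(rT := [], rW := rev (s rT) @ s rW, rC := drop (length (s rT)) (s rC))) z"
      by (rule runs_mono[OF Cons(1)]) (use s in \<open>auto simp: fun_eq_iff drop_Suc\<close>)
    show ?case
      by (rule runs_mono[OF runs_For[where body = ?drain, OF s body rest]]) (auto simp: s)
  qed
  let ?n = "length (s rI)"
  let ?s1 = "s(rI := [], rF := rev (s rI))" and ?s2 = "s(rC := replicate ?n True)"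
  have 1: "runs (Move rI rF) s z (6 * ?n + 1) ?s1 z"
    by (rule runs_mono[OF runs_Move]) (use assms in auto)
  have 2: "runs (For rF ?fill) ?s1 z (9 * ?n + 1) ?s2 z"
    by (rule runs_mono[OF fill]) (use assms in \<open>auto simp: fun_eq_iff\<close>)
  have 3: "runs (For rT ?drain) ?s2 z (8 * length (s rT) + 1)
    (s(rT := [], rW := rev (s rT), rC := replicate (?n - length (s rT)) True)) z"
    by (rule runs_mono[OF drain]) (use assms in \<open>auto simp: fun_eq_iff\<close>)
  show ?thesis
    unfolding Wind_def by (rule runs_mono[OF runs_Seq[OF 1 runs_Seq[OF 2 3]]]) auto
qed

text \<open>If the prefix, the clock and the program have length at most \<open>n\<close>, then this bounds the queue at
  all times of a trial.\<close>

definition queue_bound :: "nat \<Rightarrow> nat" where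
  "queue_bound n = 2 * n + 5 + (n + 1) * n"

definition try_cost :: "nat \<Rightarrow> nat" where
  "try_cost n = (n + 1) * (90 * queue_bound n ^ 2 + 10) + 2 * queue_bound n + 20 * n + 50"

lemma runs_Try_prefix:
  assumes s: "s rC = replicate c True" "idle s" "s rG = []" "s rM = [True]" "s rF = []" "s rP = rev p"
    and le: "length p \<le> n" "c \<le> n" "length (s rW) \<le> n"
  shows "runs Try_prefix s z (try_cost n)
    (case qrun (s rW) c (input_queue p) of None \<Rightarrow> s(rC := [], rM := [])
       | Some (c', r) \<Rightarrow> settle r (s(rC := replicate c' True))) z"
proof -
  let ?N = "queue_bound n"
  let ?s1 = "s(rF := input_queue p)" and ?s2 = "s(rF := input_queue p, rG := [True])"
  have "Suc c * length (s rW) \<le> (n + 1) * n"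
    using le by (intro mult_le_mono) auto
  then have N: "length (input_queue p) + Suc c * length (s rW) + 1 \<le> ?N"
    using length_input_queue[of p] le(1) unfolding queue_bound_def by linarith
  have 1: "runs Setup s z (20 * n + 30) ?s1 z"
    by (rule runs_mono[OF runs_Setup]) (use s le in \<open>auto simp: idle_def\<close>)
  have 2: "runs (Push rG True) ?s1 z 2 ?s2 z"
    using s by (simp add: runs_wp fun_eq_iff)
  have 3: "runs (While rG Clocked) ?s2 z ((c + 1) * (90 * ?N^2 + 10) + 2 * ?N)
    (case qrun (?s2 rW) c (?s2 rF) of None \<Rightarrow> ?s2(rF := [], rG := [], rC := [], rM := [])
       | Some (c', r) \<Rightarrow> settle r (?s2(rC := replicate c' True))) z"
    by (rule runs_Clocked) (use s N in \<open>auto simp: idle_def\<close>)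
  have le2: "(c + 1) * (90 * ?N^2 + 10) \<le> (n + 1) * (90 * ?N^2 + 10)"
    using le(2) by (intro mult_le_mono1) simp
  show ?thesis
    unfolding Try_prefix_def try_cost_def
  proof (rule runs_mono[OF runs_Seq[OF 1 runs_Seq[OF 2 3]]])
    show "Suc (20 * n + 30 + Suc (2 + ((c + 1) * (90 * ?N\<^sup>2 + 10) + 2 * ?N)))
      \<le> (n + 1) * (90 * ?N\<^sup>2 + 10) + 2 * ?N + 20 * n + 50"
      using le2 by linarith
  qed (use s in \<open>auto simp: settle_def fun_eq_iff split: option.split\<close>)
qed

lemma qrun_clock: "qrun u c Q = Some (c', r) \<Longrightarrow> c' < c"
  by (induction c arbitrary: Q) (auto split: outcome.splits simp: less_Suc_eq)

lemma search_None: "qrun u c (input_queue p) = None \<Longrightarrow> search u c p r = None"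
  by (cases r) auto

lemma search_accept: "qrun u c (input_queue p) = Some (c', Some y) \<Longrightarrow> search u c p r = Some (y @ r)"
  by (cases r) auto

text \<open>Induction on the rest of the input. The loop ends with the current trial if the clock is
  exhausted, if the prefix is accepted, or if there is no longer prefix.\<close>

lemma runs_loop:
  assumes "s rW = u" "s rC = replicate c True" "idle s" "s rG = []" "s rM = [True]" "s rF = []"
    "s rP = rev p" "s rI = r" "s rA = []"
    and "length p + length r \<le> n" "c \<le> n" "length u \<le> n"
  shows "\<exists>s' z'. runs (While rM (Try_prefix ;; Next_prefix)) s []
      ((length r + 1) * (try_cost n + 5 * queue_bound n + 5 * n + 20)) s' z' \<and>
    search u c p r = (if s' rA = [] then None else Some z')"
proof -
  let ?loop = "While rM (Try_prefix ;; Next_prefix)"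
  let ?t = "try_cost n + 5 * queue_bound n + 5 * n + 20"
  have last: "\<exists>s' z'. runs (?loop) s []
      ((length r + 1) * ?t) s' z' \<and>
      v = (if s' rA = [] then None else Some z')"
    if "s rM = [True]" "runs Try_prefix s [] (try_cost n) s1 []"
      "runs Next_prefix s1 [] (5 * queue_bound n + 5 * n + 15) s2 z2"
      "s2 rM = []" "v = (if s2 rA = [] then None else Some z2)" for s s1 s2 :: store and z2 v r
  proof -
    have "runs (?loop) s []
      ((length r + 1) * ?t) s2 z2"
      by (rule runs_mono[OF runs_While[OF _ runs_Seq[OF that(2,3)] runs_While_end]])
        (use that in auto)
    with that show ?thesis by blast
  qed
  have stop: "\<exists>s' z'. runs (?loop) s []
      ((length r + 1) * ?t) s' z' \<and>
      search u c p r = (if s' rA = [] then None else Some z')"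
    if s: "s rW = u" "s rC = replicate c True" "idle s" "s rG = []" "s rM = [True]" "s rF = []"
      "s rP = rev p" "s rI = r" "s rA = []" "length p + length r \<le> n" "c \<le> n" "length u \<le> n"
    and q: "(\<forall>c'. qrun u c (input_queue p) \<noteq> Some (c', None)) \<or> r = []" for s c p r
  proof -
    have len: "length p \<le> n" "length (s rW) \<le> n" using s by auto
    from runs_Try_prefix[of s c p n "[]", OF s(2-7) len(1) s(11) len(2)]
    have tr: "runs Try_prefix s [] (try_cost n)
      (case qrun u c (input_queue p) of None \<Rightarrow> s(rC := [], rM := [])
       | Some (c', r) \<Rightarrow> settle r (s(rC := replicate c' True))) []"
      using s(1) by simp
    consider "qrun u c (input_queue p) = None"
      | c' y where "qrun u c (input_queue p) = Some (c', Some y)"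
      | c' where "qrun u c (input_queue p) = Some (c', None)" "r = []"
      using q by (metis option.exhaust surj_pair)
    then show ?thesis
    proof cases
      case 1
      let ?s1 = "s(rC := [], rM := [])"
      have next_run: "runs Next_prefix ?s1 [] (5 * queue_bound n + 5 * n + 15) ?s1 []"
        unfolding Next_prefix_def Let_def runs_wp using s by simp
      have tr1: "runs Try_prefix s [] (try_cost n) ?s1 []" using tr 1 by simp
      show ?thesis
        by (rule last[OF s(5) tr1 next_run]) (use 1 s in \<open>auto simp: search_None\<close>)
    next
      case 2
      let ?s1 = "settle (Some y) (s(rC := replicate c' True))"
      let ?s2 = "?s1(rM := [], rF := [])"
      have tr1: "runs Try_prefix s [] (try_cost n) ?s1 []" using tr 2 by simp
      have "Suc c * length u \<le> (n + 1) * n"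
        using s by (intro mult_le_mono) auto
      then have y: "length y \<le> queue_bound n"
        using length_qrun[OF 2] length_input_queue[of p] s(10) unfolding queue_bound_def mult_Suc
        by linarith
      have 21: "runs (Pop rM) ?s1 [] 1 (?s1(rM := [])) []"
        using s by (simp add: runs_wp settle_def)
      have 22: "runs (Emit rF) (?s1(rM := [])) [] (5 * length y + 1) ?s2 y"
        using runs_Emit[of rF "?s1(rM := [])" "[]"] by (simp add: settle_def)
      have 23: "runs (Emit rI) ?s2 y (5 * length r + 1) (?s2(rI := [])) (y @ r)"
        using runs_Emit[of rI ?s2 y] s by (simp add: settle_def)
      have next_run: "runs Next_prefix ?s1 [] (5 * queue_bound n + 5 * n + 15) (?s2(rI := [])) (y @ r)"
        unfolding Next_prefix_def Let_def
      proof (rule runs_mono[OF runs_Case[of _ rA "[True]"]])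
        show "?s1 rA = [True]" using s by (simp add: settle_def)
        show "runs (case [True] of [] \<Rightarrow> Case rM Skip Skip (Case rI (Pop rM) (Pop rI ;; Push rP False ;; Pop rC) (Pop rI ;; Push rP True ;; Pop rC))
            | b # _ \<Rightarrow> if b then Pop rM ;; Emit rF ;; Emit rI else Pop rM ;; Emit rF ;; Emit rI) ?s1 []
            (5 * length y + 5 * length r + 10) (?s2(rI := [])) (y @ r)"
          using runs_Seq[OF 21 runs_Seq[OF 22 23]] by (auto elim!: runs_mono)
      qed (use y s(10) in auto)
      show ?thesis
        by (rule last[OF s(5) tr1 next_run]) (use 2 s in \<open>auto simp: search_accept settle_def\<close>)
    next
      case 3
      let ?s1 = "s(rC := replicate c' True)"
      have tr1: "runs Try_prefix s [] (try_cost n) ?s1 []"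
        using tr 3 s by (simp add: settle_def fun_upd_idem)
      have next_run: "runs Next_prefix ?s1 [] (5 * queue_bound n + 5 * n + 15) (?s1(rM := [])) []"
        unfolding Next_prefix_def Let_def runs_wp using s 3 by simp
      show ?thesis
        by (rule last[OF s(5) tr1 next_run]) (use 3 s in auto)
    qed
  qed
  from assms show ?thesis
  proof (induction r arbitrary: s c p)
  case Nil
  then show ?case by (intro stop) auto
next
  case (Cons b r)
  show ?case
  proof (cases "\<exists>c'. qrun u c (input_queue p) = Some (c', None)")
    case False
    with Cons.prems show ?thesis by (intro stop) auto
  next
    case True
    then obtain c' where q: "qrun u c (input_queue p) = Some (c', None)" by blast
    let ?s1 = "s(rC := replicate c' True)"
    let ?s2 = "s(rC := replicate (c' - 1) True, rI := r, rP := b # s rP)"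
    have tr1: "runs Try_prefix s [] (try_cost n) ?s1 []"
    proof (rule runs_mono[OF runs_Try_prefix[of s c p n "[]"]])
      show "(case qrun (s rW) c (input_queue p) of None \<Rightarrow> s(rC := [], rM := [])
         | Some (c', r) \<Rightarrow> settle r (s(rC := replicate c' True))) = ?s1"
        using q Cons.prems by (simp add: settle_def fun_upd_idem)
    qed (use Cons.prems in auto)
    have next_run: "runs Next_prefix ?s1 [] 12 ?s2 []"
      unfolding Next_prefix_def Let_def runs_wp using Cons.prems
      by (cases b; cases c') (auto simp: fun_eq_iff)
    have "\<exists>s' z'. runs (?loop) ?s2 []
      ((length r + 1) * ?t) s' z' \<and>
      search u (c' - 1) (p @ [b]) r = (if s' rA = [] then None else Some z')"
      by (rule Cons.IH) (use Cons.prems qrun_clock[OF q] in \<open>auto simp: idle_def\<close>)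
    then obtain s' z' where rest: "runs (?loop) ?s2 []
      ((length r + 1) * ?t) s' z'"
      and res: "search u (c' - 1) (p @ [b]) r = (if s' rA = [] then None else Some z')" by blast
    have "runs (?loop) s []
      ((length (b # r) + 1) * ?t) s' z'"
      by (rule runs_mono[OF runs_While[OF _ runs_Seq[OF tr1 next_run] rest]])
        (use Cons.prems in auto)
    then show ?thesis using res q by auto
  qed
  qed
qed

lemma length_parse: "parse a z = Some (a', x) \<Longrightarrow> length a' + length x \<le> length a + length z"
  by (induction a z rule: parse.induct) auto

lemma evaluator_decides: "\<exists>p. decides Evaluator evaluator p"
proof -
  let ?X = "[:0, 1:] :: nat poly"
  define N where "N = 2 * ?X + 5 + (?X + 1) * ?X"
  define C where "C = (?X + 1) * (90 * N^2 + 10) + 2 * N + 20 * ?X + 50 + 5 * N + 5 * ?X + 20"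
  define P where "P = 40 * ?X + 60 + (?X + 1) * C"
  have N: "poly N n = queue_bound n" for n
    by (simp add: N_def queue_bound_def)
  have C: "poly C n = try_cost n + 5 * queue_bound n + 5 * n + 20" for n
    by (simp add: C_def try_cost_def N)
  have "decides Evaluator evaluator P"
    unfolding decides_def
  proof
    fix z :: word
    let ?n = "length z"
    let ?loop = "While rM (Try_prefix ;; Next_prefix)"
    let ?main = "Case rM Skip Skip (Wind ;; ?loop)"
    let ?T = "30 * ?n + 40 + (?n + 1) * poly C ?n"
    define s0 where "s0 = ((\<lambda>r. []) :: store)(0 := z)"
    have push: "runs (Push rH True) s0 [] 2 (s0(rH := [True])) []"
      by (simp add: runs_wp s0_def)
    have "\<exists>s1. runs (While rH Parse_step) (s0(rH := [True])) [] (6 * ?n + 10) s1 []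
     \<and> (case parse [] z of None \<Rightarrow> s1 rA = (s0(rH := [True])) rA \<and> s1 rM = []
        | Some (a', x) \<Rightarrow> s1 = (s0(rH := [True]))(rI := x, rT := a', rH := [], rM := [True]))"
      by (rule runs_Parse_loop) (auto simp: s0_def)
    then obtain s1
      where loop: "runs (While rH Parse_step) (s0(rH := [True])) [] (6 * ?n + 10) s1 []"
      and s1: "case parse [] z of None \<Rightarrow> s1 rA = (s0(rH := [True])) rA \<and> s1 rM = []
        | Some (a', x) \<Rightarrow> s1 = (s0(rH := [True]))(rI := x, rT := a', rH := [], rM := [True])"
      by blast
    have pars: "runs Parse s0 [] (6 * ?n + 15) s1 []"
      unfolding Parse_def by (rule runs_mono[OF runs_Seq[OF push loop]]) auto
    have "\<exists>s2 z2. runs ?main s1 [] ?T s2 z2 \<and>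
      evaluator z = (if s2 rA = [] then None else Some z2)"
    proof (cases "parse [] z")
      case None
      then have "runs ?main s1 [] ?T s1 []"
        using s1 by (simp add: runs_wp)
      moreover have "evaluator z = (if s1 rA = [] then None else Some [])"
        using None s1 unfolding evaluator_def by (simp add: s0_def)
      ultimately show ?thesis by blast
    next
      case (Some ax)
      then obtain a x where ax: "parse [] z = Some (a, x)" by (cases ax) auto
      have len: "length a + length x \<le> ?n" using length_parse[OF ax] by simp
      let ?s1 = "((\<lambda>r. []) :: store)(rI := x, rT := a, rM := [True])"
      let ?s2 = "((\<lambda>r. []) :: store)(rI := x, rM := [True], rW := rev a, rC := replicate (length x - length a) True)"
      have e1: "s1 = ?s1" using s1 ax by (auto simp: s0_def fun_eq_iff)
      have wind: "runs Wind ?s1 [] (30 * ?n + 10) ?s2 []"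
        by (rule runs_mono[OF runs_Wind]) (use len in \<open>auto simp: fun_eq_iff\<close>)
      have "\<exists>s' z'. runs ?loop ?s2 []
        ((length x + 1) * (try_cost ?n + 5 * queue_bound ?n + 5 * ?n + 20)) s' z' \<and>
        search (rev a) (length x - length a) [] x = (if s' rA = [] then None else Some z')"
        by (rule runs_loop) (use len in \<open>auto simp: idle_def\<close>)
      then obtain s' z' where main: "runs ?loop ?s2 [] ((length x + 1) * poly C ?n) s' z'"
        and res: "search (rev a) (length x - length a) [] x = (if s' rA = [] then None else Some z')"
        unfolding C by blast
      have "(length x + 1) * poly C ?n \<le> (?n + 1) * poly C ?n"
        using len by (intro mult_le_mono1) simp
      then have "runs (Wind ;; ?loop) ?s1 [] (30 * ?n + 20 + (?n + 1) * poly C ?n) s' z'"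
      proof (intro runs_mono[OF runs_Seq[OF wind main]] refl)
        assume "(length x + 1) * poly C ?n \<le> (?n + 1) * poly C ?n"
        then show "Suc (30 * ?n + 10 + (length x + 1) * poly C ?n) \<le> 30 * ?n + 20 + (?n + 1) * poly C ?n"
          by linarith
      qed
      note both = this
      have "runs ?main ?s1 [] (Suc (30 * ?n + 20 + (?n + 1) * poly C ?n)) s' z'"
        by (rule runs_Case[of _ rM "[True]"]) (use both in simp_all)
      then have "runs ?main s1 [] ?T s' z'"
        unfolding e1 by (rule runs_mono) auto
      moreover have "evaluator z = (if s' rA = [] then None else Some z')"
        unfolding evaluator_def ax using res by simp
      ultimately show ?thesis by blast
    qed
    then obtain s2 z2 where main: "runs ?main s1 [] ?T s2 z2"
      and res: "evaluator z = (if s2 rA = [] then None else Some z2)" by blast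
    have "runs Evaluator s0 [] (poly P ?n) s2 z2"
      unfolding Evaluator_def by (rule runs_mono[OF runs_Seq[OF pars main]]) (auto simp: P_def)
    then show "\<exists>t s z'. exec Evaluator ((\<lambda>r. [])(0 := z)) [] t s z' \<and> t \<le> poly P (length z) \<and>
       evaluator z = (if s 1 = [] then None else Some z')"
      using res unfolding runs_def s0_def by blast
  qed
  then show ?thesis by blast
qed

section \<open>The evaluator as a right-ideal morphism\<close>

lemma qrun_more: "qrun u c Q = Some (c', r) \<Longrightarrow> qrun u (c + k) Q = Some (c' + k, r)"
  by (induction c arbitrary: Q) (auto split: outcome.splits)

text \<open>With the sum of the two clocks both runs have the same result.\<close>

lemma qrun_unique:
  assumes "qrun u c Q = Some (c', r)" "qrun u d Q = Some (d', r')"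
  shows "r = r'"
  using qrun_more[OF assms(1), of d] qrun_more[OF assms(2), of c] by (simp add: add.commute)

lemma search_0: "search u 0 p r = None"
  by (cases r) auto

text \<open>More clock never changes the outcome of a trial that was completed, so the same prefix is found, and the
  additional letters \<open>w\<close> are only copied.\<close>

lemma search_append:
  "search u c p r = Some v \<Longrightarrow> search u (c + k) p (r @ w) = Some (v @ w)"
proof (induction r arbitrary: c p)
  case Nil
  then obtain c' where "qrun u c (input_queue p) = Some (c', Some v)"
    by (auto split: option.splits)
  from search_accept[OF qrun_more[OF this]] show ?case by simp
next
  case (Cons b r)
  then obtain c' res where q: "qrun u c (input_queue p) = Some (c', res)"
    by (cases "qrun u c (input_queue p)") auto
  note more = qrun_more[OF q, of k]
  show ?case
  proof (cases res)
    case (Some y)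
    then show ?thesis using search_accept[of u c p c' y "b # r"] q Cons.prems
        search_accept[of u "c + k" p "c' + k" y "(b # r) @ w"] more by simp
  next
    case None
    then have s: "search u (c' - 1) (p @ [b]) r = Some v" using Cons.prems q by simp
    \<comment> \<open>For \<open>c' = 0\<close> the truncated subtraction would not commute with the addition of \<open>k\<close>.\<close>
    then have "c' - 1 \<noteq> 0" by (metis search_0 option.distinct(1))
    then have "c' + k - 1 = (c' - 1) + k" by simp
    then show ?thesis using Cons.IH[OF s] None more by simp
  qed
qed

lemma parse_append: "parse a z = Some (a', x) \<Longrightarrow> parse a (z @ w) = Some (a', x @ w)"
  by (induction a z rule: parse.induct) auto

lemma parse_code: "parse a (code u @ [True, True] @ x) = Some (rev u @ a, x)"
  by (induction u arbitrary: a) (auto simp: code_def)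

lemma parse_length_eq: "parse a z = Some (a', x) \<Longrightarrow> length z + 2 * length a = 2 * length a' + 2 + length x"
  by (induction a z rule: parse.induct) auto

lemma evaluatorD:
  assumes "evaluator z = Some v"
  obtains a x where "parse [] z = Some (a, x)" "length a < length x"
    "search (rev a) (length x - length a) [] x = Some v"
proof -
  obtain a x where ax: "parse [] z = Some (a, x)"
    "search (rev a) (length x - length a) [] x = Some v"
    using assms unfolding evaluator_def by (auto split: option.splits)
  moreover from this(2) have "length x - length a \<noteq> 0"
    by (metis search_0 option.distinct(1))
  ultimately show ?thesis using that by simp
qed

lemma evaluator_morphism: "right_ideal_morphism evaluator"
  unfolding right_ideal_morphism_iff
proof (intro allI impI)
  fix z v w assume "evaluator z = Some v"
  then obtain a x where ax: "parse [] z = Some (a, x)" "length a < length x"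
    "search (rev a) (length x - length a) [] x = Some v" by (rule evaluatorD)
  have "length (x @ w) - length a = length x - length a + length w" using ax(2) by simp
  then show "evaluator (z @ w) = Some (v @ w)"
    using parse_append[OF ax(1), of w] search_append[OF ax(3), of "length w" w]
    by (simp add: evaluator_def)
qed

text \<open>Each of the prefixes before the successful one has cost at least two units: one for its
  trial and one for the change of prefix.\<close>

lemma search_lower:
  "search u c p r = Some v \<Longrightarrow> \<exists>q y w. r = q @ w \<and> v = y @ w \<and> 2 * length q < c"
proof (induction r arbitrary: c p)
  case Nil
  then have "c \<noteq> 0" by (metis search_0 option.distinct(1))
  then show ?case by (intro exI[of _ "[]"] exI[of _ v]) simp
next
  case (Cons b r)
  then obtain c' res where q: "qrun u c (input_queue p) = Some (c', res)"
    by (cases "qrun u c (input_queue p)") auto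
  note less = qrun_clock[OF q]
  show ?case
  proof (cases res)
    case (Some y)
    then have "v = y @ b # r" using q Cons.prems by simp
    then show ?thesis
      using less by (intro exI[of _ "[]"] exI[of _ y] exI[of _ "b # r"]) simp
  next
    case None
    then have "search u (c' - 1) (p @ [b]) r = Some v" using Cons.prems q by simp
    from Cons.IH[OF this] obtain q' y w where "r = q' @ w" "v = y @ w" "2 * length q' < c' - 1" by blast
    then show ?thesis
      using less by (intro exI[of _ "b # q'"] exI[of _ y] exI[of _ w]) simp
  qed
qed

lemma search_upper:
  "search u c p r = Some v \<Longrightarrow> length v \<le> 2 * length p + 3 * length r + 4 + c * length u"
proof (induction r arbitrary: c p)
  case Nil
  then obtain c' where "qrun u c (input_queue p) = Some (c', Some v)"
    by (auto split: option.splits)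
  from length_qrun[OF this] length_input_queue[of p] show ?case by simp
next
  case (Cons b r)
  then obtain c' res where q: "qrun u c (input_queue p) = Some (c', res)"
    by (cases "qrun u c (input_queue p)") auto
  show ?case
  proof (cases res)
    case (Some y)
    then have "v = y @ b # r" using q Cons.prems by simp
    then show ?thesis
      using length_qrun[of u c "input_queue p" c' y] q Some length_input_queue[of p] by simp
  next
    case None
    then have "search u (c' - 1) (p @ [b]) r = Some v" using Cons.prems q by simp
    from Cons.IH[OF this] have "length v \<le> 2 * length (p @ [b]) + 3 * length r + 4 + (c' - 1) * length u" .
    also have "(c' - 1) * length u \<le> c * length u"
      using qrun_clock[OF q] by (intro mult_le_mono1) simp
    finally show ?thesis by simp
  qed
qed

text \<open>Let \<open>z = code(u) 11 x\<close>, \<open>x = q w\<close> and \<open>v = y w\<close>. Then \<open>2 |q| < |x| - |u|\<close> means \<open>|u| + |q| < |w|\<close>, and so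
  \<open>|z| = 2 |u| + 2 + |q| + |w|\<close> is linear in \<open>|w| \<le> |v|\<close>.\<close>

lemma evaluator_balanced: "poly_balanced evaluator"
  unfolding poly_balanced_def
proof (intro exI allI impI)
  fix z v assume "evaluator z = Some v"
  then obtain a x where ax: "parse [] z = Some (a, x)" "length a < length x"
    "search (rev a) (length x - length a) [] x = Some v" by (rule evaluatorD)
  have len: "length z = 2 * length a + 2 + length x" using parse_length_eq[OF ax(1)] by simp
  have "length v \<le> 3 * length x + 4 + (length x - length a) * length a"
    using search_upper[OF ax(3)] by simp
  also have "\<dots> \<le> 3 * length z + 4 + length z * length z"
    using len by (intro add_mono mult_le_mono) auto
  finally have up: "length v \<le> 3 * length z + 4 + length z * length z" .
  from search_lower[OF ax(3)] obtain q y w where "x = q @ w" "v = y @ w"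
    "2 * length q < length x - length a" by blast
  then have "length z \<le> 4 * length v + 4" using len by simp
  then show "length v \<le> poly [:4, 4, 1:] (length z) \<and> length z \<le> poly [:4, 4, 1:] (length v)"
    using up by (simp add: algebra_simps)
qed

lemma evaluator_RMP: "evaluator \<in> RMP"
  using evaluator_decides polytime_if_decides evaluator_balanced evaluator_morphism
  unfolding RMP_def fP_def by blast

text \<open>The trials decide membership of the prefixes in \<open>dom f\<close>; at the first success the morphism
  property extends the value to the whole input.\<close>

lemma search_sound:
  assumes u: "queue_computes u f p" and f: "right_ideal_morphism f"
  shows "search u c q r = Some v \<Longrightarrow> f (q @ r) = Some v"
proof (induction r arbitrary: c q)
  case Nil
  then obtain c' where "qrun u c (input_queue q) = Some (c', Some v)"
    by (auto split: option.splits)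
  moreover obtain d where "qrun u d (input_queue q) = Some (0, f q)"
    using u unfolding queue_computes_def by blast
  ultimately show ?case using qrun_unique by fastforce
next
  case (Cons b r)
  then obtain c' res where q: "qrun u c (input_queue q) = Some (c', res)"
    by (cases "qrun u c (input_queue q)") auto
  moreover obtain d where "qrun u d (input_queue q) = Some (0, f q)"
    using u unfolding queue_computes_def by blast
  ultimately have res: "res = f q" by (rule qrun_unique)
  show ?case
  proof (cases res)
    case (Some y)
    then show ?thesis using q Cons.prems morphismD[OF f, of q y "b # r"] res by simp
  next
    case None
    then have "search u (c' - 1) (q @ [b]) r = Some v" using Cons.prems q by simp
    from Cons.IH[OF this] show ?thesis by simp
  qed
qed

text \<open>A clock that allows for \<open>poly p n\<close> steps on each of the \<open>|v| + 1\<close> prefixes of \<open>q v\<close> from \<open>q\<close> on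
  suffices to reach \<open>q v\<close>, unless a shorter prefix succeeds before.\<close>

lemma search_complete:
  assumes u: "queue_computes u f p"
  shows "f (q @ v) \<noteq> None \<Longrightarrow> (length v + 1) * (poly p n + 1) \<le> c \<Longrightarrow> length q + length v \<le> n
    \<Longrightarrow> search u c q (v @ w) \<noteq> None"
proof (induction v arbitrary: c q)
  case Nil
  obtain d where d: "d \<le> poly p (length q)" "qrun u d (input_queue q) = Some (0, f q)"
    using u unfolding queue_computes_def by blast
  have "d \<le> c" using d(1) Nil.prems(2,3) poly_nat_mono[of "length q" n p] by simp
  then obtain k where "c = d + k" using le_Suc_ex by blast
  moreover obtain y where "f q = Some y" using Nil.prems(1) by auto
  ultimately show ?case using qrun_more[OF d(2), of k] search_accept by simp
next
  case (Cons b v)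
  obtain d where d: "d \<le> poly p (length q)" "qrun u d (input_queue q) = Some (0, f q)"
    using u unfolding queue_computes_def by blast
  have dn: "d \<le> poly p n" using d(1) Cons.prems(3) poly_nat_mono[of "length q" n p] by simp
  have c: "(length v + 1) * (poly p n + 1) + (poly p n + 1) \<le> c"
    using Cons.prems(2) by simp
  then have "d \<le> c" using dn by simp
  then obtain k where k: "c = d + k" using le_Suc_ex by blast
  note q = qrun_more[OF d(2), of k, folded k]
  show ?case
  proof (cases "f q")
    case (Some y)
    then show ?thesis using q search_accept by simp
  next
    case None
    have "search u (k - 1) (q @ [b]) (v @ w) \<noteq> None"
    proof (rule Cons.IH)
      show "(length v + 1) * (poly p n + 1) \<le> k - 1" using c k dn by linarith
    qed (use Cons.prems in auto)
    then show ?thesis using q None by simp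
  qed
qed

section \<open>The quotient monoid\<close>

lemma morphism_prepend: "right_ideal_morphism (\<lambda>x. Some (w @ x))"
  by (simp add: right_ideal_morphism_iff)

lemma prepend_RMP: "(\<lambda>x. Some (w @ x)) \<in> RMP"
proof -
  have "poly_balanced (\<lambda>x. Some (w @ x))"
    unfolding poly_balanced_def by (intro exI[of _ "[:length w, 1:]"]) auto
  then show ?thesis
    using polytime_prepend morphism_prepend by (simp add: RMP_def fP_def)
qed

lemma comp_RMP: "f \<in> RMP \<Longrightarrow> g \<in> RMP \<Longrightarrow> f \<circ>\<^sub>m g \<in> RMP"
  by (auto simp: RMP_def fP_def poly_balanced_comp polytime_comp morphism_comp)

lemma Some_RMP: "Some \<in> RMP"
  using prepend_RMP[of "[]"] by simp

lemma code_prefix_eq: "code_prefix u = (\<lambda>x. Some ((code u @ [True, True]) @ x))"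
  by (simp add: code_prefix_def)

lemma evaluator_code_prefix: "(evaluator \<circ>\<^sub>m code_prefix u) x = search u (length x - length u) [] x"
  using parse_code[of "[]" u x] by (simp add: code_prefix_def evaluator_def)

text \<open>Evaluating \<open>u\<close> gives a restriction of \<open>f\<close> whose domain still absorbs that of \<open>f\<close>: it is enough
  that the input exceeds \<open>|u|\<close> by the clock which \<open>search_complete\<close> requires for \<open>x\<close>.\<close>

lemma evaluator_equiv:
  assumes f: "f \<in> RMP" and u: "queue_computes u f p"
  shows "(evaluator \<circ>\<^sub>m code_prefix u, f) \<in> poly_rel"
proof -
  let ?g = "evaluator \<circ>\<^sub>m code_prefix u"
  have g: "?g \<in> RMP"
    unfolding code_prefix_eq by (rule comp_RMP[OF evaluator_RMP prepend_RMP])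
  note mor = g[THEN RMP_morphism] f[THEN RMP_morphism]
  have sub: "f x = Some v" if "?g x = Some v" for x v
    using search_sound[OF u mor(2), of "length x - length u" "[]" x v] that
    by (simp add: evaluator_code_prefix)
  have "absorbs f ?g"
    unfolding absorbs_def
  proof (intro exI ballI allI impI)
    fix x y assume "x \<in> dom ?g" "prefix x y \<and> poly 0 (length x) \<le> length y"
    then show "y \<in> dom f" using sub morphism_dom[OF mor(2)] by blast
  qed
  moreover have "absorbs ?g f"
    unfolding absorbs_def
  proof (intro exI ballI allI impI)
    let ?\<tau> = "[:length u:] + ([:0, 1:] + 1) * (p + 1)"
    fix x y assume x: "x \<in> dom f" and y: "prefix x y \<and> poly ?\<tau> (length x) \<le> length y"
    then obtain w where w: "y = x @ w" by (auto simp: prefix_def)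
    have "search u (length y - length u) [] (x @ w) \<noteq> None"
      by (rule search_complete[OF u, where n = "length x"]) (use x y in \<open>auto simp: algebra_simps\<close>)
    then show "y \<in> dom ?g"
      by (simp add: domIff evaluator_code_prefix w)
  qed
  ultimately show ?thesis
    using f g sub by (auto simp: poly_rel_def poly_equiv_iff mor)
qed

lemma poly_class_eq_iff: "f \<in> RMP \<Longrightarrow> g \<in> RMP \<Longrightarrow> poly_class f = poly_class g \<longleftrightarrow> (f, g) \<in> poly_rel"
  unfolding poly_class_def using eq_equiv_class_iff[OF equiv_poly_rel] by blast

lemma MPpoly_carrier: "X \<in> carrier MPpoly \<longleftrightarrow> (\<exists>f\<in>RMP. X = poly_class f)"
  by (auto simp: MPpoly_def quotient_def poly_class_def)

lemma MPpoly_mult: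
  assumes "f \<in> RMP" "g \<in> RMP"
  shows "poly_class f \<otimes>\<^bsub>MPpoly\<^esub> poly_class g = poly_class (f \<circ>\<^sub>m g)"
proof -
  have "congruent2 poly_rel poly_rel (\<lambda>f g. poly_class (f \<circ>\<^sub>m g))"
  proof (rule congruent2I')
    fix f1 f2 g1 g2 assume "(f1, f2) \<in> poly_rel" "(g1, g2) \<in> poly_rel"
    then have "(f1 \<circ>\<^sub>m g1, f2 \<circ>\<^sub>m g2) \<in> poly_rel"
      by (auto simp: poly_rel_def comp_RMP poly_equiv_comp)
    then show "poly_class (f1 \<circ>\<^sub>m g1) = poly_class (f2 \<circ>\<^sub>m g2)"
      using poly_class_eq_iff by (auto simp: poly_rel_def)
  qed
  from UN_equiv_class2[OF equiv_poly_rel equiv_poly_rel this assms]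
  show ?thesis by (simp add: MPpoly_def poly_class_def)
qed

lemma monoid_MPpoly: "monoid MPpoly"
proof (rule monoidI)
  show "\<one>\<^bsub>MPpoly\<^esub> \<in> carrier MPpoly"
    unfolding MPpoly_carrier using Some_RMP by (auto simp: MPpoly_def)
  fix X Y assume X: "X \<in> carrier MPpoly" and Y: "Y \<in> carrier MPpoly"
  then obtain f g where fg: "f \<in> RMP" "g \<in> RMP" "X = poly_class f" "Y = poly_class g"
    unfolding MPpoly_carrier by blast
  then show "X \<otimes>\<^bsub>MPpoly\<^esub> Y \<in> carrier MPpoly"
    unfolding MPpoly_carrier using MPpoly_mult comp_RMP by blast
  have one: "\<one>\<^bsub>MPpoly\<^esub> = poly_class Some" by (simp add: MPpoly_def)
  have "Some \<circ>\<^sub>m f = f" "f \<circ>\<^sub>m Some = f" by (auto simp: map_comp_def fun_eq_iff split: option.split)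
  then show "\<one>\<^bsub>MPpoly\<^esub> \<otimes>\<^bsub>MPpoly\<^esub> X = X" "X \<otimes>\<^bsub>MPpoly\<^esub> \<one>\<^bsub>MPpoly\<^esub> = X"
    using fg Some_RMP by (simp_all add: one MPpoly_mult)
  fix Z assume "Z \<in> carrier MPpoly"
  then obtain h where h: "h \<in> RMP" "Z = poly_class h"
    unfolding MPpoly_carrier by blast
  have "f \<circ>\<^sub>m g \<circ>\<^sub>m h = f \<circ>\<^sub>m (g \<circ>\<^sub>m h)"
    by (auto simp: map_comp_def fun_eq_iff split: option.split)
  then show "X \<otimes>\<^bsub>MPpoly\<^esub> Y \<otimes>\<^bsub>MPpoly\<^esub> Z = X \<otimes>\<^bsub>MPpoly\<^esub> (Y \<otimes>\<^bsub>MPpoly\<^esub> Z)"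
    using fg h by (simp add: MPpoly_mult comp_RMP)
qed

lemma evaluator_universal:
  assumes "F \<in> carrier MPpoly"
  obtains u where "poly_class (evaluator \<circ>\<^sub>m code_prefix u) = F"
proof -
  obtain f where f: "f \<in> RMP" "F = poly_class f"
    using assms unfolding MPpoly_carrier by blast
  then obtain u p where "queue_computes u f p"
    using queue_computes_if_polytime unfolding RMP_def fP_def by blast
  from evaluator_equiv[OF f(1) this] have "poly_class (evaluator \<circ>\<^sub>m code_prefix u) = F"
    using f poly_class_eq_iff by (auto simp: poly_rel_def)
  then show ?thesis by (rule that)
qed

lemma evaluation_element_evaluator: "evaluation_element (poly_class evaluator)"
  unfolding evaluation_element_def
proof (intro conjI bexI[of _ evaluator] ballI)
  show "poly_class evaluator \<in> carrier MPpoly"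
    unfolding MPpoly_carrier using evaluator_RMP by blast
  show "evaluator \<in> poly_class evaluator"
    unfolding poly_class_def by (rule equiv_class_self[OF equiv_poly_rel evaluator_RMP])
  show "\<exists>u. poly_class (evaluator \<circ>\<^sub>m code_prefix u) = F" if "F \<in> carrier MPpoly" for F
    using evaluator_universal[OF that] by blast
qed

theorem theorem4p7:
  shows "(\<exists>E. evaluation_element E) \<and> finitely_generated_monoid MPpoly"
proof
  show "\<exists>E. evaluation_element E" using evaluation_element_evaluator by blast
  let ?pre = "\<lambda>w. poly_class (\<lambda>x. Some (w @ x))"
  let ?S = "{poly_class evaluator, ?pre [False], ?pre [True]}"
  have "?pre w \<in> carrier MPpoly" for w
    unfolding MPpoly_carrier using prepend_RMP by blast
  moreover have "poly_class evaluator \<in> carrier MPpoly"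
    using evaluation_element_evaluator by (simp add: evaluation_element_def)
  ultimately have "?S \<subseteq> carrier MPpoly" by blast
  moreover have "H = carrier MPpoly" if H: "submonoid H MPpoly" and S: "?S \<subseteq> H" for H
  proof
    show "H \<subseteq> carrier MPpoly" using H by (rule submonoid.subset)
    have pre: "?pre w \<in> H" for w
    proof (induction w)
      case Nil
      have "?pre [] = \<one>\<^bsub>MPpoly\<^esub>" by (simp add: MPpoly_def)
      then show ?case using submonoid.one_closed[OF H] by simp
    next
      case (Cons b w)
      have "(\<lambda>x. Some ([b] @ x)) \<circ>\<^sub>m (\<lambda>x. Some (w @ x)) = (\<lambda>x. Some ((b # w) @ x))"
        by (simp add: map_comp_def)
      then have "?pre (b # w) = ?pre [b] \<otimes>\<^bsub>MPpoly\<^esub> ?pre w"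
        using MPpoly_mult[OF prepend_RMP prepend_RMP] by metis
      moreover have "?pre [b] \<in> H" using S by (cases b) auto
      ultimately show ?case using Cons submonoid.m_closed[OF H] by simp
    qed
    show "carrier MPpoly \<subseteq> H"
    proof
      fix F assume "F \<in> carrier MPpoly"
      then obtain u where "poly_class (evaluator \<circ>\<^sub>m code_prefix u) = F"
        by (rule evaluator_universal)
      then have eq: "F = poly_class evaluator \<otimes>\<^bsub>MPpoly\<^esub> ?pre (code u @ [True, True])"
        using MPpoly_mult[OF evaluator_RMP prepend_RMP] by (simp only: code_prefix_eq)
      have "poly_class evaluator \<in> H" using S by blast
      from submonoid.m_closed[OF H this pre] show "F \<in> H" unfolding eq .
    qed
  qed
  ultimately show "finitely_generated_monoid MPpoly"
    unfolding finitely_generated_monoid_def using monoid_MPpoly by (intro conjI exI[of _ ?S]) auto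
qed

end
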